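(* Let $(M,d,\mu)$ be a quasi-$b$-geodesic metric measure space satisfying $(VD)_{\mathrm{loc}}$, $(VD)_\infty$ and the Poincaré inequality $(P)_h$ at scale $h$. Suppose that a Markov operator $P$ has a kernel $p$ that is $(h,h')$-compatible with respect to $\mu$ for some $h>b$. Then there exist $c\in(0,1)$, $r_0>0$, $C_E>0$ such that for all $x\in M$, all $r\ge r_0$ and all non-negative functions $u$ (defined at least on $B(x,r+h')$) that are $P$-harmonic in $B(x,r)$, $$\operatorname*{ess\,sup}_{B(x,cr)}u\le C_E\operatorname*{ess\,inf}_{B(x,cr)}u.$$
   Context: Metric measure space: locally compact metric space with a Radon measure $\mu$ of full support; $B(x,r)=\{y:d(x,y)\le r\}$, $V(x,r)=\mu(B(x,r))$. Quasi-$b$-geodesic: there is $C$ with $d_b\le Cd$, where $d_b(x,y)=\inf\sum_i d(x_i,x_{i+1})$ over sequences $x=x_0,\dots,x_m=y$ with $d(x_i,x_{i+1})\le b$. $(VD)_{\mathrm{loc}}$: for each $r>0$ there is $C_r$ with $V(x,2r)\le C_rV(x,r)$ for all $x$. $(VD)_\infty$: there are $r_0,C>0$ with $V(x,2r)\le CV(x,r)$ for all $x$, $r\ge r_0$. $|\nabla f|_h(x)=\left(\frac1{V(x,h)}\int_{B(x,h)}|f(y)-f(x)|^2\mu(dy)\right)^{1/2}$; $(P)_h$: there are $C_1>0$, $C_2\ge1$, $r_0>0$ with $\int_{B(x,r)}|f-f_{B(x,r)}|^2d\mu\le C_1r^2\int_{B(x,C_2r)}|\nabla f|_h^2d\mu$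 for all $f\in L^\infty_{\mathrm{loc}}$, $x$, $r\ge r_0$. Kernel: $p=p_1\ge0$ with $\int p_1(x,y)\mu(dy)=1$, $p_1(x,\cdot)\in L^\infty$, $Pf(x)=\int p_1(x,y)f(y)\mu(dy)$, $p_2(x,y)=\int p_1(x,z)p_1(y,z)\mu(dz)$. $(h,h')$-compatible: $p_1(x,y)=p_1(y,x)$ $\mu\times\mu$-a.e.; there are $c_1,C_1>0$, $h'\ge h$, with $\frac{c_1}{V(x,h)}\mathbf{1}_{B(x,h)}(y)\le p_1(x,y)\le\frac{C_1}{V(x,h')}\mathbf{1}_{B(x,h')}(y)$ for all $x$, $\mu$-a.e. $y$; there is $\alpha>0$ with $p_2\ge\alpha p_1$ ($\mu$-a.e.). A function $u$ is $P$-harmonic in $B(x,r)$ if $u(y)=Pu(y)$ for all $y\in B(x,r)$ (this depends only on the values of $u$ on $B(x,r+h')$). *)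

theory Defs
  imports "HOL-Probability.Probability"
begin

text \<open>Balls are closed balls: B(x,r) = cball x r; V(x,r) = emeasure M (cball x r).\<close>

definition radon_mm_space :: "'a::metric_space measure \<Rightarrow> bool" where
  "radon_mm_space M \<longleftrightarrow>
     locally compact (UNIV :: 'a set) \<and>
     space M = UNIV \<and> sets M = sets borel \<and>
     (\<forall>K. compact K \<longrightarrow> emeasure M K < \<infinity>) \<and>
     (\<forall>A \<in> sets M. emeasure M A = (INF U \<in> {U. open U \<and> A \<subseteq> U}. emeasure M U)) \<and>
     (\<forall>U. open U \<longrightarrow> emeasure M U = (SUP K \<in> {K. compact K \<and> K \<subseteq> U}. emeasure M K)) \<and>
     (\<forall>x r. r > 0 \<longrightarrow> emeasure M (ball x r) > 0)"

definition b_chains :: "real \<Rightarrow> 'a::metric_space \<Rightarrow> 'a \<Rightarrow> ((nat \<Rightarrow> 'a) \<times> nat) set" where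
  "b_chains b x y = {(z, m). z 0 = x \<and> z m = y \<and> (\<forall>i<m. dist (z i) (z (Suc i)) \<le> b)}"

definition dist_b :: "real \<Rightarrow> 'a::metric_space \<Rightarrow> 'a \<Rightarrow> ennreal" where
  "dist_b b x y = (INF zm \<in> b_chains b x y. ennreal (\<Sum>i<snd zm. dist (fst zm i) (fst zm (Suc i))))"

definition quasi_b_geodesic :: "real \<Rightarrow> 'a::metric_space itself \<Rightarrow> bool" where
  "quasi_b_geodesic b T \<longleftrightarrow> (\<exists>C. \<forall>x y::'a. dist_b b x y \<le> ennreal (C * dist x y))"

definition VD_loc :: "'a::metric_space measure \<Rightarrow> bool" where
  "VD_loc M \<longleftrightarrow> (\<forall>r>0. \<exists>C. \<forall>x. emeasure M (cball x (2*r)) \<le> ennreal C * emeasure M (cball x r))"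

definition VD_infty :: "'a::metric_space measure \<Rightarrow> bool" where
  "VD_infty M \<longleftrightarrow> (\<exists>r0>0. \<exists>C>0. \<forall>x r. r \<ge> r0 \<longrightarrow>
      emeasure M (cball x (2*r)) \<le> ennreal C * emeasure M (cball x r))"

definition Linf_loc :: "'a::metric_space measure \<Rightarrow> ('a \<Rightarrow> real) \<Rightarrow> bool" where
  "Linf_loc M f \<longleftrightarrow> f \<in> borel_measurable M \<and>
     (\<forall>K. compact K \<longrightarrow> (\<exists>B. AE y in M. y \<in> K \<longrightarrow> \<bar>f y\<bar> \<le> B))"

definition grad_sq :: "'a::metric_space measure \<Rightarrow> real \<Rightarrow> ('a \<Rightarrow> real) \<Rightarrow> 'a \<Rightarrow> ennreal" where
  "grad_sq M h f y = (\<integral>\<^sup>+ z. ennreal ((f z - f y)^2) * indicator (cball y h) z \<partial>M)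
                       / emeasure M (cball y h)"

definition ball_avg :: "'a::metric_space measure \<Rightarrow> ('a \<Rightarrow> real) \<Rightarrow> 'a set \<Rightarrow> real" where
  "ball_avg M f A = (LINT y:A|M. f y) / measure M A"

definition poincare_h :: "'a::metric_space measure \<Rightarrow> real \<Rightarrow> bool" where
  "poincare_h M h \<longleftrightarrow> (\<exists>C1>0. \<exists>C2\<ge>1. \<exists>r0>0. \<forall>f x r. Linf_loc M f \<longrightarrow> r \<ge> r0 \<longrightarrow>
     (\<integral>\<^sup>+ y. ennreal ((f y - ball_avg M f (cball x r))^2) * indicator (cball x r) y \<partial>M)
       \<le> ennreal (C1 * r^2) * (\<integral>\<^sup>+ y. grad_sq M h f y * indicator (cball x (C2*r)) y \<partial>M))"

definition markov_kernel :: "'a::metric_space measure \<Rightarrow> ('a \<Rightarrow> 'a \<Rightarrow> real) \<Rightarrow> bool" where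
  "markov_kernel M p \<longleftrightarrow>
     (\<lambda>z. p (fst z) (snd z)) \<in> borel_measurable (M \<Otimes>\<^sub>M M) \<and>
     (\<forall>x y. p x y \<ge> 0) \<and>
     (\<forall>x. integrable M (p x) \<and> (\<integral>y. p x y \<partial>M) = 1) \<and>
     (\<forall>x. \<exists>B. AE y in M. \<bar>p x y\<bar> \<le> B)"

definition markov_op :: "'a::metric_space measure \<Rightarrow> ('a \<Rightarrow> 'a \<Rightarrow> real) \<Rightarrow> ('a \<Rightarrow> real) \<Rightarrow> 'a \<Rightarrow> real" where
  "markov_op M p f x = (\<integral>y. p x y * f y \<partial>M)"

definition kernel2 :: "'a::metric_space measure \<Rightarrow> ('a \<Rightarrow> 'a \<Rightarrow> real) \<Rightarrow> 'a \<Rightarrow> 'a \<Rightarrow> real" where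
  "kernel2 M p x y = (\<integral>z. p x z * p y z \<partial>M)"

definition compatible :: "'a::metric_space measure \<Rightarrow> ('a \<Rightarrow> 'a \<Rightarrow> real) \<Rightarrow> real \<Rightarrow> real \<Rightarrow> bool" where
  "compatible M p h h' \<longleftrightarrow>
     (AE z in M \<Otimes>\<^sub>M M. p (fst z) (snd z) = p (snd z) (fst z)) \<and>
     h' \<ge> h \<and>
     (\<exists>c1>0. \<exists>C1>0. \<forall>x. AE y in M.
        ennreal c1 / emeasure M (cball x h) * indicator (cball x h) y \<le> ennreal (p x y) \<and>
        ennreal (p x y) \<le> ennreal C1 / emeasure M (cball x h') * indicator (cball x h') y) \<and>
     (\<exists>\<alpha>>0. AE z in M \<Otimes>\<^sub>M M. kernel2 M p (fst z) (snd z) \<ge> \<alpha> * p (fst z) (snd z))"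

definition P_harmonic_in :: "'a::metric_space measure \<Rightarrow> ('a \<Rightarrow> 'a \<Rightarrow> real) \<Rightarrow> ('a \<Rightarrow> real) \<Rightarrow> 'a set \<Rightarrow> bool" where
  "P_harmonic_in M p u A \<longleftrightarrow>
     (\<forall>y\<in>A. integrable M (\<lambda>z. p y z * u z) \<and> u y = markov_op M p u y)"

definition esssup_on :: "'a measure \<Rightarrow> 'a set \<Rightarrow> ('a \<Rightarrow> real) \<Rightarrow> ereal" where
  "esssup_on M A u = esssup (restrict_space M A) (\<lambda>y. ereal (u y))"

definition essinf_on :: "'a measure \<Rightarrow> 'a set \<Rightarrow> ('a \<Rightarrow> real) \<Rightarrow> ereal" where
  "essinf_on M A u = - esssup (restrict_space M A) (\<lambda>y. - ereal (u y))"

end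

theory Submission
  imports Defs
begin

text \<open>
  Moser's argument, with the De Giorgi iteration as its mean value inequality. Testing
  \<open>w \<le> P w\<close> with \<open>\<phi>\<^sup>2 w\<close> gives a Caccioppoli inequality in the energy
  \<open>\<integral>\<integral> p(x,y) (f x - f y)\<^sup>2\<close>; the Poincare inequality, averaged over the centres of the
  balls, gives a Faber-Krahn inequality; iterating the two over levels and radii, down to the scale
  at which one application of the kernel bounds suffices, bounds a subharmonic function pointwise
  by its quadratic mean. For positive harmonic \<open>u\<close> the function \<open>w = max 0 (ln (a / u))\<close> is
  subharmonic, its energy on a ball of radius \<open>R\<close> is at most \<open>C V(x,R) / R\<^sup>2\<close>, and if \<open>u \<ge> a\<close> on
  a fixed fraction of the ball then the Poincare inequality bounds the quadratic mean of \<open>w\<close>; so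
  \<open>u \<ge> \<delta> a\<close> on the ball of twice the radius. Applied on successively doubled balls this bounds
  \<open>u\<close> below with polynomial loss \<open>(R/\<rho>)\<^sup>\<gamma>\<close>. Now maximise \<open>u y (\<rho> - dist x y)\<^sup>\<gamma>\<close> over
  the ball of radius \<open>\<rho>\<close>: near an almost maximal \<open>y\<close>, \<open>u\<close> is at most a constant times \<open>u y\<close>, so
  the mean value inequality makes \<open>u\<close> comparable to \<open>u y\<close> on a fixed fraction of a ball of radius
  comparable to \<open>\<rho> - dist x y\<close>, and the spreading estimate cancels the weight exactly. Below
  the scale where this works, and to see that the supremum is finite, balls are joined by chains
  with steps at most \<open>b < h\<close>.
\<close>

text \<open>The walk jumps up to distance \<open>h'\<close>, so no regularity can be expected at
  smaller scales: the estimates of doubling, mean value and growth hold only above a threshold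
  radius, and the iteration over levels has to stop there. Levels are used rather than powers
  because \<open>max 0 (w - t)\<close> is again subharmonic, and because level sets that fill at
  most half of every small ball are all that the Poincare inequality needs to control a function by
  its energy; no Sobolev inequality enters. The kernel is nonlocal, so a cutoff is felt up to
  distance \<open>h'\<close> outside its support; this is the origin of the margins
  \<open>h'\<close> between support and ball. The weighted maximum takes the place of a
  John-Nirenberg lemma: logarithms are only ever bounded on one side. It needs a supremum known to
  be finite, but not how large it is, so the constant behind that finiteness may depend on the
  radius. Energies are nonnegative integrals with values in \<open>ennreal\<close>; no integrability
  is checked, but a term must be shown finite before it is cancelled from both sides.\<close>

lemma doubling_power:
  fixes V :: "'a \<Rightarrow> real \<Rightarrow> real"
  assumes vd: "\<And>x r. r1 \<le> r \<Longrightarrow> V x (2*r) \<le> D * V x r" and D: "D \<ge> 0" and r: "r1 \<le> r" "0 \<le> r"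
  shows "V x (2^n * r) \<le> D^n * V x r"
proof (induction n)
  case (Suc n)
  have "1 * r \<le> 2^n * r" by (rule mult_right_mono) (use r in auto)
  then have "r1 \<le> 2^n * r" using r by simp
  from vd[OF this, of x] have "V x (2^Suc n * r) \<le> D * V x (2^n * r)" by (simp add: mult.assoc)
  also have "\<dots> \<le> D * (D^n * V x r)" by (rule mult_left_mono[OF Suc D])
  finally show ?case by (simp add: mult.assoc)
qed simp

text \<open>Kept outside the locale because the exchange of integrals also needs it while the locale
  assumptions are being established.\<close>

lemma sigma_finite_of_finite_cballs:
  fixes M :: "'a::metric_space measure"
  assumes "space M = UNIV" "sets M = sets borel" "\<And>x r. emeasure M (cball x r) \<noteq> \<infinity>"
  shows "sigma_finite_measure M"
proof
  fix x0 :: 'a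
  have "(\<Union>n::nat. cball x0 (real n)) = UNIV"
    using real_arch_simple by (force simp: set_eq_iff)
  then show "\<exists>A. countable A \<and> A \<subseteq> sets M \<and> \<Union>A = space M \<and> (\<forall>a\<in>A. emeasure M a \<noteq> \<infinity>)"
    using assms by (intro exI[of _ "range (\<lambda>n::nat. cball x0 (real n))"]) auto
qed

text \<open>The hypotheses in working form: volumes are finite, doubling is uniform in the centre
  and in all radii above any given \<open>r1\<close>, and the Poincare inequality bounds the
  oscillation about some constant \<open>m\<close> by the energy of the kernel, which dominates the
  gradient at scale \<open>h\<close> through the lower kernel bound.\<close>

locale random_walk_space =
  fixes M :: "'a::metric_space measure" and p :: "'a \<Rightarrow> 'a \<Rightarrow> real"
    and h h' c1 C1 CP C2 r0 :: real
  assumes space_M [simp]: "space M = UNIV" and sets_M [simp]: "sets M = sets borel"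
    and emeasure_cball_finite: "emeasure M (cball x r) < \<infinity>"
    and emeasure_cball_pos: "0 < r \<Longrightarrow> 0 < emeasure M (cball x r)"
    and doubling: "0 < r1 \<Longrightarrow>
      \<exists>D. \<forall>x. \<forall>r\<ge>r1. measure M (cball x (2*r)) \<le> D * measure M (cball x r)"
    and h_pos: "0 < h" and h_le: "h \<le> h'"
    and p_meas: "(\<lambda>z. p (fst z) (snd z)) \<in> borel_measurable (M \<Otimes>\<^sub>M M)"
    and p_nonneg: "0 \<le> p x y"
    and p_mass: "(\<integral>\<^sup>+y. ennreal (p x y) \<partial>M) = 1"
    and p_sym: "AE z in M \<Otimes>\<^sub>M M. p (fst z) (snd z) = p (snd z) (fst z)"
    and c1_pos: "0 < c1" and C1_pos: "0 < C1"
    and p_lower: "AE y in M. y \<in> cball x h \<longrightarrow> c1 / measure M (cball x h) \<le> p x y"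
    and p_upper: "AE y in M. p x y \<le> C1 / measure M (cball x h') * indicator (cball x h') y"
    and CP_pos: "0 < CP" and C2_ge: "1 \<le> C2" and r0_pos: "0 < r0"
    and poincare: "f \<in> borel_measurable M \<Longrightarrow> (\<And>y. \<bar>f y\<bar> \<le> B) \<Longrightarrow> r0 \<le> r \<Longrightarrow>
      \<exists>m. (\<integral>\<^sup>+y. ennreal ((f y - m)^2) * indicator (cball x r) y \<partial>M)
        \<le> ennreal (CP * r^2) *
          (\<integral>\<^sup>+y. (\<integral>\<^sup>+z. ennreal (p y z) * ennreal ((f y - f z)^2) \<partial>M) * indicator (cball x (C2*r)) y \<partial>M)"
begin

section \<open>Volume comparison, finite nets and measurability of the distance\<close>

abbreviation V :: "'a \<Rightarrow> real \<Rightarrow> real" where "V x r \<equiv> measure M (cball x r)"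

lemma emeasure_cball: "emeasure M (cball x r) = ennreal (V x r)"
  using emeasure_cball_finite[of x r] by (intro emeasure_eq_ennreal_measure) auto

lemma V_pos: "0 < r \<Longrightarrow> 0 < V x r"
  using emeasure_cball_pos[of r x] by (simp add: emeasure_cball)

lemma cball_sets [measurable]: "cball x r \<in> sets M" by simp

lemma V_mono: "dist x y + r \<le> s \<Longrightarrow> V x r \<le> V y s"
proof -
  assume a: "dist x y + r \<le> s"
  have "cball x r \<subseteq> cball y s"
  proof
    fix z assume "z \<in> cball x r"
    then have "dist y z \<le> dist x y + r" using dist_triangle[of y z x] by (simp add: dist_commute)
    then show "z \<in> cball y s" using a by simp
  qed
  then show ?thesis using emeasure_cball_finite
    by (intro measure_mono_fmeasurable) (auto simp: fmeasurable_def)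
qed

text \<open>\<open>cball x R\<close> lies in \<open>cball y (K * r)\<close>, hence in
  \<open>cball y (2^n * r)\<close> with \<open>n\<close> depending on \<open>K\<close> alone. One
  constant, fixed by \<open>r1\<close> and \<open>K\<close>, thus serves every simultaneous change
  of centre and radius.\<close>

lemma volume_comparison:
  assumes "0 < r1"
  shows "\<exists>C>0. \<forall>x y r R. r1 \<le> r \<longrightarrow> dist x y + R \<le> K * r \<longrightarrow> V x R \<le> C * V y r"
proof -
  obtain D where D: "\<And>x r. r1 \<le> r \<Longrightarrow> V x (2*r) \<le> D * V x r" using doubling[OF assms] by blast
  have Dpos: "0 \<le> D"
  proof (rule ccontr)
    assume "\<not> 0 \<le> D"
    fix x :: 'a
    from \<open>\<not> 0 \<le> D\<close> have "D * V x r1 < 0" using V_pos[OF assms, of x] by (simp add: mult_neg_pos)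
    moreover have "0 \<le> V x (2 * r1)" by simp
    ultimately show False using D[of r1 x] by linarith
  qed
  obtain n where n: "K \<le> 2^n"
    using real_arch_pow[of 2 K] by (auto intro: less_imp_le)
  have "V x R \<le> (D^n + 1) * V y r" if "r1 \<le> r" "dist x y + R \<le> K * r" for x y r R
  proof -
    have r: "0 < r" using that assms by linarith
    have "K * r \<le> 2^n * r" using n r by simp
    then have "V x R \<le> V y (2^n * r)" using that by (intro V_mono) linarith
    also have "\<dots> \<le> D^n * V y r"
      by (rule doubling_power[where V=V and ?r1.0=r1]) (use D Dpos that r in auto)
    also have "\<dots> \<le> (D^n + 1) * V y r" by (simp add: algebra_simps)
    finally show ?thesis .
  qed
  moreover have "0 < D^n + 1" using Dpos by (simp add: add_nonneg_pos)
  ultimately show ?thesis by blast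
qed

sublocale sigma_finite_measure M
  by (rule sigma_finite_of_finite_cballs) (simp_all add: emeasure_cball)

sublocale MM: pair_sigma_finite M M ..

text \<open>A largest \<open>s\<close>-separated subset of the ball is a net. It exists because the
  balls of radius \<open>s/3\<close> about its points are disjoint, lie in the ball of radius
  \<open>\<bar>k\<bar> + s\<close>, and each carry at least the fraction \<open>1/C\<close> of its
  volume.\<close>

lemma finite_net:
  assumes s: "0 < s"
  shows "\<exists>S. finite S \<and> (\<forall>y\<in>cball (x0::'a) k. \<exists>q\<in>S. dist y q < s)"
proof -
  obtain C where C: "0 < C" "\<And>x y r R. s/3 \<le> r \<Longrightarrow> dist x y + R \<le> (6*(\<bar>k\<bar>+s)/s) * r \<Longrightarrow> V x R \<le> C * V y r"
    using volume_comparison[of "s/3" "6*(\<bar>k\<bar>+s)/s"] s by auto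
  define sep where "sep S \<longleftrightarrow> finite S \<and> S \<subseteq> cball x0 k \<and> (\<forall>a\<in>S. \<forall>b\<in>S. a \<noteq> b \<longrightarrow> s \<le> dist a b)" for S
  have bound: "real (card S) \<le> C" if "sep S" for S
  proof -
    have fin: "finite S" using that by (simp add: sep_def)
    define W where "W = V x0 (\<bar>k\<bar>+s)"
    have W: "0 < W" unfolding W_def using s by (intro V_pos) auto
    have ge: "W / C \<le> V a (s/3)" if "a \<in> S" for a
    proof -
      have "dist x0 a \<le> \<bar>k\<bar>" using \<open>sep S\<close> that by (auto simp: sep_def)
      then have "dist x0 a + (\<bar>k\<bar>+s) \<le> (6*(\<bar>k\<bar>+s)/s) * (s/3)" using s by simp
      then show ?thesis unfolding W_def using C(2)[of "s/3" x0 a "\<bar>k\<bar>+s"] C(1) by (simp add: field_simps)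
    qed
    have disj: "disjoint_family_on (\<lambda>a. cball a (s/3)) S"
      unfolding disjoint_family_on_def
    proof (intro ballI impI)
      fix a b assume ab: "a \<in> S" "b \<in> S" "a \<noteq> b"
      then have "s \<le> dist a b" using that by (auto simp: sep_def)
      have False if "dist a z \<le> s/3" "dist b z \<le> s/3" for z
        using that \<open>s \<le> dist a b\<close> s dist_triangle[of a b z] by (simp add: dist_commute)
      then show "cball a (s/3) \<inter> cball b (s/3) = {}" by auto
    qed
    have sub: "(\<Union>a\<in>S. cball a (s/3)) \<subseteq> cball x0 (\<bar>k\<bar>+s)"
    proof
      fix z assume "z \<in> (\<Union>a\<in>S. cball a (s/3))"
      then obtain a where "a \<in> S" "dist a z \<le> s/3" by auto
      moreover then have "dist x0 a \<le> \<bar>k\<bar>" using that by (auto simp: sep_def)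
      ultimately show "z \<in> cball x0 (\<bar>k\<bar>+s)" using dist_triangle[of x0 z a] s by simp
    qed
    have "real (card S) * (W / C) \<le> (\<Sum>a\<in>S. V a (s/3))" using sum_mono[OF ge, where K=S] by simp
    also have "\<dots> = measure M (\<Union>a\<in>S. cball a (s/3))"
      using fin disj by (intro measure_finite_Union[symmetric]) (auto simp: emeasure_cball)
    also have "\<dots> \<le> W" unfolding W_def using sub emeasure_cball_finite fin
      by (intro measure_mono_fmeasurable) (auto simp: fmeasurable_def)
    finally show ?thesis using W C by (simp add: field_simps)
  qed
  obtain S where S: "sep S" and max: "\<And>T. sep T \<Longrightarrow> card T \<le> card S"
  proof -
    have "sep {}" by (simp add: sep_def)
    moreover have "\<forall>T. sep T \<longrightarrow> card T < Suc (nat \<lceil>C\<rceil>)" 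
      using bound by (auto simp: less_Suc_eq_le) (meson of_nat_le_iff order_trans real_nat_ceiling_ge)
    ultimately show ?thesis using ex_has_greatest_nat[of sep "{}" card] that by blast
  qed
  have "\<exists>q\<in>S. dist y q < s" if y: "y \<in> cball x0 k" for y
  proof (rule ccontr)
    assume a: "\<not> ?thesis"
    then have "y \<notin> S" using s by force
    moreover have "sep (insert y S)" using S y a by (auto simp: sep_def not_less dist_commute)
    ultimately show False using max[of "insert y S"] S by (simp add: sep_def)
  qed
  then show ?thesis using S by (auto simp: sep_def)
qed

lemma countable_dense: "\<exists>Q::'a set. countable Q \<and> Q \<noteq> {} \<and> (\<forall>y. \<forall>e>0. \<exists>q\<in>Q. dist y q < e)"
proof -
  fix x0 :: 'a
  define S where "S k n = (SOME S. finite S \<and> (\<forall>y\<in>cball x0 (real k). \<exists>q\<in>S. dist y q < 1 / real (Suc n)))"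
    for k n :: nat
  have S: "finite (S k n)" "\<And>y. y\<in>cball x0 (real k) \<Longrightarrow> \<exists>q\<in>S k n. dist y q < 1 / real (Suc n)" for k n
    using someI_ex[OF finite_net[of "1 / real (Suc n)" x0 "real k"]] unfolding S_def by auto
  define Q where "Q = (\<Union>k. \<Union>n. S k n)"
  have dense: "\<exists>q\<in>Q. dist y q < e" if e: "0 < e" for y e
  proof -
    from reals_Archimedean[OF e] obtain n where n: "1 / real (Suc n) < e"
      unfolding inverse_eq_divide by (rule exE)
    from real_arch_simple[of "dist x0 y"] obtain k :: nat where "dist x0 y \<le> real k" by (rule exE)
    then have "y \<in> cball x0 (real k)" by simp
    from S(2)[OF this, of n] obtain q where q: "q \<in> S k n" "dist y q < 1 / real (Suc n)" by (rule bexE)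
    have "q \<in> Q" using q(1) by (auto simp: Q_def)
    then show ?thesis using less_trans[OF q(2) n] by (rule bexI[rotated])
  qed
  have "countable Q" unfolding Q_def by (intro countable_UN countableI_type) (simp add: countable_finite S(1))
  moreover have "Q \<noteq> {}" using dense[OF zero_less_one, of x0] by auto
  ultimately show ?thesis using dense by (intro exI[of _ Q] conjI allI impI)
qed

text \<open>The type is only a metric space, so joint measurability of \<open>dist\<close> for the
  product sigma-algebra is not automatic. A countable dense set writes \<open>dist a b\<close> as a
  countable infimum of sums of functions of one variable.\<close>

lemma dist_measurable [measurable (raw)]:
  assumes [measurable]: "f \<in> N \<rightarrow>\<^sub>M M" "g \<in> N \<rightarrow>\<^sub>M M"
  shows "(\<lambda>x. dist (f x) (g x)) \<in> borel_measurable N"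
proof -
  obtain Q :: "'a set" where Q: "countable Q" "Q \<noteq> {}" "\<And>y e. e>0 \<Longrightarrow> \<exists>q\<in>Q. dist y q < e"
    using countable_dense by metis
  have eq: "dist a b = (INF q\<in>Q. dist a q + dist q b)" for a b :: 'a
  proof (rule antisym)
    show "dist a b \<le> (INF q\<in>Q. dist a q + dist q b)" by (rule cINF_greatest[OF Q(2)]) (rule dist_triangle)
    show "(INF q\<in>Q. dist a q + dist q b) \<le> dist a b"
    proof (rule field_le_epsilon)
      fix e :: real assume "0 < e"
      then obtain q where q: "q \<in> Q" "dist a q < e/2" using Q(3)[of "e/2" a] by auto
      have "(INF q\<in>Q. dist a q + dist q b) \<le> dist a q + dist q b"
        by (rule cINF_lower[OF _ q(1)]) (auto intro!: bdd_belowI[of _ 0])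
      also have "\<dots> \<le> dist a b + e" using q(2) dist_triangle[of q b a] by (simp add: dist_commute)
      finally show "(INF q\<in>Q. dist a q + dist q b) \<le> dist a b + e" .
    qed
  qed
  have [measurable]: "(\<lambda>x. dist x q) \<in> borel_measurable M" "(\<lambda>x. dist q x) \<in> borel_measurable M" for q
    using borel_measurable_continuous_onI[OF continuous_on_dist[OF continuous_on_id continuous_on_const]]
      borel_measurable_continuous_onI[OF continuous_on_dist[OF continuous_on_const continuous_on_id]]
    by (simp_all add: measurable_cong_sets[OF sets_M refl])
  have "(\<lambda>x. dist (f x) (g x)) = (\<lambda>x. INF q\<in>Q. dist (f x) q + dist q (g x))"
    by (rule ext) (rule eq)
  then show ?thesis
    using Q(1) by (auto intro!: borel_measurable_cINF bdd_belowI[of _ 0])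
qed

lemma indicator_cball_measurable [measurable (raw)]:
  assumes [measurable]: "f \<in> N \<rightarrow>\<^sub>M M" "g \<in> N \<rightarrow>\<^sub>M M"
  shows "(\<lambda>x. indicator (cball (f x) r) (g x) :: ennreal) \<in> borel_measurable N"
proof -
  have "(\<lambda>x. indicator (cball (f x) r) (g x) :: ennreal) = (\<lambda>x. if dist (f x) (g x) \<le> r then 1 else 0)"
    by (auto simp: indicator_def)
  then show ?thesis by simp
qed

lemma p_measurable [measurable (raw)]:
  assumes [measurable]: "f \<in> N \<rightarrow>\<^sub>M M" "g \<in> N \<rightarrow>\<^sub>M M"
  shows "(\<lambda>x. p (f x) (g x)) \<in> borel_measurable N"
  using measurable_compose[OF _ p_meas, of "\<lambda>x. (f x, g x)" N] by simp

lemma V_measurable [measurable]: "(\<lambda>x. V x r) \<in> borel_measurable M"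
proof -
  have "(\<lambda>x. V x r) = (\<lambda>x. enn2real (\<integral>\<^sup>+y. indicator (cball x r) y \<partial>M))"
    by (simp add: measure_def)
  also have "\<dots> \<in> borel_measurable M" by measurable
  finally show ?thesis .
qed

section \<open>The energy density of the kernel (twice its carre du champ) and reversibility\<close>

definition energy :: "('a \<Rightarrow> real) \<Rightarrow> 'a \<Rightarrow> ennreal" where
  "energy f x = (\<integral>\<^sup>+y. ennreal (p x y) * ennreal ((f x - f y)^2) \<partial>M)"

lemma energy_measurable [measurable]:
  assumes [measurable]: "f \<in> borel_measurable M"
  shows "energy f \<in> borel_measurable M"
  unfolding energy_def by measurable

text \<open>Exchanging the integrals turns \<open>p x y\<close> into \<open>p y x\<close>, which
  agrees with it almost everywhere. This is reversibility, and it stands in for integration by parts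
  in the energy estimates.\<close>

lemma kernel_swap:
  assumes [measurable]: "(\<lambda>z. F (fst z) (snd z)) \<in> borel_measurable (M \<Otimes>\<^sub>M M)"
  shows "(\<integral>\<^sup>+x. \<integral>\<^sup>+y. ennreal (p x y) * F x y \<partial>M \<partial>M) = (\<integral>\<^sup>+x. \<integral>\<^sup>+y. ennreal (p x y) * F y x \<partial>M \<partial>M)"
proof -
  have "(\<lambda>(x,y). ennreal (p x y) * F x y) \<in> borel_measurable (M \<Otimes>\<^sub>M M)"
    by (simp add: case_prod_beta)
  from MM.Fubini'[OF this]
  have "(\<integral>\<^sup>+x. \<integral>\<^sup>+y. ennreal (p x y) * F x y \<partial>M \<partial>M) = (\<integral>\<^sup>+x. \<integral>\<^sup>+y. ennreal (p y x) * F y x \<partial>M \<partial>M)" by simp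
  also have "\<dots> = (\<integral>\<^sup>+x. \<integral>\<^sup>+y. ennreal (p x y) * F y x \<partial>M \<partial>M)"
  proof (rule nn_integral_cong_AE)
    have "AE x in M. AE y in M. p x y = p y x" using MM.AE_pair[OF p_sym] by simp
    then show "AE x in M. (\<integral>\<^sup>+y. ennreal (p y x) * F y x \<partial>M) = (\<integral>\<^sup>+y. ennreal (p x y) * F y x \<partial>M)"
    proof eventually_elim
      fix x assume "AE y in M. p x y = p y x"
      then show "(\<integral>\<^sup>+y. ennreal (p y x) * F y x \<partial>M) = (\<integral>\<^sup>+y. ennreal (p x y) * F y x \<partial>M)"
        by (intro nn_integral_cong_AE) (auto elim!: eventually_mono)
    qed
  qed
  finally show ?thesis .
qed

lemma p_support: "AE y in M. dist x y \<le> h' \<or> p x y = 0"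
  using p_upper[of x] by eventually_elim (auto simp: indicator_def p_nonneg intro: antisym split: if_splits)

lemma emeasure_subset_cball:
  assumes "A \<subseteq> cball x r"
  shows "emeasure M A = ennreal (measure M A)"
  using emeasure_mono[OF assms, of M] emeasure_cball_finite[of x r]
  by (intro emeasure_eq_ennreal_measure) (auto simp: top_unique)

lemma emeasure_subset_cball_finite: "A \<subseteq> cball x r \<Longrightarrow> emeasure M A \<noteq> \<infinity>"
  by (simp add: emeasure_subset_cball)

subsection \<open>Poincare, Faber-Krahn and Caccioppoli inequalities\<close>

text \<open>On \<open>Z\<close> the deviation \<open>f - m\<close> equals \<open>-m\<close>, so the
  Poincare inequality bounds \<open>m^2 * e * V x r\<close> as well; then
  \<open>f^2 \<le> 2 * (f - m)^2 + 2 * m^2\<close> removes the constant \<open>m\<close>.\<close>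

lemma poincare_zero:
  assumes [measurable]: "f \<in> borel_measurable M" and bd: "\<And>y. \<bar>f y\<bar> \<le> B" and r: "r0 \<le> r"
    and Z [measurable]: "Z \<in> sets M" and ZB: "Z \<subseteq> cball x r" and f0: "\<And>y. y \<in> Z \<Longrightarrow> f y = 0"
    and e: "0 < e" "e * V x r \<le> measure M Z"
  shows "(\<integral>\<^sup>+y. ennreal ((f y)^2) * indicator (cball x r) y \<partial>M)
     \<le> ennreal ((2 + 2/e) * CP * r^2) * (\<integral>\<^sup>+y. energy f y * indicator (cball x (C2*r)) y \<partial>M)"
proof -
  obtain m where m: "(\<integral>\<^sup>+y. ennreal ((f y - m)^2) * indicator (cball x r) y \<partial>M)
        \<le> ennreal (CP * r^2) * (\<integral>\<^sup>+y. energy f y * indicator (cball x (C2*r)) y \<partial>M)" (is "?I \<le> ?R")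
    using poincare[OF assms(1) bd r, of x] unfolding energy_def by auto
  have Zfin: "emeasure M Z = ennreal (measure M Z)"
    by (rule emeasure_subset_cball[OF ZB])
  have "ennreal (m^2 * (e * V x r)) \<le> ennreal (m^2) * emeasure M Z"
    unfolding Zfin using e by (simp add: ennreal_mult[symmetric] mult_left_mono)
  also have "\<dots> = (\<integral>\<^sup>+y. ennreal (m^2) * indicator Z y \<partial>M)" by (rule nn_integral_cmult_indicator[OF Z, symmetric])
  also have "\<dots> \<le> ?I"
    by (intro nn_integral_mono) (use ZB f0 in \<open>auto split: split_indicator\<close>)
  finally have mI: "ennreal (m^2 * (e * V x r)) \<le> ?I" .
  have "(\<integral>\<^sup>+y. ennreal ((f y)^2) * indicator (cball x r) y \<partial>M)
      \<le> (\<integral>\<^sup>+y. 2 * (ennreal ((f y - m)^2) * indicator (cball x r) y) + ennreal (2 * m^2) * indicator (cball x r) y \<partial>M)"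
  proof (intro nn_integral_mono)
    fix y
    have "(f y)^2 \<le> 2 * (f y - m)^2 + 2 * m^2" using zero_le_power2[of "f y - 2 * m"] by (simp add: power2_eq_square algebra_simps)
    then have "ennreal ((f y)^2) \<le> ennreal (2 * (f y - m)^2) + ennreal (2 * m^2)"
      by (simp add: ennreal_plus[symmetric] del: ennreal_plus)
    then show "ennreal ((f y)^2) * indicator (cball x r) y
        \<le> 2 * (ennreal ((f y - m)^2) * indicator (cball x r) y) + ennreal (2 * m^2) * indicator (cball x r) y"
      by (auto split: split_indicator simp: ennreal_mult)
  qed
  also have "\<dots> = 2 * ?I + ennreal (2 * m^2) * ennreal (V x r)"
    by (subst nn_integral_add) (auto simp: nn_integral_cmult emeasure_cball)
  also have "ennreal (2 * m^2) * ennreal (V x r) = ennreal (2 / e) * ennreal (m^2 * (e * V x r))"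
    using e by (simp add: ennreal_mult[symmetric])
  also have "\<dots> \<le> ennreal (2/e) * ?I" by (intro mult_left_mono mI) simp
  also have "2 * ?I + ennreal (2/e) * ?I = ennreal (2 + 2/e) * ?I"
    using e by (simp add: ennreal_plus distrib_right)
  also have "\<dots> \<le> ennreal (2 + 2/e) * ?R" by (intro mult_left_mono m) simp
  also have "\<dots> = ennreal ((2 + 2/e) * CP * r^2) * (\<integral>\<^sup>+y. energy f y * indicator (cball x (C2*r)) y \<partial>M)"
    using e CP_pos by (simp add: ennreal_mult''[symmetric] mult.assoc[symmetric] del: ennreal_plus)
  finally show ?thesis by (simp add: add_left_mono)
qed

text \<open>Membership in a ball of fixed radius is symmetric in centre and point. The weight
  \<open>a\<close> is meant to be \<open>1 / V y s\<close>, which turns estimates on all balls of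
  radius \<open>s\<close> into a global one.\<close>

lemma cball_Fubini:
  assumes [measurable]: "g \<in> borel_measurable M" "a \<in> borel_measurable M"
  shows "(\<integral>\<^sup>+y. ennreal (a y) * (\<integral>\<^sup>+x. g x * indicator (cball y s) x \<partial>M) \<partial>M)
       = (\<integral>\<^sup>+x. g x * (\<integral>\<^sup>+y. ennreal (a y) * indicator (cball x s) y \<partial>M) \<partial>M)"
proof -
  have "(\<integral>\<^sup>+y. ennreal (a y) * (\<integral>\<^sup>+x. g x * indicator (cball y s) x \<partial>M) \<partial>M)
      = (\<integral>\<^sup>+y. \<integral>\<^sup>+x. ennreal (a y) * (g x * indicator (cball y s) x) \<partial>M \<partial>M)"
    by (simp add: nn_integral_cmult)
  also have "\<dots> = (\<integral>\<^sup>+x. \<integral>\<^sup>+y. ennreal (a y) * (g x * indicator (cball y s) x) \<partial>M \<partial>M)"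
    by (rule MM.Fubini') simp
  also have "\<dots> = (\<integral>\<^sup>+x. \<integral>\<^sup>+y. g x * (ennreal (a y) * indicator (cball x s) y) \<partial>M \<partial>M)"
    by (intro nn_integral_cong) (auto split: split_indicator simp: dist_commute ac_simps)
  also have "\<dots> = (\<integral>\<^sup>+x. g x * (\<integral>\<^sup>+y. ennreal (a y) * indicator (cball x s) y \<partial>M) \<partial>M)"
    by (simp add: nn_integral_cmult)
  finally show ?thesis .
qed

text \<open>The weights \<open>1 / V z s\<close> on balls of radius \<open>s\<close> cover each
  point with total mass bounded below, as a partition of unity would.\<close>

lemma inverse_volume_integral_ge:
  assumes s: "0 < s" and C: "0 < C" and le: "\<And>z. dist x z \<le> s \<Longrightarrow> V z s \<le> C * V x s"
  shows "ennreal (1/C) \<le> (\<integral>\<^sup>+z. ennreal (1 / V z s) * indicator (cball x s) z \<partial>M)"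
proof -
  have "ennreal (1/C) = (\<integral>\<^sup>+z. ennreal (1 / (C * V x s)) * indicator (cball x s) z \<partial>M)"
    using V_pos[OF s, of x] C by (simp add: nn_integral_cmult emeasure_cball ennreal_mult[symmetric])
  also have "\<dots> \<le> (\<integral>\<^sup>+z. ennreal (1 / V z s) * indicator (cball x s) z \<partial>M)"
    using le V_pos[OF s] C
    by (intro nn_integral_mono) (auto split: split_indicator intro!: ennreal_leI divide_left_mono)
  finally show ?thesis .
qed

text \<open>Averaging the Poincare inequality at scale \<open>s\<close> over all centres replaces a covering argument.\<close>

lemma faber_krahn:
  "\<exists>CF>0. \<forall>s f. r0 \<le> s \<longrightarrow> f \<in> borel_measurable M \<longrightarrow> (\<exists>B. \<forall>y. \<bar>f y\<bar> \<le> B) \<longrightarrow>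
     (\<forall>y. measure M {x\<in>cball y s. f x \<noteq> 0} \<le> V y s / 2) \<longrightarrow>
     (\<integral>\<^sup>+x. ennreal ((f x)^2) \<partial>M) \<le> ennreal (CF * s^2) * (\<integral>\<^sup>+x. energy f x \<partial>M)"
proof -
  obtain C where C: "0 < C" "\<And>x y r R. r0 \<le> r \<Longrightarrow> dist x y + R \<le> (2 * C2) * r \<Longrightarrow> V x R \<le> C * V y r"
    using volume_comparison[OF r0_pos] by metis
  have main: "(\<integral>\<^sup>+x. ennreal ((f x)^2) \<partial>M) \<le> ennreal ((6 * CP * C * C) * s^2) * (\<integral>\<^sup>+x. energy f x \<partial>M)"
    if s: "r0 \<le> s" and [measurable]: "f \<in> borel_measurable M" and bd: "\<And>y. \<bar>f y\<bar> \<le> B"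
      and small: "\<And>y. measure M {x\<in>cball y s. f x \<noteq> 0} \<le> V y s / 2" for s f B
  proof -
    have s0: "0 < s" using s r0_pos by linarith
    define F where "F x = ennreal ((f x)^2)" for x
    have [measurable]: "F \<in> borel_measurable M" unfolding F_def by measurable
    have loc: "(\<integral>\<^sup>+x. F x * indicator (cball y s) x \<partial>M)
       \<le> ennreal (6 * CP * s^2) * (\<integral>\<^sup>+x. energy f x * indicator (cball y (C2 * s)) x \<partial>M)" for y
    proof -
      have "cball y s \<inter> {x\<in>space M. f x = 0} \<in> sets M" "cball y s \<inter> {x\<in>space M. f x \<noteq> 0} \<in> sets M"
        by measurable
      then have Z: "{x\<in>cball y s. f x = 0} \<in> sets M" "{x\<in>cball y s. f x \<noteq> 0} \<in> sets M"
        by (simp_all add: Int_def)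
      have fin: "emeasure M {x\<in>cball y s. P x} \<noteq> \<infinity>" for P
        by (rule emeasure_subset_cball_finite[of _ y s]) auto
      have "V y s = measure M ({x\<in>cball y s. f x = 0} \<union> {x\<in>cball y s. f x \<noteq> 0})"
        by (rule arg_cong[where f="measure M"]) auto
      also have "\<dots> = measure M {x\<in>cball y s. f x = 0} + measure M {x\<in>cball y s. f x \<noteq> 0}"
        by (rule measure_Union[OF fin[of "\<lambda>x. f x = 0"] fin[of "\<lambda>x. f x \<noteq> 0"] Z]) auto
      \<comment> \<open>At least half of the ball lies in the zero set, so
        \<open>poincare_zero\<close> applies with \<open>e = 1/2\<close>; its factor
        \<open>2 + 2/e\<close> is the 6 in the constant.\<close>
      finally have "1/2 * V y s \<le> measure M {x\<in>cball y s. f x = 0}" using small[of y] by simp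
      from poincare_zero[OF that(2) bd s Z(1) _ _ _ this]
      have "(\<integral>\<^sup>+x. F x * indicator (cball y s) x \<partial>M)
         \<le> ennreal ((2 + 2 / (1/2)) * CP * s^2) * (\<integral>\<^sup>+x. energy f x * indicator (cball y (C2 * s)) x \<partial>M)"
        unfolding F_def by fastforce
      also have "(2 + 2 / (1/2)) * CP * s^2 = 6 * CP * s^2" by simp
      finally show ?thesis .
    qed
    have "ennreal (1/C) * (\<integral>\<^sup>+x. F x \<partial>M) = (\<integral>\<^sup>+x. F x * ennreal (1/C) \<partial>M)"
      by (subst nn_integral_multc) (simp_all add: mult.commute)
    also have "\<dots> \<le> (\<integral>\<^sup>+x. F x * (\<integral>\<^sup>+y. ennreal (1 / V y s) * indicator (cball x s) y \<partial>M) \<partial>M)"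
    proof (intro nn_integral_mono mult_left_mono inverse_volume_integral_ge[OF s0 C(1)])
      fix x y :: 'a assume "dist x y \<le> s"
      moreover have "2 * s \<le> 2 * C2 * s" using C2_ge s0 by simp
      ultimately show "V y s \<le> C * V x s" by (intro C(2)[OF s]) (simp add: dist_commute)
    qed simp
    also have "\<dots> = (\<integral>\<^sup>+y. ennreal (1 / V y s) * (\<integral>\<^sup>+x. F x * indicator (cball y s) x \<partial>M) \<partial>M)"
      by (rule cball_Fubini[symmetric]) simp_all
    also have "\<dots> \<le> (\<integral>\<^sup>+y. ennreal (1 / V y s) *
        (ennreal (6 * CP * s^2) * (\<integral>\<^sup>+x. energy f x * indicator (cball y (C2 * s)) x \<partial>M)) \<partial>M)"
      by (intro nn_integral_mono mult_left_mono loc) simp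
    also have "\<dots> = ennreal (6 * CP * s^2) * (\<integral>\<^sup>+y. ennreal (1 / V y s) *
         (\<integral>\<^sup>+x. energy f x * indicator (cball y (C2 * s)) x \<partial>M) \<partial>M)"
      by (subst nn_integral_cmult[symmetric]) (auto simp: ac_simps)
    also have "(\<integral>\<^sup>+y. ennreal (1 / V y s) * (\<integral>\<^sup>+x. energy f x * indicator (cball y (C2 * s)) x \<partial>M) \<partial>M)
       = (\<integral>\<^sup>+x. energy f x * (\<integral>\<^sup>+y. ennreal (1 / V y s) * indicator (cball x (C2 * s)) y \<partial>M) \<partial>M)"
      by (rule cball_Fubini) simp_all
    \<comment> \<open>Bounded overlap of the enlarged balls: \<open>V y s\<close> is at least
      \<open>V x (C2 * s) / C\<close> whenever \<open>dist x y \<le> C2 * s\<close>, so the energy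
      at \<open>x\<close> is counted with total weight at most \<open>C\<close>.\<close>
    also have "\<dots> \<le> (\<integral>\<^sup>+x. energy f x * ennreal C \<partial>M)"
    proof (intro nn_integral_mono mult_left_mono)
      fix x
      have Vp: "0 < V x (C2 * s)" using C2_ge s0 by (intro V_pos) simp
      have "(\<integral>\<^sup>+y. ennreal (1 / V y s) * indicator (cball x (C2 * s)) y \<partial>M)
         \<le> (\<integral>\<^sup>+y. ennreal (C / V x (C2 * s)) * indicator (cball x (C2 * s)) y \<partial>M)"
      proof (intro nn_integral_mono)
        fix y
        have "V x (C2 * s) \<le> C * V y s" if "dist x y \<le> C2 * s"
          by (rule C(2)[OF s]) (use that in simp)
        then show "ennreal (1 / V y s) * indicator (cball x (C2 * s)) y \<le> ennreal (C / V x (C2 * s)) * indicator (cball x (C2 * s)) y"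
          using V_pos[OF s0, of y] Vp by (auto split: split_indicator intro!: ennreal_leI simp: field_simps)
      qed
      also have "\<dots> = ennreal C"
        using Vp C by (simp add: nn_integral_cmult emeasure_cball ennreal_mult[symmetric])
      finally show "(\<integral>\<^sup>+y. ennreal (1 / V y s) * indicator (cball x (C2 * s)) y \<partial>M) \<le> ennreal C" .
    qed simp
    also have "\<dots> = ennreal C * (\<integral>\<^sup>+x. energy f x \<partial>M)"
      by (subst nn_integral_multc) (simp_all add: mult.commute)
    finally have *: "ennreal (1/C) * (\<integral>\<^sup>+x. F x \<partial>M) \<le> ennreal (6 * CP * s^2) * (ennreal C * (\<integral>\<^sup>+x. energy f x \<partial>M))"
      by (simp add: mult_left_mono)
    have "(\<integral>\<^sup>+x. F x \<partial>M) = ennreal C * (ennreal (1/C) * (\<integral>\<^sup>+x. F x \<partial>M))"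
      using C by (simp add: mult.assoc[symmetric] ennreal_mult[symmetric])
    also have "\<dots> \<le> ennreal C * (ennreal (6 * CP * s^2) * (ennreal C * (\<integral>\<^sup>+x. energy f x \<partial>M)))"
      by (intro mult_left_mono *) simp
    also have "\<dots> = ennreal ((6 * CP * C * C) * s^2) * (\<integral>\<^sup>+x. energy f x \<partial>M)"
      using C CP_pos by (simp add: mult.assoc[symmetric] ennreal_mult[symmetric]) (simp add: ac_simps)
    finally show ?thesis by (simp add: F_def)
  qed
  show ?thesis
    by (rule exI[of _ "6 * CP * C * C"]) (use main C CP_pos in auto)
qed

text \<open>The nonnegative integral avoids any integrability condition. As \<open>ennreal\<close>
  sends negative numbers to 0, the notion is meant for nonnegative \<open>w\<close>.\<close>

definition subharmonic_on :: "('a \<Rightarrow> real) \<Rightarrow> 'a set \<Rightarrow> bool" where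
  "subharmonic_on w A \<longleftrightarrow> (\<forall>x\<in>A. ennreal (w x) \<le> (\<integral>\<^sup>+y. ennreal (p x y) * ennreal (w y) \<partial>M))"

text \<open>Expanding squares gives \<open>(\<phi> x * w x - \<phi> y * w y)^2 + (\<phi> x^2 +
  \<phi> y^2) * w x * w y = \<phi> x^2 * w x^2 + \<phi> y^2 * w y^2 + w x * w y * (\<phi> x - \<phi>
  y)^2\<close>. Integrated against the symmetric kernel this reads \<open>E + 2 J = 2 I + T\<close>,
  and \<open>I \<le> J\<close> is subharmonicity tested with \<open>\<phi>^2 * w\<close>.\<close>

lemma caccioppoli:
  assumes [measurable]: "w \<in> borel_measurable M" "\<phi> \<in> borel_measurable M"
    and w: "\<And>x. 0 \<le> w x" "\<And>x. w x \<le> B" and \<phi>: "\<And>x. 0 \<le> \<phi> x" "\<And>x. \<phi> x \<le> 1"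
    and supp: "\<And>x. x \<notin> cball z R \<Longrightarrow> \<phi> x = 0" and sub: "subharmonic_on w (cball z R)"
  shows "(\<integral>\<^sup>+x. energy (\<lambda>x. \<phi> x * w x) x \<partial>M)
      \<le> (\<integral>\<^sup>+x. \<integral>\<^sup>+y. ennreal (p x y) * ennreal (w x * w y * (\<phi> x - \<phi> y)^2) \<partial>M \<partial>M)" (is "?E \<le> ?T")
proof -
  define I where "I = (\<integral>\<^sup>+x. ennreal ((\<phi> x)^2 * (w x)^2) \<partial>M)"
  define J where "J = (\<integral>\<^sup>+x. \<integral>\<^sup>+y. ennreal (p x y) * ennreal ((\<phi> x)^2 * w x * w y) \<partial>M \<partial>M)"
  have I2: "(\<integral>\<^sup>+x. \<integral>\<^sup>+y. ennreal (p x y) * ennreal ((\<phi> x)^2 * (w x)^2) \<partial>M \<partial>M) = I"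
    by (simp add: nn_integral_multc p_mass I_def)
  have J2: "J = (\<integral>\<^sup>+x. ennreal ((\<phi> x)^2 * w x) * (\<integral>\<^sup>+y. ennreal (p x y) * ennreal (w y) \<partial>M) \<partial>M)"
    unfolding J_def using w \<phi>
    by (subst nn_integral_cmult[symmetric]) (auto simp: ennreal_mult ac_simps)
  have IJ: "I \<le> J"
    unfolding J2 I_def
  proof (intro nn_integral_mono)
    fix x
    show "ennreal ((\<phi> x)^2 * (w x)^2) \<le> ennreal ((\<phi> x)^2 * w x) * (\<integral>\<^sup>+y. ennreal (p x y) * ennreal (w y) \<partial>M)"
    proof (cases "x \<in> cball z R")
      case True
      have "ennreal ((\<phi> x)^2 * (w x)^2) = ennreal ((\<phi> x)^2 * w x) * ennreal (w x)"
        using w by (simp add: ennreal_mult[symmetric]) (simp add: power2_eq_square mult.assoc)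
      also have "\<dots> \<le> ennreal ((\<phi> x)^2 * w x) * (\<integral>\<^sup>+y. ennreal (p x y) * ennreal (w y) \<partial>M)"
        using sub True by (intro mult_left_mono) (auto simp: subharmonic_on_def)
      finally show ?thesis .
    qed (simp add: supp)
  qed
  have B: "0 \<le> B" using w order_trans by blast
  \<comment> \<open>Boundedness of \<open>w\<close> and of the support makes \<open>J\<close>
    finite, so that it can be cancelled in \<open>ennreal\<close> at the end.\<close>
  have "J \<le> (\<integral>\<^sup>+x. ennreal (B * B) * indicator (cball z R) x \<partial>M)"
    unfolding J_def
  proof (intro nn_integral_mono)
    fix x
    have "(\<integral>\<^sup>+y. ennreal (p x y) * ennreal ((\<phi> x)^2 * w x * w y) \<partial>M)
      \<le> (\<integral>\<^sup>+y. ennreal (p x y) * (ennreal (B * B) * indicator (cball z R) x) \<partial>M)"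
    proof (intro nn_integral_mono mult_left_mono)
      fix y
      have "(\<phi> x)^2 * (w x * w y) \<le> 1 * (B * B)"
        using w \<phi> B by (intro mult_mono) (auto intro: power_le_one mult_mono)
      then show "ennreal ((\<phi> x)^2 * w x * w y) \<le> ennreal (B * B) * indicator (cball z R) x"
        using supp[of x] by (auto split: split_indicator intro!: ennreal_leI simp: mult.assoc)
    qed simp
    then show "(\<integral>\<^sup>+y. ennreal (p x y) * ennreal ((\<phi> x)^2 * w x * w y) \<partial>M) \<le> ennreal (B * B) * indicator (cball z R) x"
      by (simp add: nn_integral_multc p_mass)
  qed
  also have "\<dots> < \<infinity>" by (simp add: nn_integral_cmult emeasure_cball ennreal_mult_less_top)
  finally have Jfin: "J \<noteq> \<infinity>" by simp
  have I3: "(\<integral>\<^sup>+x. \<integral>\<^sup>+y. ennreal (p x y) * ennreal ((\<phi> y)^2 * (w y)^2) \<partial>M \<partial>M) = I"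
    unfolding I2[symmetric] by (rule kernel_swap[symmetric]) simp
  have J3: "(\<integral>\<^sup>+x. \<integral>\<^sup>+y. ennreal (p x y) * ennreal ((\<phi> y)^2 * w y * w x) \<partial>M \<partial>M) = J"
    unfolding J_def by (rule kernel_swap[symmetric]) simp
  have "?E + J + J = (\<integral>\<^sup>+x. \<integral>\<^sup>+y. ennreal (p x y) * ennreal ((\<phi> x * w x - \<phi> y * w y)^2) \<partial>M \<partial>M)
     + (\<integral>\<^sup>+x. \<integral>\<^sup>+y. ennreal (p x y) * ennreal ((\<phi> x)^2 * w x * w y) \<partial>M \<partial>M)
     + (\<integral>\<^sup>+x. \<integral>\<^sup>+y. ennreal (p x y) * ennreal ((\<phi> y)^2 * w y * w x) \<partial>M \<partial>M)"
    unfolding J3 unfolding J_def energy_def ..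
  also have "\<dots> = (\<integral>\<^sup>+x. \<integral>\<^sup>+y. ennreal (p x y) * (ennreal ((\<phi> x * w x - \<phi> y * w y)^2)
        + ennreal ((\<phi> x)^2 * w x * w y) + ennreal ((\<phi> y)^2 * w y * w x)) \<partial>M \<partial>M)"
    by (simp add: nn_integral_add distrib_left)
  also have "\<dots> = (\<integral>\<^sup>+x. \<integral>\<^sup>+y. ennreal (p x y) * (ennreal ((\<phi> x)^2 * (w x)^2)
        + ennreal ((\<phi> y)^2 * (w y)^2) + ennreal (w x * w y * (\<phi> x - \<phi> y)^2)) \<partial>M \<partial>M)"
    using w by (simp add: ennreal_plus[symmetric] del: ennreal_plus)
      (simp add: power2_eq_square algebra_simps)
  also have "\<dots> = I + I + ?T"
    by (simp add: nn_integral_add distrib_left I3) (simp add: I_def nn_integral_multc p_mass)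
  also have "\<dots> \<le> J + J + ?T" using IJ by (intro add_mono) auto
  finally have "?E + (J + J) \<le> ?T + (J + J)" by (simp add: ac_simps)
  then show ?thesis using Jfin by (simp add: ennreal_add_left_cancel_le add.commute[of _ "J + J"])
qed

text \<open>Jumps have length at most \<open>h'\<close>, so a pair with
  \<open>\<phi> x \<noteq> \<phi> y\<close> has both points in \<open>cball z R\<close> and
  contributes at most \<open>(L * h')^2\<close>. The product \<open>w x * w y\<close> is split into
  squares, which symmetry then makes equal.\<close>

lemma caccioppoli_lipschitz:
  assumes [measurable]: "w \<in> borel_measurable M" "\<phi> \<in> borel_measurable M"
    and w: "\<And>x. 0 \<le> w x" "\<And>x. w x \<le> B" and \<phi>: "\<And>x. 0 \<le> \<phi> x" "\<And>x. \<phi> x \<le> 1"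
    and supp: "\<And>x. x \<notin> cball z (R - h') \<Longrightarrow> \<phi> x = 0" and sub: "subharmonic_on w (cball z R)"
    and lip: "\<And>x y. \<bar>\<phi> x - \<phi> y\<bar> \<le> L * dist x y"
  shows "(\<integral>\<^sup>+x. energy (\<lambda>x. \<phi> x * w x) x \<partial>M)
      \<le> ennreal ((L * h')^2) * (\<integral>\<^sup>+x. ennreal ((w x)^2) * indicator (cball z R) x \<partial>M)"
proof -
  have h': "0 < h'" using h_pos h_le by simp
  define W where "W x = ennreal ((w x)^2) * indicator (cball z R) x" for x
  have [measurable]: "W \<in> borel_measurable M" unfolding W_def by measurable
  have supp': "\<phi> x = 0" if "x \<notin> cball z R" for x using supp[of x] that h' by auto
  have "(\<integral>\<^sup>+x. energy (\<lambda>x. \<phi> x * w x) x \<partial>M)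
      \<le> (\<integral>\<^sup>+x. \<integral>\<^sup>+y. ennreal (p x y) * ennreal (w x * w y * (\<phi> x - \<phi> y)^2) \<partial>M \<partial>M)"
    by (rule caccioppoli[OF assms(1,2) w \<phi> supp' sub])
  also have "\<dots> \<le> (\<integral>\<^sup>+x. \<integral>\<^sup>+y. ennreal (p x y) * (ennreal ((L*h')^2 / 2) * (W x + W y)) \<partial>M \<partial>M)"
  proof (rule nn_integral_mono, rule nn_integral_mono_AE)
    fix x
    show "AE y in M. ennreal (p x y) * ennreal (w x * w y * (\<phi> x - \<phi> y)^2)
        \<le> ennreal (p x y) * (ennreal ((L*h')^2 / 2) * (W x + W y))"
      using p_support[of x]
    proof eventually_elim
      fix y assume "dist x y \<le> h' \<or> p x y = 0"
      moreover have "ennreal (w x * w y * (\<phi> x - \<phi> y)^2) \<le> ennreal ((L*h')^2 / 2) * (W x + W y)"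
        if d: "dist x y \<le> h'" and ne: "\<phi> x \<noteq> \<phi> y"
      proof -
        have "x \<in> cball z (R - h') \<or> y \<in> cball z (R - h')" using ne supp by metis
        then have xy: "x \<in> cball z R" "y \<in> cball z R"
          using d h' dist_triangle[of z x y] dist_triangle[of z y x] by (auto simp: dist_commute)
        have L: "0 \<le> L"
        proof (rule ccontr)
          assume "\<not> 0 \<le> L"
          then have "L * dist x y \<le> 0" by (intro mult_nonpos_nonneg) auto
          then show False using lip[of x y] ne by auto
        qed
        have "\<bar>\<phi> x - \<phi> y\<bar> \<le> L * h'" using lip[of x y] mult_left_mono[OF d L] by linarith
        then have "(\<phi> x - \<phi> y)^2 \<le> (L*h')^2" by (metis abs_ge_zero power2_abs power_mono)
        moreover have "w x * w y \<le> ((w x)^2 + (w y)^2) / 2" using sum_squares_bound[of "w x" "w y"] by simp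
        ultimately have "w x * w y * (\<phi> x - \<phi> y)^2 \<le> ((w x)^2 + (w y)^2) / 2 * (L*h')^2"
          using w by (intro mult_mono) auto
        also have "\<dots> = (L*h')^2 / 2 * ((w x)^2 + (w y)^2)" by simp
        finally have "ennreal (w x * w y * (\<phi> x - \<phi> y)^2) \<le> ennreal ((L*h')^2 / 2 * ((w x)^2 + (w y)^2))"
          by (rule ennreal_leI)
        also have "\<dots> = ennreal ((L*h')^2 / 2) * (W x + W y)"
          using xy by (subst ennreal_mult) (auto simp: W_def)
        finally show ?thesis .
      qed
      ultimately show "ennreal (p x y) * ennreal (w x * w y * (\<phi> x - \<phi> y)^2)
        \<le> ennreal (p x y) * (ennreal ((L*h')^2 / 2) * (W x + W y))"
        by (cases "p x y = 0"; cases "\<phi> x = \<phi> y") (auto intro!: mult_left_mono)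
    qed
  qed
  also have "\<dots> = (\<integral>\<^sup>+x. ennreal ((L*h')^2 / 2) * (\<integral>\<^sup>+y. ennreal (p x y) * W x + ennreal (p x y) * W y \<partial>M) \<partial>M)"
    by (subst nn_integral_cmult[symmetric]) (auto intro!: nn_integral_cong simp: algebra_simps)
  also have "\<dots> = ennreal ((L*h')^2 / 2) * ((\<integral>\<^sup>+x. \<integral>\<^sup>+y. ennreal (p x y) * W x \<partial>M \<partial>M)
      + (\<integral>\<^sup>+x. \<integral>\<^sup>+y. ennreal (p x y) * W y \<partial>M \<partial>M))"
    by (simp add: nn_integral_cmult nn_integral_add)
  also have "(\<integral>\<^sup>+x. \<integral>\<^sup>+y. ennreal (p x y) * W y \<partial>M \<partial>M) = (\<integral>\<^sup>+x. \<integral>\<^sup>+y. ennreal (p x y) * W x \<partial>M \<partial>M)"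
    by (rule kernel_swap) simp
  also have "(\<integral>\<^sup>+x. \<integral>\<^sup>+y. ennreal (p x y) * W x \<partial>M \<partial>M) = (\<integral>\<^sup>+x. W x \<partial>M)"
    by (simp add: nn_integral_multc p_mass)
  also have "ennreal ((L*h')^2 / 2) * ((\<integral>\<^sup>+x. W x \<partial>M) + (\<integral>\<^sup>+x. W x \<partial>M)) = ennreal ((L*h')^2) * (\<integral>\<^sup>+x. W x \<partial>M)"
    by (simp add: distrib_left distrib_right[symmetric] ennreal_plus[symmetric] del: ennreal_plus)
  finally show ?thesis by (simp add: W_def)
qed

subsection \<open>The mean value inequality for subharmonic functions\<close>

lemma subharmonic_on_subset: "subharmonic_on w A \<Longrightarrow> B \<subseteq> A \<Longrightarrow> subharmonic_on w B"
  unfolding subharmonic_on_def by blast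

text \<open>Average \<open>w y \<le> max 0 (w y - t) + t\<close> against a kernel of mass one and
  subtract the finite \<open>t\<close>.\<close>

lemma subharmonic_truncate:
  assumes [measurable]: "w \<in> borel_measurable M" and "0 \<le> t" and sub: "subharmonic_on w A"
  shows "subharmonic_on (\<lambda>x. max 0 (w x - t)) A"
  unfolding subharmonic_on_def
proof
  fix x assume "x \<in> A"
  then have "ennreal (w x) \<le> (\<integral>\<^sup>+y. ennreal (p x y) * ennreal (w y) \<partial>M)"
    using sub by (simp add: subharmonic_on_def)
  also have "\<dots> \<le> (\<integral>\<^sup>+y. ennreal (p x y) * (ennreal (max 0 (w y - t)) + ennreal t) \<partial>M)"
    using \<open>0 \<le> t\<close> by (intro nn_integral_mono mult_left_mono)
      (auto simp: ennreal_plus[symmetric] max_def simp del: ennreal_plus intro!: ennreal_leI)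
  also have "\<dots> = (\<integral>\<^sup>+y. ennreal (p x y) * ennreal (max 0 (w y - t)) \<partial>M) + ennreal t"
    by (simp add: distrib_left nn_integral_add nn_integral_multc p_mass)
  finally have *: "ennreal (w x) \<le> (\<integral>\<^sup>+y. ennreal (p x y) * ennreal (max 0 (w y - t)) \<partial>M) + ennreal t" .
  show "ennreal (max 0 (w x - t)) \<le> (\<integral>\<^sup>+y. ennreal (p x y) * ennreal (max 0 (w y - t)) \<partial>M)"
  proof (cases "w x \<le> t")
    case False
    then have "ennreal (w x) = ennreal (max 0 (w x - t)) + ennreal t"
      using \<open>0 \<le> t\<close> by (simp add: ennreal_plus[symmetric] del: ennreal_plus)
    with * show ?thesis by (simp add: ennreal_add_left_cancel_le add.commute[of _ "ennreal t"])
  qed simp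
qed

text \<open>The exit from the iteration: Young's inequality
  \<open>w \<le> \<tau>/2 + w^2 / (2 * \<tau>)\<close> under the kernel, whose upper bound turns the
  square term into a quadratic mean at scale \<open>h'\<close>.\<close>

lemma subharmonic_pointwise:
  assumes [measurable]: "w \<in> borel_measurable M" and w: "\<And>x. 0 \<le> w x" and \<tau>: "0 < \<tau>" and K: "0 \<le> K"
    and sub: "subharmonic_on w {x}"
    and int: "(\<integral>\<^sup>+y. ennreal ((w y)^2) * indicator (cball x h') y \<partial>M) \<le> ennreal K"
  shows "w x \<le> (\<tau> + C1 * K / (\<tau> * V x h')) / 2"
proof -
  have Vp: "0 < V x h'" using h_pos h_le by (intro V_pos) simp
  have "ennreal (w x) \<le> (\<integral>\<^sup>+y. ennreal (p x y) * ennreal (w y) \<partial>M)"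
    using sub by (simp add: subharmonic_on_def)
  also have "\<dots> \<le> (\<integral>\<^sup>+y. ennreal (p x y) * ennreal (\<tau>/2)
      + ennreal (C1 / (2 * \<tau> * V x h')) * (ennreal ((w y)^2) * indicator (cball x h') y) \<partial>M)"
  proof (rule nn_integral_mono_AE)
    show "AE y in M. ennreal (p x y) * ennreal (w y) \<le> ennreal (p x y) * ennreal (\<tau>/2)
      + ennreal (C1 / (2 * \<tau> * V x h')) * (ennreal ((w y)^2) * indicator (cball x h') y)"
      using p_upper[of x]
    proof eventually_elim
      fix y assume up: "p x y \<le> C1 / V x h' * indicator (cball x h') y"
      show "ennreal (p x y) * ennreal (w y) \<le> ennreal (p x y) * ennreal (\<tau>/2)
        + ennreal (C1 / (2 * \<tau> * V x h')) * (ennreal ((w y)^2) * indicator (cball x h') y)"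
      proof (cases "y \<in> cball x h'")
        case True
        have "2 * \<tau> * w y \<le> \<tau>^2 + (w y)^2" using sum_squares_bound[of \<tau> "w y"] by simp
        then have "w y \<le> \<tau>/2 + (w y)^2 / (2 * \<tau>)" using \<tau> by (simp add: field_simps power2_eq_square)
        then have "p x y * w y \<le> p x y * (\<tau>/2) + p x y * ((w y)^2 / (2 * \<tau>))"
          using mult_left_mono[OF _ p_nonneg[of x y]] by (fastforce simp: distrib_left)
        also have "p x y * ((w y)^2 / (2 * \<tau>)) \<le> C1 / V x h' * ((w y)^2 / (2 * \<tau>))"
          using up True \<tau> by (intro mult_right_mono) auto
        also have "C1 / V x h' * ((w y)^2 / (2 * \<tau>)) = C1 / (2 * \<tau> * V x h') * (w y)^2" by simp
        finally have "ennreal (p x y * w y) \<le> ennreal (p x y * (\<tau>/2) + C1 / (2 * \<tau> * V x h') * (w y)^2)"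
          by (intro ennreal_leI) simp
        also have "\<dots> = ennreal (p x y) * ennreal (\<tau>/2) + ennreal (C1 / (2 * \<tau> * V x h')) * ennreal ((w y)^2)"
          using \<tau> C1_pos Vp p_nonneg by (subst ennreal_plus) (auto simp: ennreal_mult[symmetric])
        finally show ?thesis using True w p_nonneg by (simp add: ennreal_mult)
      next
        case False
        then have "p x y = 0" using up p_nonneg[of x y] by simp
        then show ?thesis by simp
      qed
    qed
  qed
  also have "\<dots> = ennreal (\<tau>/2) + ennreal (C1 / (2 * \<tau> * V x h')) * (\<integral>\<^sup>+y. ennreal ((w y)^2) * indicator (cball x h') y \<partial>M)"
    by (subst nn_integral_add) (auto simp: nn_integral_cmult nn_integral_multc p_mass)
  also have "\<dots> \<le> ennreal (\<tau>/2) + ennreal (C1 / (2 * \<tau> * V x h')) * ennreal K"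
    by (intro add_left_mono mult_left_mono int) simp
  also have "\<dots> = ennreal (\<tau>/2 + C1 / (2 * \<tau> * V x h') * K)"
    using \<tau> C1_pos Vp K by (simp add: ennreal_mult[symmetric])
  finally have "w x \<le> \<tau>/2 + C1 / (2 * \<tau> * V x h') * K"
    using \<tau> C1_pos Vp K by (subst (asm) ennreal_le_iff) auto
  also have "\<dots> = (\<tau> + C1 * K / (\<tau> * V x h')) / 2" using \<tau> Vp by (simp add: field_simps)
  finally show ?thesis .
qed

lemma cutoff_function:
  assumes g: "0 < g"
  obtains \<phi> where "\<phi> \<in> borel_measurable M" "\<And>x. 0 \<le> \<phi> x" "\<And>x. \<phi> x \<le> 1"
    "\<And>x. x \<notin> cball z s \<Longrightarrow> \<phi> x = 0" "\<And>x. dist z x \<le> s - g \<Longrightarrow> \<phi> x = 1"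
    "\<And>x y. \<bar>\<phi> x - \<phi> y\<bar> \<le> 1 / g * dist x y"
proof
  let ?\<phi> = "\<lambda>x. max 0 (min 1 ((s - dist z x) / g))"
  show "?\<phi> \<in> borel_measurable M" by measurable
  show "0 \<le> ?\<phi> x" "?\<phi> x \<le> 1" for x by auto
  show "?\<phi> x = 0" if "x \<notin> cball z s" for x
    using that g by (auto simp: min_def max_def zero_le_divide_iff)
  show "?\<phi> x = 1" if "dist z x \<le> s - g" for x
    using that g by (auto simp: min_def max_def field_simps)
  show "\<bar>?\<phi> x - ?\<phi> y\<bar> \<le> 1 / g * dist x y" for x y
  proof -
    have "\<bar>?\<phi> x - ?\<phi> y\<bar> \<le> \<bar>(s - dist z x) / g - (s - dist z y) / g\<bar>" by linarith
    also have "\<dots> = \<bar>dist z y - dist z x\<bar> / g" using g by (simp add: diff_divide_distrib[symmetric])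
    also have "\<dots> \<le> dist x y / g"
      using g dist_triangle[of z y x] dist_triangle[of z x y] by (intro divide_right_mono) (auto simp: dist_commute)
    finally show ?thesis by simp
  qed
qed

text \<open>Faber-Krahn at scale \<open>s\<close> is applied to \<open>\<phi> * v\<close>, which
  lives where \<open>w\<close> exceeds \<open>t'\<close>, and the Caccioppoli inequality bounds its
  energy with slope \<open>1/g\<close>. The gain is the ratio \<open>s/g\<close>. The gap
  \<open>2 * g\<close> between the radii pays \<open>g\<close> for the slope and at least
  \<open>h'\<close> for the jumps.\<close>

lemma de_giorgi_step:
  assumes FK: "\<And>s f. r0 \<le> s \<Longrightarrow> f \<in> borel_measurable M \<Longrightarrow> (\<exists>B. \<forall>y. \<bar>f y\<bar> \<le> B) \<Longrightarrow>
     (\<forall>y. measure M {x\<in>cball y s. f x \<noteq> 0} \<le> V y s / 2) \<Longrightarrow>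
     (\<integral>\<^sup>+x. ennreal ((f x)^2) \<partial>M) \<le> ennreal (CF * s^2) * (\<integral>\<^sup>+x. energy f x \<partial>M)"
    and CF: "0 < CF"
    and w_meas [measurable]: "w \<in> borel_measurable M" and w: "\<And>x. 0 \<le> w x" "\<And>x. w x \<le> B"
    and sub: "subharmonic_on w (cball z \<rho>)"
    and g: "0 < g" "h' \<le> g" "\<rho>' + 2 * g \<le> \<rho>" and s: "r0 \<le> s" and t: "0 \<le> t" "t \<le> t'"
    and small: "\<And>y. measure M {x\<in>cball y s. x \<in> cball z \<rho> \<and> t' < w x} \<le> V y s / 2"
  shows "(\<integral>\<^sup>+x. ennreal ((max 0 (w x - t'))^2) * indicator (cball z \<rho>') x \<partial>M)
     \<le> ennreal (CF * s^2 * (h'/g)^2) * (\<integral>\<^sup>+x. ennreal ((max 0 (w x - t))^2) * indicator (cball z \<rho>) x \<partial>M)"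
proof -
  define v where "v x = max 0 (w x - t')" for x
  have h': "0 < h'" using h_pos h_le by simp
  obtain \<phi> where [measurable]: "\<phi> \<in> borel_measurable M" and \<phi>: "\<And>x. 0 \<le> \<phi> x" "\<And>x. \<phi> x \<le> 1"
    and supp: "\<And>x. x \<notin> cball z (\<rho> - h') \<Longrightarrow> \<phi> x = 0"
    and one': "\<And>x. dist z x \<le> \<rho> - h' - g \<Longrightarrow> \<phi> x = 1"
    and lip: "\<And>x y. \<bar>\<phi> x - \<phi> y\<bar> \<le> 1 / g * dist x y"
    using cutoff_function[OF g(1), of z "\<rho> - h'"] by blast
  have one: "\<phi> x = 1" if "x \<in> cball z \<rho>'" for x using that g by (intro one') simp
  have [measurable]: "v \<in> borel_measurable M" unfolding v_def by measurable
  have v: "0 \<le> v x" "v x \<le> B" for x using w[of x] t by (auto simp: v_def)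
  have subv: "subharmonic_on v (cball z \<rho>)"
    unfolding v_def using t by (intro subharmonic_truncate sub) auto
  have bd: "\<bar>\<phi> x * v x\<bar> \<le> B" for x
    using mult_mono[OF \<phi>(2) v(2)[of x], of x] v(1)[of x] \<phi>(1)[of x] by (simp add: abs_mult)
  have "(\<integral>\<^sup>+x. ennreal ((v x)^2) * indicator (cball z \<rho>') x \<partial>M) \<le> (\<integral>\<^sup>+x. ennreal ((\<phi> x * v x)^2) \<partial>M)"
    by (intro nn_integral_mono) (auto split: split_indicator simp: one)
  also have "\<dots> \<le> ennreal (CF * s^2) * (\<integral>\<^sup>+x. energy (\<lambda>x. \<phi> x * v x) x \<partial>M)"
  proof (rule FK[OF s])
    show "\<exists>B. \<forall>x. \<bar>\<phi> x * v x\<bar> \<le> B" using bd by blast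
    show "\<forall>y. measure M {x \<in> cball y s. \<phi> x * v x \<noteq> 0} \<le> V y s / 2"
    proof
      fix y
      have sets: "cball y s \<inter> (cball z \<rho> \<inter> {x\<in>space M. t' < w x}) \<in> sets M" by measurable
      have eq: "cball y s \<inter> (cball z \<rho> \<inter> {x\<in>space M. t' < w x}) = {x\<in>cball y s. x \<in> cball z \<rho> \<and> t' < w x}" by auto
      have "measure M {x \<in> cball y s. \<phi> x * v x \<noteq> 0} \<le> measure M {x\<in>cball y s. x \<in> cball z \<rho> \<and> t' < w x}"
      proof (rule measure_mono_fmeasurable)
        show "{x \<in> cball y s. \<phi> x * v x \<noteq> 0} \<subseteq> {x \<in> cball y s. x \<in> cball z \<rho> \<and> t' < w x}"
        proof
          fix x assume x: "x \<in> {x \<in> cball y s. \<phi> x * v x \<noteq> 0}"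
          then have "x \<in> cball z (\<rho> - h')" using supp by auto
          moreover have "t' < w x" using x by (auto simp: v_def max_def split: if_splits)
          ultimately show "x \<in> {x \<in> cball y s. x \<in> cball z \<rho> \<and> t' < w x}" using x h' by auto
        qed
        have "cball y s \<inter> {x\<in>space M. \<phi> x * v x \<noteq> 0} \<in> sets M" by measurable
        then show "{x \<in> cball y s. \<phi> x * v x \<noteq> 0} \<in> sets M" by (simp add: Int_def)
        show "{x \<in> cball y s. x \<in> cball z \<rho> \<and> t' < w x} \<in> fmeasurable M"
        proof (rule fmeasurableI)
          show "{x \<in> cball y s. x \<in> cball z \<rho> \<and> t' < w x} \<in> sets M" using sets unfolding eq .
          have "emeasure M {x \<in> cball y s. x \<in> cball z \<rho> \<and> t' < w x} \<noteq> \<infinity>"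
            by (rule emeasure_subset_cball_finite[of _ y s]) blast
          then show "emeasure M {x \<in> cball y s. x \<in> cball z \<rho> \<and> t' < w x} < \<infinity>" by (simp add: less_top)
        qed
      qed
      then show "measure M {x \<in> cball y s. \<phi> x * v x \<noteq> 0} \<le> V y s / 2" using small[of y] by linarith
    qed
  qed simp
  also have "\<dots> \<le> ennreal (CF * s^2) * (ennreal ((1 / g * h')^2) * (\<integral>\<^sup>+x. ennreal ((v x)^2) * indicator (cball z \<rho>) x \<partial>M))"
    by (intro mult_left_mono caccioppoli_lipschitz[where B=B] v \<phi> supp subv lip) simp_all
  also have "\<dots> = ennreal (CF * s^2 * (h'/g)^2) * (\<integral>\<^sup>+x. ennreal ((v x)^2) * indicator (cball z \<rho>) x \<partial>M)"
    using CF by (simp add: mult.assoc[symmetric] ennreal_mult)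
  also have "\<dots> \<le> ennreal (CF * s^2 * (h'/g)^2) * (\<integral>\<^sup>+x. ennreal ((max 0 (w x - t))^2) * indicator (cball z \<rho>) x \<partial>M)"
    using t by (intro mult_left_mono nn_integral_mono)
      (auto split: split_indicator intro!: ennreal_leI power_mono simp: v_def)
  finally show ?thesis by (simp add: v_def)
qed

lemma chebyshev_level:
  assumes [measurable]: "w \<in> borel_measurable M" and t: "t < t'" and K: "0 \<le> K"
    and int: "(\<integral>\<^sup>+x. ennreal ((max 0 (w x - t))^2) * indicator (cball z \<rho>) x \<partial>M) \<le> ennreal K"
  shows "measure M {x\<in>cball z \<rho>. t' < w x} \<le> K / (t' - t)^2"
proof -
  define A where "A = {x\<in>cball z \<rho>. t' < w x}"
  have "cball z \<rho> \<inter> {x\<in>space M. t' < w x} \<in> sets M" by measurable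
  then have A [measurable]: "A \<in> sets M" by (simp add: Int_def A_def)
  have Afin: "emeasure M A = ennreal (measure M A)"
    by (rule emeasure_subset_cball[of A z \<rho>]) (auto simp: A_def)
  have "ennreal ((t' - t)^2 * measure M A) = ennreal ((t' - t)^2) * emeasure M A"
    unfolding Afin by (simp add: ennreal_mult)
  also have "\<dots> = (\<integral>\<^sup>+x. ennreal ((t' - t)^2) * indicator A x \<partial>M)"
    by (rule nn_integral_cmult_indicator[OF A, symmetric])
  also have "\<dots> \<le> (\<integral>\<^sup>+x. ennreal ((max 0 (w x - t))^2) * indicator (cball z \<rho>) x \<partial>M)"
    using t by (intro nn_integral_mono) (auto split: split_indicator intro!: ennreal_leI power_mono simp: A_def)
  also have "\<dots> \<le> ennreal K" by (rule int)
  finally have "(t' - t)^2 * measure M A \<le> K" using K by simp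
  then show ?thesis using t unfolding A_def[symmetric] by (simp add: field_simps)
qed

lemma uniform_doubling:
  assumes "0 < r1"
  shows "\<exists>D\<ge>1. \<forall>x. \<forall>r\<ge>r1. \<forall>n::nat. V x (2^n * r) \<le> D^n * V x r"
proof -
  obtain D where D: "\<And>x r. r1 \<le> r \<Longrightarrow> V x (2*r) \<le> D * V x r" using doubling[OF assms] by blast
  have D1: "1 \<le> D"
  proof -
    fix x :: 'a
    have "V x r1 \<le> V x (2 * r1)" using assms by (intro V_mono) simp
    also have "\<dots> \<le> D * V x r1" by (rule D) simp
    finally show ?thesis using V_pos[OF assms, of x] by simp
  qed
  have "V x (2^n * r) \<le> D^n * V x r" if "r1 \<le> r" for x r and n :: nat
    by (rule doubling_power[where V=V and ?r1.0=r1]) (use D D1 that assms in auto)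
  with D1 show ?thesis by blast
qed

text \<open>The number of iterations grows with \<open>R\<close>, since the scale has to descend
  from \<open>R\<close> to the fixed \<open>r1\<close>. The constants remain uniform because the
  integrals \<open>A k\<close> decay by \<open>4 * D\<close> per step, which outweighs the loss
  \<open>D\<close> of volume at each halving of the scale.\<close>

lemma mean_value:
  "\<exists>C>0. \<exists>R0>0. \<forall>R z t w. R0 \<le> R \<longrightarrow> 0 < t \<longrightarrow> w \<in> borel_measurable M \<longrightarrow> (\<forall>x. 0 \<le> w x) \<longrightarrow>
     (\<exists>B. \<forall>x. w x \<le> B) \<longrightarrow> subharmonic_on w (cball z R) \<longrightarrow>
     (\<integral>\<^sup>+x. ennreal ((w x)^2) * indicator (cball z R) x \<partial>M) \<le> ennreal (t^2 * V z R) \<longrightarrow>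
     (\<forall>y\<in>cball z (R/2). w y \<le> C * t)"
proof -
  have h': "0 < h'" using h_pos h_le by simp
  obtain CF where CF: "0 < CF" and FK: "\<And>s f. r0 \<le> s \<Longrightarrow> f \<in> borel_measurable M \<Longrightarrow> (\<exists>B. \<forall>y. \<bar>f y\<bar> \<le> B) \<Longrightarrow>
     (\<forall>y. measure M {x\<in>cball y s. f x \<noteq> 0} \<le> V y s / 2) \<Longrightarrow>
     (\<integral>\<^sup>+x. ennreal ((f x)^2) \<partial>M) \<le> ennreal (CF * s^2) * (\<integral>\<^sup>+x. energy f x \<partial>M)"
    using faber_krahn by blast
  define r1 where "r1 = r0 + h'"
  have r1: "0 < r1" "r0 \<le> r1" "h' \<le> r1" using r0_pos h' by (auto simp: r1_def)
  obtain D where D: "1 \<le> D" "\<And>x r n. r1 \<le> r \<Longrightarrow> V x (2^n * r) \<le> D^n * V x r"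
    using uniform_doubling[OF r1(1)] by blast
  obtain C3 where C3: "0 < C3" "\<And>x. V x (2 * r1) \<le> C3 * V x h'"
    using volume_comparison[OF h', of "2 * r1 / h'"] h' by (metis add_0 dist_self nonzero_divide_eq_eq order_refl less_irrefl)
  \<comment> \<open>\<open>l\<close> fixes the ratio \<open>8 / 2^l\<close> of the Faber-Krahn scale
    \<open>s k\<close> to the cutoff width \<open>g\<close>, small enough for the factor of a single
    step to be at most \<open>1 / (4 * D)\<close>. The extra 3 ensures
    \<open>s k \<le> g\<close>.\<close>
  obtain l0 :: nat where l0: "CF * 64 * h'^2 * (4 * D) \<le> 2^l0"
    using real_arch_pow[of 2 "CF * 64 * h'^2 * (4 * D)"] by (auto intro: less_imp_le)
  define l where "l = l0 + 3"
  have l: "CF * 64 * h'^2 / 4^l \<le> 1 / (4 * D)"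
  proof -
    have "(2::real)^l0 \<le> 4^l" unfolding l_def
      by (rule order_trans[OF power_increasing[of l0 "l0+3"] power_mono]) auto
    then have "CF * 64 * h'^2 * (4 * D) \<le> 4^l" using l0 by linarith
    then show ?thesis using D(1) by (simp add: field_simps)
  qed
  have l3: "(8::real) \<le> 2^l" using power_increasing[of 3 l "2::real"] by (simp add: l_def)
  \<comment> \<open>Solves \<open>4 * \<delta> * D^(l+2) = 1/2\<close>: the level sets then fill at
    most half of every ball of radius \<open>s k\<close>.\<close>
  define \<delta> where "\<delta> = 1 / (8 * D^(l+2))"
  have \<delta>: "0 < \<delta>" using D(1) by (simp add: \<delta>_def)
  have bound: "w y \<le> (2 + C1 * C3) * t"
    if R: "2^l * r1 \<le> R" and t: "0 < t" and [measurable]: "w \<in> borel_measurable M" and w: "\<And>x. 0 \<le> w x" "\<And>x. w x \<le> B"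
      and sub: "subharmonic_on w (cball z R)"
      and int: "(\<integral>\<^sup>+x. ennreal ((w x)^2) * indicator (cball z R) x \<partial>M) \<le> ennreal (\<delta> * t^2 * V z R)"
      and y: "y \<in> cball z (R/2)" for R z t w B y
  proof -
    have R0: "0 < R" using R r1 l3 by (meson less_le_trans mult_pos_pos zero_less_numeral zero_less_power)
    \<comment> \<open>Levels rise from 0 towards \<open>t\<close> while the radii
      \<open>\<rho> k\<close> shrink from \<open>R\<close> towards \<open>R/2\<close>. Consecutive
      radii differ by exactly \<open>2 * g\<close> for the \<open>g\<close> used in the
      step.\<close>
    define tk where "tk k = t * (1 - 1 / 2^k)" for k :: nat
    define \<rho> where "\<rho> k = R / 2 * (1 + 1 / 2^k)" for k :: nat
    define s where "s k = R / 2^(k+l)" for k :: nat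
    define A where "A k = (\<integral>\<^sup>+x. ennreal ((max 0 (w x - tk k))^2) * indicator (cball z (\<rho> k)) x \<partial>M)" for k
    \<comment> \<open>The factor \<open>4^k\<close> in the denominator absorbs Chebyshev's loss from
      the level gap \<open>t / 2^(k+1)\<close>, and \<open>D^k\<close> absorbs the passage from the
      volume at radius \<open>R\<close> to that at \<open>s k\<close>.\<close>
    define a where "a k = \<delta> / (4 * D)^k * t^2 * V z R" for k :: nat
    have a0: "0 \<le> a k" for k using \<delta> D(1) by (simp add: a_def)
    have tk: "0 \<le> tk k" "tk k \<le> t" "tk (Suc k) - tk k = t / 2^(Suc k)" for k
      using t by (auto simp: tk_def field_simps)
    have \<rho>R: "\<rho> k \<le> R" "R / 2 \<le> \<rho> k" for k using R0 by (auto simp: \<rho>_def field_simps)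
    have s_pos: "0 < s k" for k using R0 by (simp add: s_def)
    have volR: "V z R \<le> D^(k+l+2) * V y (s k)" if "r1 \<le> s k" "dist y z \<le> 2 * R" for k y
    proof -
      have "V z R \<le> V y (4 * R)" using that R0 by (intro V_mono) (simp add: dist_commute)
      also have "4 * R = 2^(k+l+2) * s k" by (simp add: s_def power_add)
      also have "V y (2^(k+l+2) * s k) \<le> D^(k+l+2) * V y (s k)" by (rule D(2)[OF that(1)])
      finally show ?thesis .
    qed
    have step: "A (Suc k) \<le> ennreal (a (Suc k))" if A: "A k \<le> ennreal (a k)" and sk: "r1 \<le> s k" for k
    proof -
      define g where "g = R / 2^(k+3)"
      have g: "0 < g" using R0 by (simp add: g_def)
      have "h' \<le> s k" using sk r1 by linarith
      also have "s k \<le> g" unfolding s_def g_def using R0 by (intro divide_left_mono power_increasing) (auto simp: l_def)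
      finally have h'g: "h' \<le> g" .
      have gap: "\<rho> (Suc k) + 2 * g \<le> \<rho> k" by (simp add: \<rho>_def g_def power_add field_simps)
      have Om: "measure M {x\<in>cball z (\<rho> k). tk (Suc k) < w x} \<le> 4 * \<delta> / D^k * V z R"
      proof -
        have "tk k < tk (Suc k)" using tk(3)[of k] t by (smt (verit) divide_pos_pos zero_less_power)
        from chebyshev_level[OF _ this a0 A[unfolded A_def]]
        have "measure M {x\<in>cball z (\<rho> k). tk (Suc k) < w x} \<le> a k / (t / 2^(Suc k))^2" unfolding tk(3) by simp
        also have "(t / 2^(Suc k))^2 = t^2 / 4^(Suc k)"
          by (simp add: power_divide power_mult[symmetric] power_mult_distrib) (simp add: power_mult mult.commute[of k 2])
        also have "a k / (t^2 / 4^(Suc k)) = 4 * \<delta> / D^k * V z R"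
          using t by (simp add: a_def power_mult_distrib)
        finally show ?thesis .
      qed
      have small: "measure M {x\<in>cball y (s k). x \<in> cball z (\<rho> k) \<and> tk (Suc k) < w x} \<le> V y (s k) / 2" for y
      proof (cases "dist y z \<le> 2 * R")
        case True
        have sets: "cball z (\<rho> k) \<inter> {x\<in>space M. tk (Suc k) < w x} \<in> sets M"
          "cball y (s k) \<inter> (cball z (\<rho> k) \<inter> {x\<in>space M. tk (Suc k) < w x}) \<in> sets M" by measurable
        have "measure M {x\<in>cball y (s k). x \<in> cball z (\<rho> k) \<and> tk (Suc k) < w x}
            \<le> measure M {x\<in>cball z (\<rho> k). tk (Suc k) < w x}"
        proof (rule measure_mono_fmeasurable)
          show "{x\<in>cball y (s k). x \<in> cball z (\<rho> k) \<and> tk (Suc k) < w x} \<in> sets M"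
            using sets(2) by (simp add: Int_def)
          show "{x\<in>cball z (\<rho> k). tk (Suc k) < w x} \<in> fmeasurable M"
          proof (rule fmeasurableI)
            show "{x\<in>cball z (\<rho> k). tk (Suc k) < w x} \<in> sets M" using sets(1) by (simp add: Int_def)
            have "emeasure M {x\<in>cball z (\<rho> k). tk (Suc k) < w x} \<noteq> \<infinity>"
              by (rule emeasure_subset_cball_finite[of _ z "\<rho> k"]) blast
            then show "emeasure M {x\<in>cball z (\<rho> k). tk (Suc k) < w x} < \<infinity>" by (simp add: less_top)
          qed
        qed blast
        also have "\<dots> \<le> 4 * \<delta> / D^k * V z R" by (rule Om)
        also have "\<dots> \<le> 4 * \<delta> / D^k * (D^(k+l+2) * V y (s k))"
          using \<delta> D(1) by (intro mult_left_mono volR sk True) auto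
        also have "\<dots> = V y (s k) / 2"
          using D(1) by (simp add: \<delta>_def power_add field_simps)
        finally show ?thesis .
      next
        case False
        have "dist y z \<le> s k + \<rho> k" if "x \<in> cball y (s k)" "x \<in> cball z (\<rho> k)" for x
          using that dist_triangle[of y z x] by (simp add: dist_commute)
        moreover have "s k \<le> R" using R0 by (simp add: s_def field_simps)
        ultimately have "{x\<in>cball y (s k). x \<in> cball z (\<rho> k) \<and> tk (Suc k) < w x} = {}"
          using False \<rho>R(1)[of k] by fastforce
        then show ?thesis by (simp only: measure_empty) simp
      qed
      have tl: "tk k \<le> tk (Suc k)" using tk(3)[of k] t by (smt (verit) divide_pos_pos zero_less_power)
      have "A (Suc k) \<le> ennreal (CF * (s k)^2 * (h'/g)^2) * A k"
        unfolding A_def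
      proof (rule de_giorgi_step[OF FK CF _ w _ g h'g gap _ tk(1) tl small])
        show "subharmonic_on w (cball z (\<rho> k))"
          by (rule subharmonic_on_subset[OF sub subset_cball[OF \<rho>R(1)]])
      qed (use sk r1 in simp_all)
      also have "CF * (s k)^2 * (h'/g)^2 = CF * 64 * h'^2 / 4^l"
      proof -
        have "s k / g = 8 / 2^l" using R0 by (simp add: s_def g_def power_add)
        then have "(s k / g)^2 = 64 / 4^l" by (simp add: power_divide power_mult[symmetric]) (simp add: power_mult mult.commute[of l 2])
        moreover have "CF * (s k)^2 * (h'/g)^2 = CF * h'^2 * (s k / g)^2" by (simp add: power_divide)
        ultimately show ?thesis by simp
      qed
      also have "ennreal (CF * 64 * h'^2 / 4^l) * A k \<le> ennreal (1 / (4 * D)) * ennreal (a k)"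
        by (intro mult_mono ennreal_leI l A) auto
      also have "\<dots> = ennreal (a (Suc k))"
        using D(1) a0[of k] by (simp add: ennreal_mult[symmetric]) (simp add: a_def field_simps)
      finally show ?thesis .
    qed
    have A0: "A 0 \<le> ennreal (a 0)"
      using int w by (simp add: A_def a_def tk_def \<rho>_def)
    have s_dec: "s (Suc k) = s k / 2" for k by (simp add: s_def)
    have all: "k = 0 \<or> r1 \<le> s (k-1) \<Longrightarrow> A k \<le> ennreal (a k)" for k
    proof (induction k)
      case (Suc k)
      then have "r1 \<le> s k" by simp
      moreover have "k = 0 \<or> r1 \<le> s (k-1)"
        using \<open>r1 \<le> s k\<close> s_dec[of "k-1"] s_pos[of k] by (cases k) auto
      ultimately show ?case using Suc.IH step by blast
    qed (use A0 in simp)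
    have ex: "\<exists>n. s n < r1"
    proof -
      obtain n where "R / r1 < 2^n" using real_arch_pow[of 2 "R/r1"] by auto
      also have "(2::real)^n \<le> 2^(n+l)" by (intro power_increasing) auto
      finally show ?thesis using r1 by (intro exI[of _ n]) (simp add: s_def field_simps)
    qed
    \<comment> \<open>The iteration performs \<open>N\<close> steps: \<open>s (N - 1)\<close> is
      still admissible for Faber-Krahn and for the jumps, yet at most \<open>2 * r1\<close>, so that
      balls of this radius compare with balls of radius \<open>h'\<close>.\<close>
    define N where "N = (LEAST n. s n < r1)"
    have sN: "s N < r1" unfolding N_def by (rule LeastI_ex[OF ex])
    have "\<not> s 0 < r1" using R by (simp add: s_def field_simps)
    then have "N \<noteq> 0" using sN by metis
    then obtain n where n: "N = Suc n" by (cases N) auto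
    have sn: "r1 \<le> s n" using not_less_Least[of n "\<lambda>n. s n < r1"] n unfolding N_def by simp
    have sn2: "s n \<le> 2 * r1" using sN s_dec[of n] n by simp
    have AN: "A N \<le> ennreal (a N)" using all[of N] sn n by simp
    have dy: "dist y z \<le> R / 2" using y by (simp add: dist_commute)
    have h'N: "h' \<le> R / 2 / 2^N"
    proof -
      have "h' \<le> s n" using sn r1 by simp
      also have "s n \<le> R / 2 / 2^N"
        using l3 R0 by (simp add: s_def n power_add field_simps)
      finally show ?thesis .
    qed
    have sub1: "cball y h' \<subseteq> cball z (\<rho> N)"
    proof
      fix x assume "x \<in> cball y h'"
      then have "dist z x \<le> R / 2 + h'" using dist_triangle[of z x y] dy by (simp add: dist_commute)
      also have "\<dots> \<le> \<rho> N" using h'N by (simp add: \<rho>_def distrib_left)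
      finally show "x \<in> cball z (\<rho> N)" by simp
    qed
    define v where "v x = max 0 (w x - tk N)" for x
    have "v y \<le> (t + C1 * a N / (t * V y h')) / 2"
    proof (rule subharmonic_pointwise[OF _ _ t a0])
      show "subharmonic_on v {y}" unfolding v_def using y R0
        by (intro subharmonic_truncate tk subharmonic_on_subset[OF sub]) auto
      have "(\<integral>\<^sup>+x. ennreal ((v x)^2) * indicator (cball y h') x \<partial>M) \<le> A N"
        unfolding A_def v_def using sub1 by (intro nn_integral_mono) (auto split: split_indicator)
      with AN show "(\<integral>\<^sup>+x. ennreal ((v x)^2) * indicator (cball y h') x \<partial>M) \<le> ennreal (a N)" by (rule order_trans[rotated])
    qed (simp_all add: v_def)
    also have "C1 * a N / (t * V y h') \<le> C1 * C3 * t"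
    proof -
      have Vp: "0 < V y h'" using h' by (rule V_pos)
      have "V z R \<le> D^(n+l+2) * V y (s n)" using dy R0 by (intro volR sn) simp
      also have "V y (s n) \<le> V y (2 * r1)" using sn2 by (intro V_mono) simp
      also have "\<dots> \<le> C3 * V y h'" by (rule C3)
      finally have VV: "V z R \<le> D^(n+l+2) * (C3 * V y h')" using D(1) by (simp add: mult_left_mono)
      \<comment> \<open>The \<open>D^N\<close> in the denominator of \<open>a N\<close>, together
        with \<open>\<delta>\<close>, cancels the doubling loss \<open>D^(n+l+2)\<close>; this makes
        the bound independent of \<open>R\<close>.\<close>
      have "a N \<le> \<delta> / (4 * D)^N * t^2 * (D^(n+l+2) * (C3 * V y h'))"
        unfolding a_def using \<delta> D(1) by (intro mult_left_mono VV) auto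
      also have "\<dots> = (1 / 8 / 4^N / D) * (C3 * t^2 * V y h')"
        using D(1) by (simp add: \<delta>_def n power_add power_mult_distrib field_simps)
      also have "\<dots> \<le> 1 * (C3 * t^2 * V y h')"
      proof (rule mult_right_mono)
        have "1 * 1 * 1 \<le> 8 * 4^N * D" using D(1) by (intro mult_mono) auto
        then show "1 / 8 / 4^N / D \<le> 1" using D(1) by (simp add: field_simps)
      qed (use C3 in simp)
      finally have "a N \<le> C3 * t^2 * V y h'" by simp
      then have "C1 * a N / (t * V y h') \<le> C1 * (C3 * t^2 * V y h') / (t * V y h')"
        using C1_pos t Vp by (intro divide_right_mono mult_left_mono) auto
      also have "\<dots> = C1 * C3 * t" using t Vp by (simp add: power2_eq_square)
      finally show ?thesis .
    qed
    finally have "v y \<le> (t + C1 * C3 * t) / 2" by simp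
    moreover have "0 \<le> C1 * C3 * t" using C1_pos C3 t by simp
    moreover have "w y - tk N \<le> v y" by (simp add: v_def)
    ultimately have "w y \<le> tk N + (t + C1 * C3 * t)" using t by argo
    also have "\<dots> \<le> (2 + C1 * C3) * t" using tk(2)[of N] by (simp add: algebra_simps)
    finally show ?thesis .
  qed
  show ?thesis
  proof (rule exI[of _ "(2 + C1 * C3) / sqrt \<delta>"], rule conjI, goal_cases)
    case 1
    have "0 < C1 * C3" using C1_pos C3 by simp
    then show ?case using \<delta> by simp
  next
    case 2
    show ?case
    proof (rule exI[of _ "2^l * r1"], intro conjI allI impI ballI, goal_cases)
      case 1
      show ?case using r1 by simp
    next
      case (2 R z t w y)
      then obtain B where B: "\<And>x. w x \<le> B" by blast
      \<comment> \<open>Raising the level from \<open>t\<close> to \<open>t / sqrt \<delta>\<close>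
        supplies the smallness that the iteration starts from.\<close>
      have "w y \<le> (2 + C1 * C3) * (t / sqrt \<delta>)"
      proof (rule bound[OF 2(1) _ 2(3) _ B 2(6) _ 2(8)])
        have "\<delta> * (t / sqrt \<delta>)^2 = t^2" using \<delta> by (simp add: power_divide)
        then show "(\<integral>\<^sup>+x. ennreal ((w x)^2) * indicator (cball z R) x \<partial>M) \<le> ennreal (\<delta> * (t / sqrt \<delta>)^2 * V z R)"
          using 2(7) by simp
      qed (use 2 \<delta> in auto)
      then show ?case by simp
    qed
  qed
qed

end

subsection \<open>Logarithms of harmonic functions\<close>

text \<open>For \<open>t = r^2 \<ge> 1\<close> one has
  \<open>ln t = 2 * ln r \<le> 2 * (r - 1)\<close>, while the right side contains
  \<open>(r - 1)^2 * (r + 1)^2 / r^2\<close>. Both sides are invariant under \<open>t\<close> to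
  \<open>1 / t\<close>.\<close>

lemma ln_power2_le:
  assumes t: "0 < (t::real)"
  shows "(ln t)^2 \<le> 4 * ((1 - t)^2 / t)"
proof -
  have ge1: "(ln t)^2 \<le> 4 * ((1 - t)^2 / t)" if t: "1 \<le> t" for t :: real
  proof -
    define r where "r = sqrt t"
    have r: "1 \<le> r" "t = r^2" using t by (auto simp: r_def)
    have "ln t = 2 * ln r" using r by (simp add: ln_realpow)
    also have "\<dots> \<le> 2 * (r - 1)" using ln_le_minus_one[of r] r by simp
    finally have "(ln t)^2 \<le> (2 * (r - 1))^2" using t by (intro power_mono) auto
    also have "\<dots> = 4 * ((r - 1)^2 * 1)" by (simp add: power2_eq_square algebra_simps)
    also have "\<dots> \<le> 4 * ((r - 1)^2 * ((r + 1)^2 / r^2))"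
      using r by (intro mult_left_mono) (auto simp: field_simps)
    also have "\<dots> = 4 * ((1 - t)^2 / t)"
      using r by (simp add: field_simps) (simp add: power2_eq_square algebra_simps)
    finally show ?thesis .
  qed
  show ?thesis
  proof (cases "1 \<le> t")
    case False
    then have "1 \<le> 1 / t" using t by simp
    from ge1[OF this] have "(ln (1/t))^2 \<le> 4 * ((1 - 1/t)^2 / (1/t))" .
    also have "(1 - 1/t)^2 / (1/t) = (1 - t)^2 / t" using t by (simp add: power2_eq_square field_simps)
    also have "(ln (1/t))^2 = (ln t)^2" using t by (simp add: ln_div)
    finally show ?thesis .
  qed (rule ge1)
qed

text \<open>The integrand of the logarithmic energy estimate, with \<open>t = v y / v x\<close>: after integration
  against the kernel the terms \<open>p\<^sup>2 * t\<close> and \<open>q\<^sup>2 / t\<close> cancel \<open>p\<^sup>2 + q\<^sup>2\<close>.\<close>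

lemma log_cutoff_inequality:
  assumes p: "0 \<le> (p::real)" "0 \<le> q" and t: "0 < t"
  shows "(min p q)^2 * (ln t)^2 / 8 + p^2 + q^2 \<le> 3 * (p - q)^2 + p^2 * t + q^2 / t"
proof -
  have main: "q^2 * (ln t)^2 / 8 + p^2 + q^2 \<le> 3 * (p - q)^2 + p^2 * t + q^2 / t"
    if qp: "0 \<le> q" "q \<le> p" and t: "0 < t" for p q t :: real
  proof -
    have "q^2 * (ln t)^2 / 8 \<le> q^2 * (4 * ((1 - t)^2 / t)) / 8"
      using ln_power2_le[OF t] by (intro divide_right_mono mult_left_mono) auto
    also have "\<dots> = q^2 * ((1 - t)^2 / t) / 2" by simp
    finally have l: "q^2 * (ln t)^2 / 8 \<le> q^2 * ((1 - t)^2 / t) / 2" .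
    have sq: "q^2 * ((1 - t)^2 / t) = q^2 * t + q^2 / t - 2 * q^2"
      using t by (simp add: power2_eq_square field_simps)
    show ?thesis
    proof (cases "1 \<le> t")
      case True
      have "q^2 * (t - 1) \<le> p^2 * (t - 1)" using True qp by (intro mult_right_mono power_mono) auto
      then have "q^2 * t - q^2 \<le> p^2 * t - p^2" by (simp add: right_diff_distrib)
      moreover have "0 \<le> q^2 * ((1 - t)^2 / t)" using t by simp
      moreover have "0 \<le> 3 * (p - q)^2" by simp
      ultimately show ?thesis using l unfolding sq by argo
    next
      case False
      \<comment> \<open>For \<open>t < 1\<close> the term \<open>p^2 * t - p^2\<close> is negative.
        Writing \<open>p = q + (p - q)\<close> and completing the square absorbs it into three
        copies of \<open>(p - q)^2\<close> and half of \<open>q^2 * (1 - t)^2\<close>.\<close>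
      have "0 \<le> 2 * ((p - q) - q * (1 - t) / 2)^2 + t * (p - q)^2" using t by simp
      also have "\<dots> = 3 * (p - q)^2 + p^2 * t - p^2 + q^2 * (1 - t) + q^2 * (1 - t)^2 / 2"
        by (simp add: power2_eq_square field_simps)
      finally have 1: "0 \<le> 3 * (p - q)^2 + p^2 * t - p^2 + q^2 * (1 - t) + q^2 * (1 - t)^2 / 2" .
      have 2: "q^2 / t - q^2 = q^2 * (1 - t) + q^2 * ((1 - t)^2 / t)"
        using sq by (simp add: algebra_simps)
      have "q^2 * (1 - t)^2 \<le> q^2 * ((1 - t)^2 / t)"
        using t False by (intro mult_left_mono) (auto simp: field_simps mult_left_le)
      with 1 2 l show ?thesis by simp
    qed
  qed
  show ?thesis
  proof (cases "q \<le> p")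
    case True
    then show ?thesis using main[OF p(2) True t] by (simp only: min_absorb2)
  next
    case False
    \<comment> \<open>The remaining order follows by exchanging \<open>p\<close> with
      \<open>q\<close> and \<open>t\<close> with \<open>1 / t\<close>.\<close>
    have "0 < 1 / t" using t by simp
    from main[OF p(1) _ this, of q] False t show ?thesis
      by (simp add: min_absorb1 ln_div power2_commute[of q p] algebra_simps)
  qed
qed

context random_walk_space
begin

definition harmonic_on :: "('a \<Rightarrow> real) \<Rightarrow> 'a set \<Rightarrow> bool" where
  "harmonic_on u A \<longleftrightarrow> (\<forall>x\<in>A. ennreal (u x) = (\<integral>\<^sup>+y. ennreal (p x y) * ennreal (u y) \<partial>M))"

lemma harmonic_on_subset: "harmonic_on u A \<Longrightarrow> B \<subseteq> A \<Longrightarrow> harmonic_on u B"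
  unfolding harmonic_on_def by blast

text \<open>Kernels of mass one fix constants; the shift makes \<open>u\<close> strictly positive
  before its logarithm is taken.\<close>

lemma harmonic_add_const:
  assumes [measurable]: "u \<in> borel_measurable M" and u: "\<And>x. 0 \<le> u x" and e: "0 \<le> e"
    and harm: "harmonic_on u A"
  shows "harmonic_on (\<lambda>x. u x + e) A"
  unfolding harmonic_on_def
proof
  fix x assume x: "x \<in> A"
  have "(\<integral>\<^sup>+y. ennreal (p x y) * ennreal (u y + e) \<partial>M)
      = (\<integral>\<^sup>+y. ennreal (p x y) * ennreal (u y) + ennreal (p x y) * ennreal e \<partial>M)"
    using u e by (simp add: distrib_left)
  also have "\<dots> = ennreal (u x) + ennreal e"
    using harm x by (simp add: harmonic_on_def nn_integral_add nn_integral_multc p_mass)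
  finally show "ennreal (u x + e) = (\<integral>\<^sup>+y. ennreal (p x y) * ennreal (u y + e) \<partial>M)"
    using u e by simp
qed

text \<open>This is \<open>v = P v\<close> tested with \<open>\<phi>^2 / v\<close>. After
  integration of \<open>log_cutoff_inequality\<close>, the two quotient terms on the right and the
  two squares on the left all equal the finite \<open>I\<close> and cancel.\<close>

lemma log_caccioppoli:
  assumes [measurable]: "v \<in> borel_measurable M" "\<phi> \<in> borel_measurable M"
    and v: "\<And>x. 0 < v x" and \<phi>: "\<And>x. 0 \<le> \<phi> x" "\<And>x. \<phi> x \<le> 1"
    and supp: "\<And>x. x \<notin> cball z R \<Longrightarrow> \<phi> x = 0" and harm: "harmonic_on v (cball z R)"
  shows "(\<integral>\<^sup>+x. \<integral>\<^sup>+y. ennreal (p x y) * ennreal ((min (\<phi> x) (\<phi> y))^2 * (ln (v y / v x))^2 / 8) \<partial>M \<partial>M)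
      \<le> 3 * (\<integral>\<^sup>+x. \<integral>\<^sup>+y. ennreal (p x y) * ennreal ((\<phi> x - \<phi> y)^2) \<partial>M \<partial>M)" (is "?X \<le> 3 * ?T")
proof -
  define I where "I = (\<integral>\<^sup>+x. ennreal ((\<phi> x)^2) \<partial>M)"
  have v0: "0 \<le> v x" for x using v[of x] by simp
  have "I \<le> (\<integral>\<^sup>+x. indicator (cball z R) x \<partial>M)"
    unfolding I_def using \<phi> supp
    by (intro nn_integral_mono) (auto split: split_indicator simp: power_le_one)
  also have "\<dots> < \<infinity>" by (simp add: emeasure_cball)
  finally have Ifin: "I \<noteq> \<infinity>" by simp
  have I1: "(\<integral>\<^sup>+x. \<integral>\<^sup>+y. ennreal (p x y) * ennreal ((\<phi> x)^2) \<partial>M \<partial>M) = I"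
    by (simp add: nn_integral_multc p_mass I_def)
  have I2: "(\<integral>\<^sup>+x. \<integral>\<^sup>+y. ennreal (p x y) * ennreal ((\<phi> y)^2) \<partial>M \<partial>M) = I"
    unfolding I1[symmetric] by (rule kernel_swap[symmetric]) simp
  \<comment> \<open>Where \<open>\<phi>\<close> does not vanish, harmonicity says that
    \<open>v y / v x\<close> has mean 1 under \<open>p x\<close>.\<close>
  have I3: "(\<integral>\<^sup>+x. \<integral>\<^sup>+y. ennreal (p x y) * ennreal ((\<phi> x)^2 * (v y / v x)) \<partial>M \<partial>M) = I"
    unfolding I_def
  proof (rule nn_integral_cong)
    fix x
    have "(\<integral>\<^sup>+y. ennreal (p x y) * ennreal ((\<phi> x)^2 * (v y / v x)) \<partial>M)
       = (\<integral>\<^sup>+y. ennreal ((\<phi> x)^2 / v x) * (ennreal (p x y) * ennreal (v y)) \<partial>M)"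
      using v0 p_nonneg by (intro nn_integral_cong) (simp add: ennreal_mult[symmetric] ac_simps)
    also have "\<dots> = ennreal ((\<phi> x)^2 / v x) * (\<integral>\<^sup>+y. ennreal (p x y) * ennreal (v y) \<partial>M)"
      by (simp add: nn_integral_cmult)
    also have "\<dots> = ennreal ((\<phi> x)^2)"
    proof (cases "x \<in> cball z R")
      case True
      then have "(\<integral>\<^sup>+y. ennreal (p x y) * ennreal (v y) \<partial>M) = ennreal (v x)"
        using harm by (simp add: harmonic_on_def)
      then show ?thesis using v[of x] by (simp add: ennreal_mult[symmetric])
    qed (simp add: supp)
    finally show "(\<integral>\<^sup>+y. ennreal (p x y) * ennreal ((\<phi> x)^2 * (v y / v x)) \<partial>M) = ennreal ((\<phi> x)^2)" .
  qed
  have I4: "(\<integral>\<^sup>+x. \<integral>\<^sup>+y. ennreal (p x y) * ennreal ((\<phi> y)^2 * (v x / v y)) \<partial>M \<partial>M) = I"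
    unfolding I3[symmetric] by (rule kernel_swap[symmetric]) simp
  have "?X + (I + I) = (\<integral>\<^sup>+x. \<integral>\<^sup>+y. ennreal (p x y) * (ennreal ((min (\<phi> x) (\<phi> y))^2 * (ln (v y / v x))^2 / 8)
       + (ennreal ((\<phi> x)^2) + ennreal ((\<phi> y)^2))) \<partial>M \<partial>M)"
    unfolding I1[symmetric] by (subst (2) I1, subst I2[symmetric]) (simp add: nn_integral_add distrib_left)
  also have "\<dots> \<le> (\<integral>\<^sup>+x. \<integral>\<^sup>+y. ennreal (p x y) * (3 * ennreal ((\<phi> x - \<phi> y)^2)
       + (ennreal ((\<phi> x)^2 * (v y / v x)) + ennreal ((\<phi> y)^2 * (v x / v y)))) \<partial>M \<partial>M)"
  proof (intro nn_integral_mono mult_left_mono)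
    fix x y
    have "(min (\<phi> x) (\<phi> y))^2 * (ln (v y / v x))^2 / 8 + (\<phi> x)^2 + (\<phi> y)^2
        \<le> 3 * (\<phi> x - \<phi> y)^2 + (\<phi> x)^2 * (v y / v x) + (\<phi> y)^2 / (v y / v x)"
      using v[of x] v[of y] by (intro log_cutoff_inequality \<phi>) simp
    then have "ennreal ((min (\<phi> x) (\<phi> y))^2 * (ln (v y / v x))^2 / 8 + ((\<phi> x)^2 + (\<phi> y)^2))
      \<le> ennreal (3 * (\<phi> x - \<phi> y)^2 + ((\<phi> x)^2 * (v y / v x) + (\<phi> y)^2 * (v x / v y)))"
      by (intro ennreal_leI) simp
    then show "ennreal ((min (\<phi> x) (\<phi> y))^2 * (ln (v y / v x))^2 / 8) + (ennreal ((\<phi> x)^2) + ennreal ((\<phi> y)^2))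
      \<le> 3 * ennreal ((\<phi> x - \<phi> y)^2) + (ennreal ((\<phi> x)^2 * (v y / v x)) + ennreal ((\<phi> y)^2 * (v x / v y)))"
      using v0 by (simp add: ennreal_plus ennreal_mult)
  qed simp
  also have "\<dots> = 3 * ?T + (I + I)"
    by (simp add: nn_integral_add distrib_left I3[simplified] I4[simplified] mult.left_commute[of _ 3] nn_integral_cmult)
  finally show ?thesis using Ifin by (simp add: ennreal_add_left_cancel_le add.commute[of _ "I + I"])
qed

text \<open>The cutoff is 1 up to radius \<open>\<rho> + h'\<close>, so both ends of every jump from
  \<open>cball z \<rho>\<close> see the value 1, and it changes by at most
  \<open>2 * h' / \<rho>\<close> along a jump. Truncation does not increase differences of
  logarithms. The constant is \<open>96 = 8 * 3 * 4\<close>.\<close>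

lemma log_energy:
  assumes [measurable]: "v \<in> borel_measurable M" and v: "\<And>x. 0 < v x" and a: "0 < a"
    and \<rho>: "4 * h' \<le> \<rho>" and harm: "harmonic_on v (cball z (2 * \<rho>))"
  shows "(\<integral>\<^sup>+x. energy (\<lambda>x. max 0 (ln (a / v x))) x * indicator (cball z \<rho>) x \<partial>M)
    \<le> ennreal (96 * h'^2 / \<rho>^2 * V z (2 * \<rho>))"
proof -
  have h': "0 < h'" using h_pos h_le by simp
  have \<rho>0: "0 < \<rho>" using h' \<rho> by simp
  obtain \<phi> where [measurable]: "\<phi> \<in> borel_measurable M" and \<phi>: "\<And>x. 0 \<le> \<phi> x" "\<And>x. \<phi> x \<le> 1"
    and supp': "\<And>x. x \<notin> cball z (2 * \<rho> - h') \<Longrightarrow> \<phi> x = 0"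
    and one': "\<And>x. dist z x \<le> 2 * \<rho> - h' - \<rho> / 2 \<Longrightarrow> \<phi> x = 1"
    and lip: "\<And>x y. \<bar>\<phi> x - \<phi> y\<bar> \<le> 1 / (\<rho> / 2) * dist x y"
    using cutoff_function[of "\<rho> / 2" z "2 * \<rho> - h'"] \<rho>0 by auto
  have supp: "\<phi> x = 0" if "x \<notin> cball z (2 * \<rho>)" for x using supp'[of x] that h' by auto
  have one: "\<phi> x = 1" if "dist z x \<le> \<rho> + h'" for x using that \<rho> by (intro one') simp
  define w where "w x = max 0 (ln (a / v x))" for x
  have [measurable]: "w \<in> borel_measurable M" unfolding w_def by measurable
  have "(\<integral>\<^sup>+x. energy w x * indicator (cball z \<rho>) x \<partial>M)
     \<le> (\<integral>\<^sup>+x. \<integral>\<^sup>+y. 8 * (ennreal (p x y) * ennreal ((min (\<phi> x) (\<phi> y))^2 * (ln (v y / v x))^2 / 8)) \<partial>M \<partial>M)"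
  proof (intro nn_integral_mono)
    fix x
    show "energy w x * indicator (cball z \<rho>) x
      \<le> (\<integral>\<^sup>+y. 8 * (ennreal (p x y) * ennreal ((min (\<phi> x) (\<phi> y))^2 * (ln (v y / v x))^2 / 8)) \<partial>M)"
    proof (cases "x \<in> cball z \<rho>")
      case True
      have "energy w x \<le> (\<integral>\<^sup>+y. 8 * (ennreal (p x y) * ennreal ((min (\<phi> x) (\<phi> y))^2 * (ln (v y / v x))^2 / 8)) \<partial>M)"
        unfolding energy_def
      proof (rule nn_integral_mono_AE)
        show "AE y in M. ennreal (p x y) * ennreal ((w x - w y)^2)
          \<le> 8 * (ennreal (p x y) * ennreal ((min (\<phi> x) (\<phi> y))^2 * (ln (v y / v x))^2 / 8))"
          using p_support[of x]
        proof eventually_elim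
          fix y assume d: "dist x y \<le> h' \<or> p x y = 0"
          show "ennreal (p x y) * ennreal ((w x - w y)^2)
            \<le> 8 * (ennreal (p x y) * ennreal ((min (\<phi> x) (\<phi> y))^2 * (ln (v y / v x))^2 / 8))"
          proof (cases "p x y = 0")
            case False
            then have "dist x y \<le> h'" using d by simp
            then have "\<phi> y = 1" "\<phi> x = 1"
              using True h' dist_triangle[of z y x] by (auto intro!: one)
            moreover have "(w x - w y)^2 \<le> (ln (v y / v x))^2"
            proof -
              have "ln (v y / v x) = ln (a / v x) - ln (a / v y)"
                using v[of x] v[of y] a by (simp add: ln_div)
              then have "\<bar>w x - w y\<bar> \<le> \<bar>ln (v y / v x)\<bar>" unfolding w_def by linarith
              then show ?thesis by (metis abs_le_square_iff)
            qed
            then have "ennreal ((w x - w y)^2) \<le> 8 * ennreal ((ln (v y / v x))^2 / 8)"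
              by (simp add: ennreal_mult[symmetric] ennreal_leI flip: ennreal_numeral)
            ultimately show ?thesis using mult_left_mono[of _ _ "ennreal (p x y)"] by (simp add: mult.left_commute[of 8])
          qed simp
        qed
      qed
      then show ?thesis using True by simp
    qed simp
  qed
  also have "\<dots> = 8 * (\<integral>\<^sup>+x. \<integral>\<^sup>+y. ennreal (p x y) * ennreal ((min (\<phi> x) (\<phi> y))^2 * (ln (v y / v x))^2 / 8) \<partial>M \<partial>M)"
    by (simp add: nn_integral_cmult)
  also have "\<dots> \<le> 8 * (3 * (\<integral>\<^sup>+x. \<integral>\<^sup>+y. ennreal (p x y) * ennreal ((\<phi> x - \<phi> y)^2) \<partial>M \<partial>M))"
    by (intro mult_left_mono log_caccioppoli[OF _ _ v \<phi> supp harm]) simp_all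
  also have "\<dots> \<le> 8 * (3 * (\<integral>\<^sup>+x. \<integral>\<^sup>+y. ennreal (p x y) * (ennreal ((h' / (\<rho> / 2))^2) * indicator (cball z (2 * \<rho>)) x) \<partial>M \<partial>M))"
  proof (rule mult_left_mono, rule mult_left_mono, rule nn_integral_mono, rule nn_integral_mono_AE)
    fix x
    show "AE y in M. ennreal (p x y) * ennreal ((\<phi> x - \<phi> y)^2)
        \<le> ennreal (p x y) * (ennreal ((h' / (\<rho> / 2))^2) * indicator (cball z (2 * \<rho>)) x)"
      using p_support[of x]
    proof eventually_elim
      fix y assume d: "dist x y \<le> h' \<or> p x y = 0"
      show "ennreal (p x y) * ennreal ((\<phi> x - \<phi> y)^2)
        \<le> ennreal (p x y) * (ennreal ((h' / (\<rho> / 2))^2) * indicator (cball z (2 * \<rho>)) x)"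
      proof (cases "p x y = 0 \<or> \<phi> x = \<phi> y")
        case False
        then have d: "dist x y \<le> h'" using d by simp
        have "x \<in> cball z (2 * \<rho> - h') \<or> y \<in> cball z (2 * \<rho> - h')" using False supp' by metis
        then have x: "x \<in> cball z (2 * \<rho>)"
          using d h' dist_triangle[of z x y] by (auto simp: dist_commute)
        have "\<bar>\<phi> x - \<phi> y\<bar> \<le> h' / (\<rho> / 2)"
          using order_trans[OF lip[of x y] mult_left_mono[OF d, of "1 / (\<rho> / 2)"]] \<rho>0 by (simp add: mult.commute)
        then have "(\<phi> x - \<phi> y)^2 \<le> (h' / (\<rho> / 2))^2" by (metis abs_ge_zero power2_abs power_mono)
        then show ?thesis using x by (intro mult_left_mono) (auto intro: ennreal_leI)
      qed auto
    qed
  qed simp_all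
  also have "\<dots> = 8 * (3 * (ennreal ((h' / (\<rho> / 2))^2) * ennreal (V z (2 * \<rho>))))"
    by (simp add: nn_integral_multc p_mass nn_integral_cmult emeasure_cball)
  also have "\<dots> = ennreal (96 * h'^2 / \<rho>^2 * V z (2 * \<rho>))"
    by (simp add: ennreal_mult[symmetric] power_divide power_mult_distrib flip: ennreal_numeral)
  finally show ?thesis unfolding w_def .
qed

text \<open>Jensen's inequality by hand: where \<open>w x > 0\<close>,
  \<open>ln s \<le> s - 1\<close> gives \<open>w x \<le> w y + v y / v x - 1\<close> for every
  \<open>y\<close>, and \<open>v y / v x\<close> has mean 1 under \<open>p x\<close>.\<close>

lemma log_subharmonic:
  assumes [measurable]: "v \<in> borel_measurable M" and v: "\<And>x. 0 < v x" and a: "0 < a" and harm: "harmonic_on v A"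
  shows "subharmonic_on (\<lambda>x. max 0 (ln (a / v x))) A"
  unfolding subharmonic_on_def
proof
  fix x assume x: "x \<in> A"
  define w where "w x = max 0 (ln (a / v x))" for x
  have [measurable]: "w \<in> borel_measurable M" unfolding w_def by measurable
  have w0: "0 \<le> w y" for y by (simp add: w_def)
  have v0: "0 \<le> v y" for y using v[of y] by simp
  have "ennreal (w x) \<le> (\<integral>\<^sup>+y. ennreal (p x y) * ennreal (w y) \<partial>M)"
  proof (cases "a \<le> v x")
    case True
    then have "ln (a / v x) \<le> 0" using v[of x] a by simp
    then have "w x = 0" by (simp add: w_def)
    then show ?thesis by simp
  next
    case False
    have "(\<integral>\<^sup>+y. ennreal (p x y) * (ennreal (1 / v x) * ennreal (v y)) \<partial>M)
        = ennreal (1 / v x) * (\<integral>\<^sup>+y. ennreal (p x y) * ennreal (v y) \<partial>M)"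
      by (subst nn_integral_cmult[symmetric]) (auto intro!: nn_integral_cong simp: ac_simps)
    also have "\<dots> = ennreal (1 / v x) * ennreal (v x)"
      using harm x by (simp add: harmonic_on_def)
    also have "\<dots> = 1" using v[of x] by (simp add: ennreal_mult[symmetric])
    finally have one: "(\<integral>\<^sup>+y. ennreal (p x y) * (ennreal (1 / v x) * ennreal (v y)) \<partial>M) = 1" .
    have "ennreal (w x) + 1 = (\<integral>\<^sup>+y. ennreal (p x y) * (ennreal (w x) + 1) \<partial>M)"
      by (simp add: nn_integral_multc p_mass)
    also have "\<dots> \<le> (\<integral>\<^sup>+y. ennreal (p x y) * (ennreal (w y) + ennreal (1 / v x) * ennreal (v y)) \<partial>M)"
    proof (intro nn_integral_mono mult_left_mono)
      fix y
      have "w x = ln (a / v x)" using False v[of x] by (simp add: w_def)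
      also have "\<dots> = ln (a / v y) + ln (v y / v x)" using v[of x] v[of y] a by (simp add: ln_div)
      also have "\<dots> \<le> w y + (v y / v x - 1)"
        using v[of x] v[of y] by (intro add_mono ln_le_minus_one) (auto simp: w_def)
      finally have "ennreal (w x + 1) \<le> ennreal (w y + v y / v x)" by (intro ennreal_leI) simp
      then show "ennreal (w x) + 1 \<le> ennreal (w y) + ennreal (1 / v x) * ennreal (v y)"
        using w0 v0 by (simp add: ennreal_mult[symmetric])
    qed simp
    also have "\<dots> = (\<integral>\<^sup>+y. ennreal (p x y) * ennreal (w y) \<partial>M) + 1"
      by (simp add: distrib_left nn_integral_add one)
    finally show ?thesis by (simp add: ennreal_add_left_cancel_le add.commute[of _ 1])
  qed
  then show "ennreal (max 0 (ln (a / v x))) \<le> (\<integral>\<^sup>+y. ennreal (p x y) * ennreal (max 0 (ln (a / v y))) \<partial>M)"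
    by (simp add: w_def)
qed

text \<open>\<open>A\<close> and \<open>R0\<close> precede \<open>\<epsilon>\<close>, so the
  fraction affects only \<open>\<delta>\<close>. The Poincare inequality is used on radius
  \<open>4 * R\<close>, whose half is the \<open>2 * R\<close> of the conclusion. Reaching twice the
  original radius is what allows iteration.\<close>

lemma growth_lemma:
  "\<exists>A\<ge>1. \<exists>R0>0. \<forall>\<epsilon>>0. \<exists>\<delta>>0. \<forall>z R u a. R0 \<le> R \<longrightarrow> u \<in> borel_measurable M \<longrightarrow> (\<forall>x. 0 \<le> u x) \<longrightarrow> 0 < a \<longrightarrow>
     harmonic_on u (cball z (A * R)) \<longrightarrow> \<epsilon> * V z R \<le> measure M {x\<in>cball z R. a \<le> u x} \<longrightarrow>
     (\<forall>y\<in>cball z (2 * R). \<delta> * a \<le> u y)"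
proof -
  have h': "0 < h'" using h_pos h_le by simp
  obtain CM R1 where CM: "0 < CM" "0 < R1" and MV: "\<And>R z t w. R1 \<le> R \<Longrightarrow> 0 < t \<Longrightarrow> w \<in> borel_measurable M \<Longrightarrow> (\<forall>x. 0 \<le> w x) \<Longrightarrow>
     (\<exists>B. \<forall>x. w x \<le> B) \<Longrightarrow> subharmonic_on w (cball z R) \<Longrightarrow>
     (\<integral>\<^sup>+x. ennreal ((w x)^2) * indicator (cball z R) x \<partial>M) \<le> ennreal (t^2 * V z R) \<Longrightarrow>
     (\<forall>y\<in>cball z (R/2). w y \<le> CM * t)"
    using mean_value by blast
  define R0 where "R0 = R1 + r0 + h'"
  have R0: "0 < R0" "R1 \<le> R0" "r0 \<le> R0" "h' \<le> R0" using CM r0_pos h' by (auto simp: R0_def)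
  obtain Cv where Cv: "0 < Cv" "\<And>x y r R. R0 \<le> r \<Longrightarrow> dist x y + R \<le> (8 * C2) * r \<Longrightarrow> V x R \<le> Cv * V y r"
    using volume_comparison[OF R0(1)] by metis
  have "\<exists>\<delta>>0. \<forall>z R u a. R0 \<le> R \<longrightarrow> u \<in> borel_measurable M \<longrightarrow> (\<forall>x. 0 \<le> u x) \<longrightarrow> 0 < a \<longrightarrow>
     harmonic_on u (cball z (8 * C2 * R)) \<longrightarrow> \<epsilon> * V z R \<le> measure M {x\<in>cball z R. a \<le> u x} \<longrightarrow>
     (\<forall>y\<in>cball z (2 * R). \<delta> * a \<le> u y)" if \<epsilon>: "0 < \<epsilon>" for \<epsilon>
  proof -
    define K where "K = (2 + 2 / (\<epsilon> / Cv)) * CP * (96 * h'^2 / C2^2) * Cv"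
    have K: "0 < K" unfolding K_def using \<epsilon> Cv CP_pos h' C2_ge by (intro mult_pos_pos add_pos_pos divide_pos_pos) auto
    have "exp (- (CM * sqrt K)) * a \<le> u y"
      if R: "R0 \<le> R" and [measurable]: "u \<in> borel_measurable M" and u: "\<And>x. 0 \<le> u x" and a: "0 < a"
        and harm: "harmonic_on u (cball z (8 * C2 * R))" and big: "\<epsilon> * V z R \<le> measure M {x\<in>cball z R. a \<le> u x}"
        and y: "y \<in> cball z (2 * R)" for z R u a y
    \<comment> \<open>The shift by \<open>e\<close> keeps \<open>w\<close> bounded, as the mean
      value inequality requires; the resulting bound does not involve \<open>e\<close>.\<close>
    proof (rule field_le_epsilon)
      fix e :: real assume e: "0 < e"
      have Rpos: "0 < R" using R R0 by simp
      define v where "v x = u x + e" for x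
      define w where "w x = max 0 (ln (a / v x))" for x
      have [measurable]: "v \<in> borel_measurable M" "w \<in> borel_measurable M"
        unfolding w_def v_def by measurable
      have v: "0 < v x" "e \<le> v x" for x using u[of x] e by (auto simp: v_def)
      have hv: "harmonic_on v (cball z (8 * C2 * R))"
        unfolding v_def using u e harm by (intro harmonic_add_const) auto
      have w0: "0 \<le> w x" for x by (simp add: w_def)
      have wB: "w x \<le> max 0 (ln (a / e))" for x
      proof -
        have "a / v x \<le> a / e" using v[of x] e a by (intro divide_left_mono) auto
        then have "ln (a / v x) \<le> ln (a / e)" using v[of x] e a by (subst ln_le_cancel_iff) auto
        then show ?thesis unfolding w_def by linarith
      qed
      have wabs: "\<bar>w x\<bar> \<le> max 0 (ln (a / e))" for x using w0 wB[of x] by (simp add: abs_of_nonneg)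
      have "4 * R \<le> 8 * C2 * R" using C2_ge Rpos by simp
      then have subw: "subharmonic_on w (cball z (4 * R))"
        unfolding w_def by (intro log_subharmonic v a harmonic_on_subset[OF hv] subset_cball) auto
      define Z where "Z = {x\<in>cball z R. a \<le> u x}"
      have "cball z R \<inter> {x\<in>space M. a \<le> u x} \<in> sets M" by measurable
      then have Z: "Z \<in> sets M" by (simp add: Z_def Int_def)
      have ZB: "Z \<subseteq> cball z (4 * R)" using Rpos by (auto simp: Z_def)
      have wZ: "w x = 0" if "x \<in> Z" for x
      proof -
        have "a \<le> v x" using that e by (simp add: Z_def v_def)
        then have "ln (a / v x) \<le> 0" using v[of x] a by simp
        then show ?thesis by (simp add: w_def)
      qed
      have V4: "V z (4 * R) \<le> Cv * V z R"
        by (rule Cv(2)[OF R]) (use C2_ge Rpos in simp)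
      have frac: "\<epsilon> / Cv * V z (4 * R) \<le> measure M Z"
      proof -
        have "\<epsilon> / Cv * V z (4 * R) \<le> \<epsilon> / Cv * (Cv * V z R)"
          using \<epsilon> Cv by (intro mult_left_mono V4) auto
        also have "\<dots> = \<epsilon> * V z R" using Cv by simp
        finally show ?thesis using big by (simp add: Z_def)
      qed
      have "(\<integral>\<^sup>+x. ennreal ((w x)^2) * indicator (cball z (4 * R)) x \<partial>M)
        \<le> ennreal ((2 + 2 / (\<epsilon> / Cv)) * CP * (4 * R)^2) * (\<integral>\<^sup>+x. energy w x * indicator (cball z (C2 * (4 * R))) x \<partial>M)"
        by (rule poincare_zero[OF _ wabs _ Z ZB wZ _ frac]) (use R R0 \<epsilon> Cv in auto)
      also have "\<dots> \<le> ennreal ((2 + 2 / (\<epsilon> / Cv)) * CP * (4 * R)^2) *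
         ennreal (96 * h'^2 / (C2 * (4 * R))^2 * V z (2 * (C2 * (4 * R))))"
        unfolding w_def
      proof (intro mult_left_mono log_energy v a)
        have "1 * h' \<le> C2 * R" using C2_ge R R0 h' by (intro mult_mono) auto
        then show "4 * h' \<le> C2 * (4 * R)" by simp
        show "harmonic_on v (cball z (2 * (C2 * (4 * R))))" using hv by (simp add: mult.assoc[symmetric])
      qed simp_all
      also have "\<dots> = ennreal ((2 + 2 / (\<epsilon> / Cv)) * CP * (4 * R)^2 * (96 * h'^2 / (C2 * (4 * R))^2 * V z (2 * (C2 * (4 * R)))))"
        using \<epsilon> Cv CP_pos by (intro ennreal_mult[symmetric]) auto
      also have "\<dots> \<le> ennreal ((2 + 2 / (\<epsilon> / Cv)) * CP * (4 * R)^2 * (96 * h'^2 / (C2 * (4 * R))^2 * (Cv * V z (4 * R))))"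
      proof (intro ennreal_leI mult_left_mono)
        show "V z (2 * (C2 * (4 * R))) \<le> Cv * V z (4 * R)"
          by (rule Cv(2)) (use R R0 C2_ge Rpos in auto)
      qed (use \<epsilon> Cv CP_pos in auto)
      \<comment> \<open>Here the \<open>R^2\<close> of the Poincare inequality cancels the
        \<open>1 / R^2\<close> of the logarithmic energy, leaving a \<open>K\<close> free of
        \<open>R\<close>.\<close>
      also have "(2 + 2 / (\<epsilon> / Cv)) * CP * (4 * R)^2 * (96 * h'^2 / (C2 * (4 * R))^2 * (Cv * V z (4 * R)))
         = (sqrt K)^2 * V z (4 * R)"
        using K Rpos by (simp add: K_def power_mult_distrib)
      finally have int: "(\<integral>\<^sup>+x. ennreal ((w x)^2) * indicator (cball z (4 * R)) x \<partial>M) \<le> ennreal ((sqrt K)^2 * V z (4 * R))" .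
      have "\<forall>y\<in>cball z (4 * R / 2). w y \<le> CM * sqrt K"
        by (rule MV[OF _ _ _ _ _ subw int]) (use R R0 K w0 wB in auto)
      then have "w y \<le> CM * sqrt K" using y by simp
      then have "ln (a / v y) \<le> CM * sqrt K" by (simp add: w_def)
      then have "a / v y \<le> exp (CM * sqrt K)" using v[of y] a by (metis divide_pos_pos exp_le_cancel_iff exp_ln)
      then have "a / exp (CM * sqrt K) \<le> v y" using v[of y] by (simp add: field_simps)
      then show "exp (- (CM * sqrt K)) * a \<le> u y + e" by (simp add: v_def exp_minus field_simps)
    qed
    then show ?thesis by (intro exI[of _ "exp (- (CM * sqrt K))"]) auto
  qed
  then show ?thesis using C2_ge R0 by (intro exI[of _ "8 * C2"]) auto
qed

end

subsection \<open>Local comparison along chains\<close>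

lemma dist_le_chain_length: "dist (z 0) (z i) \<le> (\<Sum>j<i. dist (z j) (z (Suc j)))" for z :: "nat \<Rightarrow> 'a::metric_space"
proof (induction i)
  case (Suc i)
  then show ?case using dist_triangle[of "z 0" "z (Suc i)" "z i"] by simp
qed simp

text \<open>Each hop to the first chain point at distance more than \<open>\<eta>\<close> uses up length \<open>\<eta>\<close>, so the
  number of hops is controlled by the length of the chain and not by its number of points.\<close>

lemma chain_comparison:
  fixes J :: "'a::metric_space \<Rightarrow> ennreal"
  assumes \<eta>: "0 < \<eta>" and b: "0 \<le> b" and K: "1 \<le> K"
    and step: "\<And>i. i < m \<Longrightarrow> dist (z i) (z (Suc i)) \<le> b"
    and len: "(\<Sum>i<m. dist (z i) (z (Suc i))) \<le> real n * \<eta>"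
    and hop: "\<And>i y. i \<le> m \<Longrightarrow> dist (z i) y \<le> b + \<eta> \<Longrightarrow> J y \<le> K * J (z i)"
  shows "J (z m) \<le> K ^ Suc n * J (z 0)"
  using step len hop
proof (induction n arbitrary: z m)
  case (0 z m)
  have "dist (z 0) (z m) \<le> b + \<eta>" using dist_le_chain_length[of z m] 0(2) \<eta> b by simp
  from 0(3)[OF _ this] show ?case by simp
next
  case (Suc n z m)
  show ?case
  proof (cases "\<forall>i\<le>m. dist (z 0) (z i) \<le> \<eta>")
    case True
    have "J (z m) \<le> K * J (z 0)" by (rule Suc.prems(3)) (use True b in \<open>auto intro: add_increasing\<close>)
    also have "K * J (z 0) \<le> K ^ Suc (Suc n) * J (z 0)"
      using power_increasing[of 1 "Suc (Suc n)" K] K by (intro mult_right_mono) auto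
    finally show ?thesis .
  next
    case False
    then have ex: "\<exists>i. i \<le> m \<and> \<eta> < dist (z 0) (z i)" by (auto simp: not_le)
    \<comment> \<open>Minimality keeps the predecessor within \<open>\<eta>\<close>, so this point
      is at most \<open>b + \<eta>\<close> away and a single hop reaches it.\<close>
    define i where "i = (LEAST i. i \<le> m \<and> \<eta> < dist (z 0) (z i))"
    have i: "i \<le> m" "\<eta> < dist (z 0) (z i)" using LeastI_ex[OF ex] unfolding i_def by auto
    have "i \<noteq> 0"
    proof
      assume "i = 0"
      with i(2) \<eta> show False by simp
    qed
    then obtain k where k: "i = Suc k" by (cases i) auto
    have "\<not> (k \<le> m \<and> \<eta> < dist (z 0) (z k))" 
      by (rule not_less_Least) (use k in \<open>simp add: i_def\<close>)
    then have "dist (z 0) (z k) \<le> \<eta>" using i k by simp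
    moreover have "dist (z k) (z i) \<le> b" using Suc.prems(1)[of k] i k by simp
    ultimately have "dist (z 0) (z i) \<le> b + \<eta>" using dist_triangle[of "z 0" "z i" "z k"] by simp
    then have first: "J (z i) \<le> K * J (z 0)" by (intro Suc.prems(3)) auto
    define z' where "z' j = z (i + j)" for j
    have "J (z' (m - i)) \<le> K ^ Suc n * J (z' 0)"
    proof (rule Suc.IH)
      show "dist (z' j) (z' (Suc j)) \<le> b" if "j < m - i" for j
        using Suc.prems(1)[of "i + j"] that by (simp add: z'_def)
      show "J y \<le> K * J (z' j)" if "j \<le> m - i" "dist (z' j) y \<le> b + \<eta>" for j y
        using Suc.prems(3)[of "i + j" y] that i by (simp add: z'_def)
      have split: "(\<Sum>j<i+k. f j) = (\<Sum>j<i. f j) + (\<Sum>j<k. f (i + j))" for i k and f :: "nat \<Rightarrow> real"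
        by (induction k) auto
      have "(\<Sum>j<m. dist (z j) (z (Suc j))) = (\<Sum>j<i. dist (z j) (z (Suc j))) + (\<Sum>j<m-i. dist (z' j) (z' (Suc j)))"
        using split[where i=i and k="m - i" and f="\<lambda>j. dist (z j) (z (Suc j))"] i by (simp add: z'_def)
      then show "(\<Sum>j<m - i. dist (z' j) (z' (Suc j))) \<le> real n * \<eta>"
        using Suc.prems(2) dist_le_chain_length[of z i] i(2) by (simp add: algebra_simps)
    qed
    then have "J (z m) \<le> K ^ Suc n * J (z i)" using i by (simp add: z'_def)
    also have "\<dots> \<le> K ^ Suc n * (K * J (z 0))" by (intro mult_left_mono first) simp
    finally show ?thesis by (simp add: ac_simps)
  qed
qed

text \<open>The infimum defining \<open>dist_b\<close> need not be attained; the added 1 makes the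
  bound strict, also for \<open>x = y\<close>, so that some chain meets it.\<close>

lemma quasi_geodesic_chain:
  assumes "quasi_b_geodesic b TYPE('a::metric_space)"
  shows "\<exists>Q\<ge>0. \<forall>x y::'a. \<exists>z m. z 0 = x \<and> z m = y \<and> (\<forall>i<m. dist (z i) (z (Suc i)) \<le> b) \<and>
     (\<Sum>i<m. dist (z i) (z (Suc i))) \<le> Q * dist x y + 1"
proof -
  obtain C where C: "\<And>x y::'a. dist_b b x y \<le> ennreal (C * dist x y)"
    using assms by (auto simp: quasi_b_geodesic_def)
  have "\<exists>z m. z 0 = x \<and> z m = y \<and> (\<forall>i<m. dist (z i) (z (Suc i)) \<le> b) \<and>
     (\<Sum>i<m. dist (z i) (z (Suc i))) \<le> max C 0 * dist x y + 1" for x y :: 'a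
  proof -
    have "dist_b b x y \<le> ennreal (max C 0 * dist x y)"
      by (rule order_trans[OF C ennreal_leI]) (simp add: mult_right_mono)
    also have "\<dots> < ennreal (max C 0 * dist x y + 1)" by (rule ennreal_lessI) (auto intro: add_nonneg_pos)
    finally obtain zm where zm: "zm \<in> b_chains b x y"
      "ennreal (\<Sum>i<snd zm. dist (fst zm i) (fst zm (Suc i))) < ennreal (max C 0 * dist x y + 1)"
      unfolding dist_b_def by (auto simp: INF_less_iff)
    have "(\<Sum>i<snd zm. dist (fst zm i) (fst zm (Suc i))) \<le> max C 0 * dist x y + 1"
      using zm(2) by (subst (asm) ennreal_less_iff) (auto intro: sum_nonneg)
    then show ?thesis using zm(1)
      by (intro exI[of _ "fst zm"] exI[of _ "snd zm"]) (auto simp: b_chains_def)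
  qed
  then show ?thesis by (intro exI[of _ "max C 0"]) auto
qed

context random_walk_space
begin

lemma harmonic_lower:
  assumes [measurable]: "u \<in> borel_measurable M" and harm: "harmonic_on u {x}"
  shows "ennreal (c1 / V x h) * (\<integral>\<^sup>+y. ennreal (u y) * indicator (cball x h) y \<partial>M) \<le> ennreal (u x)"
proof -
  have "ennreal (c1 / V x h) * (\<integral>\<^sup>+y. ennreal (u y) * indicator (cball x h) y \<partial>M)
     = (\<integral>\<^sup>+y. ennreal (c1 / V x h) * (ennreal (u y) * indicator (cball x h) y) \<partial>M)"
    by (simp add: nn_integral_cmult)
  also have "\<dots> \<le> (\<integral>\<^sup>+y. ennreal (p x y) * ennreal (u y) \<partial>M)"
  proof (rule nn_integral_mono_AE)
    show "AE y in M. ennreal (c1 / V x h) * (ennreal (u y) * indicator (cball x h) y) \<le> ennreal (p x y) * ennreal (u y)"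
      using p_lower[of x] by eventually_elim (auto split: split_indicator intro!: mult_right_mono ennreal_leI)
  qed
  finally show ?thesis using harm by (simp add: harmonic_on_def)
qed

lemma harmonic_upper:
  assumes [measurable]: "u \<in> borel_measurable M" and harm: "harmonic_on u {x}"
  shows "ennreal (u x) \<le> ennreal (C1 / V x h') * (\<integral>\<^sup>+y. ennreal (u y) * indicator (cball x h') y \<partial>M)"
proof -
  have "ennreal (u x) = (\<integral>\<^sup>+y. ennreal (p x y) * ennreal (u y) \<partial>M)" using harm by (simp add: harmonic_on_def)
  also have "\<dots> \<le> (\<integral>\<^sup>+y. ennreal (C1 / V x h') * (ennreal (u y) * indicator (cball x h') y) \<partial>M)"
  proof (rule nn_integral_mono_AE)
    show "AE y in M. ennreal (p x y) * ennreal (u y) \<le> ennreal (C1 / V x h') * (ennreal (u y) * indicator (cball x h') y)"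
      using p_upper[of x]
    proof eventually_elim
      fix y assume "p x y \<le> C1 / V x h' * indicator (cball x h') y"
      then show "ennreal (p x y) * ennreal (u y) \<le> ennreal (C1 / V x h') * (ennreal (u y) * indicator (cball x h') y)"
        using p_nonneg[of x y] by (cases "y \<in> cball x h'") (auto intro!: mult_right_mono ennreal_leI)
    qed
  qed
  also have "\<dots> = ennreal (C1 / V x h') * (\<integral>\<^sup>+y. ennreal (u y) * indicator (cball x h') y \<partial>M)"
    by (simp add: nn_integral_cmult)
  finally show ?thesis .
qed

text \<open>The constant may depend on \<open>\<rho>\<close>, but the radius of harmonicity is
  linear in \<open>\<rho>\<close> with a fixed \<open>\<kappa>\<close>. The comparison passes
  through the masses \<open>J\<close>: \<open>u y\<close> is bounded by an average of
  \<open>J\<close> near \<open>y\<close>, neighbouring masses are comparable, and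
  \<open>J y'\<close> is bounded by \<open>u y'\<close>.\<close>

lemma local_harnack:
  assumes geo: "quasi_b_geodesic b TYPE('a)" and b: "0 \<le> b" "b < h"
  shows "\<exists>\<kappa>\<ge>1. \<forall>\<rho>\<ge>0. \<exists>C>0. \<forall>u y y'. u \<in> borel_measurable M \<longrightarrow> (\<forall>x. 0 \<le> u x) \<longrightarrow>
     harmonic_on u (cball y (\<kappa> * (\<rho> + 1))) \<longrightarrow> dist y y' \<le> \<rho> \<longrightarrow> u y \<le> C * u y'"
proof -
  obtain Q where Q: "0 \<le> Q" and chain: "\<And>x y::'a. \<exists>z m. z 0 = x \<and> z m = y \<and> (\<forall>i<m. dist (z i) (z (Suc i)) \<le> b) \<and>
     (\<Sum>i<m. dist (z i) (z (Suc i))) \<le> Q * dist x y + 1"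
    using quasi_geodesic_chain[OF geo] by blast
  \<comment> \<open>One \<open>\<eta>\<close> is the slack of a hop and the other two are radii:
    points of the \<open>\<eta>\<close>-balls about centres at distance \<open>b + \<eta>\<close>
    are within \<open>h\<close> of each other, the range of the lower kernel bound.\<close>
  define \<eta> where "\<eta> = (h - b) / 3"
  have \<eta>: "0 < \<eta>" "b + 3 * \<eta> = h" using b unfolding \<eta>_def by argo+
  have \<eta>h: "\<eta> \<le> h" "\<eta> \<le> h'" "0 < h'" using \<eta> b h_le h_pos by auto
  define \<kappa> where "\<kappa> = 2 + Q + Q * (h' + \<eta>) + \<eta>"
  have \<kappa>1: "1 \<le> \<kappa>" unfolding \<kappa>_def using Q \<eta> \<eta>h by (simp add: add_nonneg_nonneg)
  have "\<exists>C>0. \<forall>u y y'. u \<in> borel_measurable M \<longrightarrow> (\<forall>x. 0 \<le> u x) \<longrightarrow>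
     harmonic_on u (cball y (\<kappa> * (\<rho> + 1))) \<longrightarrow> dist y y' \<le> \<rho> \<longrightarrow> u y \<le> C * u y'" if \<rho>: "0 \<le> \<rho>" for \<rho>
  proof -
    define \<rho>1 where "\<rho>1 = \<rho> + h' + \<eta>"
    define L where "L = Q * \<rho>1 + 1"
    \<comment> \<open>Chains start at \<open>y'\<close>, within \<open>\<rho>\<close> of
      \<open>y\<close>, and have length at most \<open>L\<close>; the last \<open>\<eta>\<close> is
      the radius of the balls carrying the masses.\<close>
    have HL: "\<rho> + L + \<eta> \<le> \<kappa> * (\<rho> + 1)"
    proof -
      have "\<kappa> * (\<rho> + 1) - (\<rho> + L + \<eta>) = \<rho> + Q + Q * (h' + \<eta>) * \<rho> + \<eta> * \<rho> + 1"
        by (simp add: \<kappa>_def L_def \<rho>1_def algebra_simps)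
      also have "\<dots> \<ge> 0" using Q \<rho> \<eta> \<eta>h by simp
      finally show ?thesis by simp
    qed
    define Kc where "Kc = (\<rho> + 2 * h' + 2 * \<eta>) / \<eta>"
    have Kc: "Kc * \<eta> = \<rho> + 2 * h' + 2 * \<eta>" "0 \<le> Kc" using \<eta> \<rho> \<eta>h by (auto simp: Kc_def)
    obtain C where C: "0 < C" "\<And>x y r R. \<eta> \<le> r \<Longrightarrow> dist x y + R \<le> Kc * r \<Longrightarrow> V x R \<le> C * V y r"
      using volume_comparison[OF \<eta>(1)] by metis
    obtain n :: nat where n: "L \<le> real n * \<eta>" using reals_Archimedean3[OF \<eta>(1), THEN spec, of L] by (auto intro: less_imp_le)
    define K where "K = max 1 (C / c1)"
    define B where "B = C1 * C * C * K^Suc n * C / c1"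
    have K: "1 \<le> K" by (simp add: K_def)
    have B: "0 < B" unfolding B_def using C C1_pos c1_pos K by (intro divide_pos_pos mult_pos_pos zero_less_power) auto
    have "u y \<le> B * u y'" if [measurable]: "u \<in> borel_measurable M" and u: "\<And>x. 0 \<le> u x"
      and harm: "harmonic_on u (cball y (\<kappa> * (\<rho> + 1)))" and yy': "dist y y' \<le> \<rho>" for u y y'
    proof -
      define J where "J z = (\<integral>\<^sup>+x. ennreal (u x) * indicator (cball z \<eta>) x \<partial>M)" for z
      have harm1: "harmonic_on u {x}" if "dist y x \<le> \<rho> + L + \<eta>" for x
        by (rule harmonic_on_subset[OF harm]) (use that HL in auto)
      have hop: "J z' \<le> ennreal K * J z" if z: "dist y z \<le> \<rho> + L" and zz': "dist z z' \<le> b + \<eta>" for z z'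
      proof -
        have Vp: "0 < V z \<eta>" by (rule V_pos[OF \<eta>(1)])
        have "ennreal (c1 / C) * J z' = (\<integral>\<^sup>+x. (ennreal (c1 / (C * V z \<eta>)) * J z') * indicator (cball z \<eta>) x \<partial>M)"
          using Vp C c1_pos by (simp add: nn_integral_cmult emeasure_cball mult.commute[of _ "J z'"] mult.assoc ennreal_mult[symmetric])
        also have "\<dots> \<le> J z"
          unfolding J_def[of z]
        proof (intro nn_integral_mono)
          fix x
          show "ennreal (c1 / (C * V z \<eta>)) * J z' * indicator (cball z \<eta>) x \<le> ennreal (u x) * indicator (cball z \<eta>) x"
          proof (cases "x \<in> cball z \<eta>")
            case True
            then have zx: "dist z x \<le> \<eta>" by simp
            have "V x h \<le> C * V z \<eta>"
              by (rule C(2)) (use zx \<eta>h h_le \<rho> \<eta> Kc in \<open>auto simp: dist_commute\<close>)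
            then have "c1 / (C * V z \<eta>) \<le> c1 / V x h"
              using c1_pos V_pos[OF h_pos, of x] by (intro divide_left_mono) auto
            moreover have "J z' \<le> (\<integral>\<^sup>+y. ennreal (u y) * indicator (cball x h) y \<partial>M)"
              unfolding J_def
            proof (intro nn_integral_mono mult_left_mono)
              fix t
              have "dist x t \<le> h" if "dist z' t \<le> \<eta>"
                using that zx zz' \<eta> dist_triangle[of x t z] dist_triangle[of z t z'] by (simp add: dist_commute)
              then show "indicator (cball z' \<eta>) t \<le> (indicator (cball x h) t :: ennreal)"
                by (auto split: split_indicator)
            qed simp
            ultimately have "ennreal (c1 / (C * V z \<eta>)) * J z' \<le>
               ennreal (c1 / V x h) * (\<integral>\<^sup>+y. ennreal (u y) * indicator (cball x h) y \<partial>M)"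
              by (intro mult_mono ennreal_leI) auto
            also have "\<dots> \<le> ennreal (u x)"
              by (rule harmonic_lower[OF _ harm1]) (use z zx dist_triangle[of y x z] in auto)
            finally show ?thesis using True by simp
          qed simp
        qed
        finally have le: "ennreal (c1 / C) * J z' \<le> J z" .
        have "J z' = ennreal (C / c1) * (ennreal (c1 / C) * J z')"
          using C c1_pos by (simp add: mult.assoc[symmetric] ennreal_mult[symmetric])
        also have "\<dots> \<le> ennreal K * J z"
          by (intro mult_mono le ennreal_leI) (auto simp: K_def)
        finally show ?thesis .
      qed
      have JJ: "J z \<le> ennreal (K^Suc n) * J y'" if z: "dist y z \<le> h' + \<eta>" for z
      proof -
        obtain c m where c: "c 0 = y'" "c m = z" "\<And>i. i<m \<Longrightarrow> dist (c i) (c (Suc i)) \<le> b"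
           "(\<Sum>i<m. dist (c i) (c (Suc i))) \<le> Q * dist y' z + 1" using chain[of y' z] by blast
        have "dist y' z \<le> \<rho>1" using z yy' dist_triangle[of y' z y] by (simp add: \<rho>1_def dist_commute)
        then have "Q * dist y' z + 1 \<le> L" using Q by (simp add: L_def mult_left_mono)
        then have len: "(\<Sum>i<m. dist (c i) (c (Suc i))) \<le> L" using c(4) by simp
        have "J (c m) \<le> ennreal K ^ Suc n * J (c 0)"
        proof (rule chain_comparison[where z=c and b=b, OF \<eta>(1) b(1) _ c(3)])
          show "1 \<le> ennreal K" using K by simp
          show "(\<Sum>i<m. dist (c i) (c (Suc i))) \<le> real n * \<eta>" using len n by simp
          fix i t assume i: "i \<le> m" and t: "dist (c i) t \<le> b + \<eta>"
          have "dist y' (c i) \<le> (\<Sum>j<i. dist (c j) (c (Suc j)))" using dist_le_chain_length[of c i] c(1) by simp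
          also have "\<dots> \<le> (\<Sum>j<m. dist (c j) (c (Suc j)))" using i by (intro sum_mono2) auto
          finally have "dist y (c i) \<le> \<rho> + L" using len yy' dist_triangle[of y "c i" y'] by simp
          then show "J t \<le> ennreal K * J (c i)" using t by (rule hop)
        qed
        then show ?thesis using c K by (simp add: ennreal_power ennreal_mult)
      qed
      have Jy': "J y' \<le> ennreal (C * V y h' / c1) * ennreal (u y')"
      proof -
        have Vp: "0 < V y' h" by (rule V_pos[OF h_pos])
        have VV: "V y' h \<le> C * V y h'"
        proof (rule C(2))
          have "\<rho> + h' \<le> Kc * \<eta>" using Kc \<eta> \<eta>h by simp
          also have "\<dots> \<le> Kc * h'" using Kc \<eta>h by (intro mult_left_mono) auto
          finally show "dist y' y + h \<le> Kc * h'" using yy' h_le by (simp add: dist_commute)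
        qed (rule \<eta>h)
        have "ennreal (c1 / V y' h) * J y' \<le> ennreal (c1 / V y' h) * (\<integral>\<^sup>+x. ennreal (u x) * indicator (cball y' h) x \<partial>M)"
          unfolding J_def using \<eta>h by (intro mult_left_mono nn_integral_mono) (auto split: split_indicator)
        also have "\<dots> \<le> ennreal (u y')"
        proof (rule harmonic_lower[OF _ harm1])
          have "0 \<le> L" using Q \<rho> \<eta>h \<eta> by (simp add: L_def \<rho>1_def)
          then show "dist y y' \<le> \<rho> + L + \<eta>" using yy' \<eta> by simp
        qed simp
        finally have le: "ennreal (c1 / V y' h) * J y' \<le> ennreal (u y')" .
        have "J y' = ennreal (V y' h / c1) * (ennreal (c1 / V y' h) * J y')"
          using Vp c1_pos by (simp add: mult.assoc[symmetric] ennreal_mult[symmetric])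
        also have "\<dots> \<le> ennreal (C * V y h' / c1) * ennreal (u y')"
          using c1_pos VV by (intro mult_mono le ennreal_leI divide_right_mono) auto
        finally show ?thesis .
      qed
      define g where "g x = ennreal (u x) * indicator (cball y h') x" for x
      have [measurable]: "g \<in> borel_measurable M" unfolding g_def by measurable
      \<comment> \<open>Averaging over centres \<open>z\<close> with weight
        \<open>1 / V z \<eta>\<close> replaces a cover of \<open>cball y h'\<close> by balls of
        radius \<open>\<eta>\<close>.\<close>
      have "ennreal (1/C) * (\<integral>\<^sup>+x. g x \<partial>M) = (\<integral>\<^sup>+x. g x * ennreal (1/C) \<partial>M)"
        by (subst nn_integral_multc) (simp_all add: mult.commute)
      also have "\<dots> \<le> (\<integral>\<^sup>+x. g x * (\<integral>\<^sup>+z. ennreal (1 / V z \<eta>) * indicator (cball x \<eta>) z \<partial>M) \<partial>M)"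
      proof (intro nn_integral_mono mult_left_mono inverse_volume_integral_ge[OF \<eta>(1) C(1)])
        show "V z \<eta> \<le> C * V x \<eta>" if "dist x z \<le> \<eta>" for x z
          by (rule C(2)) (use that Kc \<rho> \<eta>h in \<open>auto simp: dist_commute\<close>)
      qed simp
      also have "\<dots> = (\<integral>\<^sup>+z. ennreal (1 / V z \<eta>) * (\<integral>\<^sup>+x. g x * indicator (cball z \<eta>) x \<partial>M) \<partial>M)"
        by (rule cball_Fubini[symmetric]) simp_all
      also have "\<dots> \<le> (\<integral>\<^sup>+z. (ennreal (C / V y (h' + \<eta>)) * (ennreal (K^Suc n) * J y')) * indicator (cball y (h' + \<eta>)) z \<partial>M)"
      proof (intro nn_integral_mono)
        fix z
        show "ennreal (1 / V z \<eta>) * (\<integral>\<^sup>+x. g x * indicator (cball z \<eta>) x \<partial>M)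
           \<le> (ennreal (C / V y (h' + \<eta>)) * (ennreal (K^Suc n) * J y')) * indicator (cball y (h' + \<eta>)) z"
        proof (cases "dist y z \<le> h' + \<eta>")
          case True
          have "V y (h' + \<eta>) \<le> C * V z \<eta>"
            by (rule C(2)) (use True Kc \<rho> in auto)
          then have "1 / V z \<eta> \<le> C / V y (h' + \<eta>)"
            using V_pos[OF \<eta>(1), of z] V_pos[of "h' + \<eta>" y] \<eta> \<eta>h by (simp add: field_simps)
          moreover have "(\<integral>\<^sup>+x. g x * indicator (cball z \<eta>) x \<partial>M) \<le> J z"
            unfolding J_def g_def by (intro nn_integral_mono) (auto split: split_indicator)
          ultimately show ?thesis using True JJ[OF True]
            by (auto intro!: mult_mono ennreal_leI elim: order_trans)
        next
          case False
          have "g x * indicator (cball z \<eta>) x = 0" for x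
            using False dist_triangle[of y z x] by (auto simp: g_def indicator_def dist_commute)
          then have "(\<integral>\<^sup>+x. g x * indicator (cball z \<eta>) x \<partial>M) = (\<integral>\<^sup>+x. 0 \<partial>M)" by (intro nn_integral_cong)
          then show ?thesis by simp
        qed
      qed
      also have "\<dots> = ennreal C * (ennreal (K^Suc n) * J y')"
        using V_pos[of "h' + \<eta>" y] \<eta> \<eta>h C
        by (simp add: nn_integral_cmult emeasure_cball mult.commute[of _ "ennreal (V y (h' + \<eta>))"] mult.assoc[symmetric] ennreal_mult[symmetric])
      also have "\<dots> \<le> ennreal C * (ennreal (K^Suc n) * (ennreal (C * V y h' / c1) * ennreal (u y')))"
        by (intro mult_left_mono Jy') simp_all
      finally have le: "ennreal (1/C) * (\<integral>\<^sup>+x. g x \<partial>M)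
          \<le> ennreal C * (ennreal (K^Suc n) * (ennreal (C * V y h' / c1) * ennreal (u y')))" .
      have Vp: "0 < V y h'" by (rule V_pos[OF \<eta>h(3)])
      have "ennreal (u y) \<le> ennreal (C1 / V y h') * (\<integral>\<^sup>+x. g x \<partial>M)"
        unfolding g_def
      proof (rule harmonic_upper[OF _ harm1])
        have "0 \<le> L" using Q \<rho> \<eta>h \<eta> by (simp add: L_def \<rho>1_def)
        then show "dist y y \<le> \<rho> + L + \<eta>" using \<rho> \<eta> by simp
      qed simp
      also have "(\<integral>\<^sup>+x. g x \<partial>M) = ennreal C * (ennreal (1/C) * (\<integral>\<^sup>+x. g x \<partial>M))"
        using C by (simp add: mult.assoc[symmetric] ennreal_mult[symmetric])
      also have "ennreal (C1 / V y h') * (ennreal C * (ennreal (1/C) * (\<integral>\<^sup>+x. g x \<partial>M)))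
        \<le> ennreal (C1 / V y h') * (ennreal C * (ennreal C * (ennreal (K^Suc n) * (ennreal (C * V y h' / c1) * ennreal (u y')))))"
        by (intro mult_left_mono le) simp_all
      also have "\<dots> = ennreal (C1 / V y h' * (C * (C * (K^Suc n * (C * V y h' / c1 * u y')))))"
        using C C1_pos Vp c1_pos K u by (simp add: ennreal_mult[symmetric] del: power_Suc)
      also have "C1 / V y h' * (C * (C * (K^Suc n * (C * V y h' / c1 * u y')))) = B * u y'"
        using Vp by (simp add: B_def)
      finally show ?thesis using B u by simp
    qed
    then show ?thesis using B by blast
  qed
  then show ?thesis using \<kappa>1 by blast
qed

subsection \<open>The elliptic Harnack inequality\<close>

text \<open>\<open>growth_lemma\<close> with the full ball as the good set is iterated over doubled
  radii. The number of doublings is logarithmic in \<open>T / R\<close>, so a fixed loss at each of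
  them becomes a power.\<close>

lemma spread:
  "\<exists>A\<ge>1. \<exists>R0>0. \<exists>\<gamma>>0. \<forall>z R T u a. R0 \<le> R \<longrightarrow> R \<le> T \<longrightarrow> u \<in> borel_measurable M \<longrightarrow> (\<forall>x. 0 \<le> u x) \<longrightarrow> 0 < a \<longrightarrow>
     harmonic_on u (cball z (A * T)) \<longrightarrow> (\<forall>y\<in>cball z R. a \<le> u y) \<longrightarrow>
     (\<forall>y\<in>cball z T. a * (R / (2 * T)) powr \<gamma> \<le> u y)"
proof -
  obtain A R0 where A: "1 \<le> A" and R0: "0 < R0" and all: "\<And>\<epsilon>. 0 < \<epsilon> \<Longrightarrow> \<exists>\<delta>>0. \<forall>z R u a. R0 \<le> R \<longrightarrow> u \<in> borel_measurable M \<longrightarrow> (\<forall>x. 0 \<le> u x) \<longrightarrow> 0 < a \<longrightarrow>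
     harmonic_on u (cball z (A * R)) \<longrightarrow> \<epsilon> * V z R \<le> measure M {x\<in>cball z R. a \<le> u x} \<longrightarrow>
     (\<forall>y\<in>cball z (2 * R). \<delta> * a \<le> u y)"
    using growth_lemma by blast
  obtain \<delta>1 where \<delta>1: "0 < \<delta>1"
    and GL: "\<And>z R u a. R0 \<le> R \<Longrightarrow> u \<in> borel_measurable M \<Longrightarrow> (\<forall>x. 0 \<le> u x) \<Longrightarrow> 0 < a \<Longrightarrow>
     harmonic_on u (cball z (A * R)) \<Longrightarrow> 1 * V z R \<le> measure M {x\<in>cball z R. a \<le> u x} \<Longrightarrow>
     (\<forall>y\<in>cball z (2 * R). \<delta>1 * a \<le> u y)"
    using all[OF zero_less_one] by blast
  \<comment> \<open>Each doubling keeps at least the factor \<open>2 powr (- \<gamma>)\<close>; the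
    maximum with 1 secures a positive exponent.\<close>
  define \<gamma> where "\<gamma> = max 1 (- log 2 \<delta>1)"
  have \<gamma>: "0 < \<gamma>" by (simp add: \<gamma>_def)
  have \<delta>\<gamma>: "2 powr (- \<gamma>) \<le> \<delta>1"
  proof -
    have "2 powr (- \<gamma>) \<le> 2 powr (log 2 \<delta>1)" by (intro powr_mono) (auto simp: \<gamma>_def)
    then show ?thesis using \<delta>1 by simp
  qed
  have iter: "\<forall>y\<in>cball z (2^j * R). (2 powr (- \<gamma>))^j * a \<le> u y"
    if R: "R0 \<le> R" and u: "u \<in> borel_measurable M" "\<forall>x. 0 \<le> u x" and a: "0 < a"
      and harm: "harmonic_on u (cball z (A * 2^j * R))" and ge: "\<forall>y\<in>cball z R. a \<le> u y" for z R u a and j :: nat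
    using harm
  proof (induction j)
    case 0
    then show ?case using ge by simp
  next
    case (Suc j)
    have Rp: "0 < R" using R R0 by simp
    have sub: "A * 2^j * R \<le> A * 2^Suc j * R" using A Rp by simp
    have harm': "harmonic_on u (cball z (A * 2^j * R))"
      by (rule harmonic_on_subset[OF Suc.prems subset_cball[OF sub]])
    note IH = Suc.IH[OF harm']
    have a': "0 < (2 powr (- \<gamma>))^j * a" using a by simp
    have "{x\<in>cball z (2^j * R). (2 powr (- \<gamma>))^j * a \<le> u x} = cball z (2^j * R)" using IH by auto
    then have 1: "1 * V z (2^j * R) \<le> measure M {x\<in>cball z (2^j * R). (2 powr (- \<gamma>))^j * a \<le> u x}" by simp
    have "1 * R \<le> 2^j * R" using Rp by (intro mult_right_mono) auto
    then have R': "R0 \<le> 2^j * R" using R by simp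
    have h2: "harmonic_on u (cball z (A * (2^j * R)))" using harm' by (simp add: mult.assoc)
    from GL[OF R' u a' h2 1] have *: "\<And>y. y \<in> cball z (2 * (2^j * R)) \<Longrightarrow> \<delta>1 * ((2 powr (- \<gamma>))^j * a) \<le> u y" by blast
    show ?case
    proof
      fix y assume "y \<in> cball z (2^Suc j * R)"
      then have "\<delta>1 * ((2 powr (- \<gamma>))^j * a) \<le> u y" by (intro *) (simp add: mult.assoc)
      moreover have "(2 powr (- \<gamma>))^Suc j * a \<le> \<delta>1 * ((2 powr (- \<gamma>))^j * a)"
        using \<delta>\<gamma> a by (simp add: mult.assoc mult_right_mono)
      ultimately show "(2 powr (- \<gamma>))^Suc j * a \<le> u y" by (rule order_trans[rotated])
    qed
  qed
  have main: "a * (R / (2 * T)) powr \<gamma> \<le> u y"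
    if R: "R0 \<le> R" and T: "R \<le> T" and u: "u \<in> borel_measurable M" "\<forall>x. 0 \<le> u x" and a: "0 < a"
      and harm: "harmonic_on u (cball z (2 * A * T))" and ge: "\<forall>y\<in>cball z R. a \<le> u y" and y: "y \<in> cball z T" for z R T u a y
  proof -
    have Rp: "0 < R" "0 < T" using R R0 T by auto
    have ex: "\<exists>j::nat. T \<le> 2^j * R"
    proof -
      obtain j where "T / R < 2^j" using real_arch_pow[of 2 "T/R"] by auto
      then show ?thesis using Rp by (intro exI[of _ j]) (simp add: field_simps)
    qed
    define j where "j = (LEAST j::nat. T \<le> 2^j * R)"
    have j1: "T \<le> 2^j * R" unfolding j_def by (rule LeastI_ex[OF ex])
    \<comment> \<open>The least sufficient \<open>j\<close> overshoots \<open>T\<close> by at most a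
      factor 2, hence the 2 in \<open>R / (2 * T)\<close> and in the radius of harmonicity
      \<open>2 * A * T\<close>.\<close>
    have j2: "2^j * R \<le> 2 * T"
    proof (cases j)
      case (Suc i)
      have "\<not> (T \<le> 2^i * R)" by (rule not_less_Least) (use Suc in \<open>simp add: j_def\<close>)
      then show ?thesis using Suc by simp
    qed (use T Rp in simp)
    have h2: "harmonic_on u (cball z (A * 2^j * R))"
    proof (rule harmonic_on_subset[OF harm subset_cball])
      have "A * (2^j * R) \<le> A * (2 * T)" using A j2 by (intro mult_left_mono) auto
      then show "A * 2^j * R \<le> 2 * A * T" by (simp add: ac_simps)
    qed
    have "(2 powr (- \<gamma>))^j * a \<le> u y"
      using iter[OF R u a h2 ge] y j1 by simp
    moreover have "(R / (2 * T)) powr \<gamma> \<le> (2 powr (- \<gamma>))^j"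
    proof -
      have "(R / (2 * T)) powr \<gamma> \<le> (1 / 2^j) powr \<gamma>"
        using Rp \<gamma> j2 by (intro powr_mono2) (auto simp: field_simps)
      also have "\<dots> = (2 ^ j) powr (- \<gamma>)" by (simp add: powr_minus powr_divide inverse_eq_divide)
      also have "\<dots> = (2 powr (- \<gamma>)) powr real j" by (simp add: powr_realpow[symmetric] powr_powr mult.commute)
      also have "\<dots> = (2 powr (- \<gamma>))^j" by (simp add: powr_realpow)
      finally show ?thesis .
    qed
    then have "a * (R / (2 * T)) powr \<gamma> \<le> a * (2 powr (- \<gamma>))^j" using a by (intro mult_left_mono) auto
    ultimately show ?thesis by (simp only: mult.commute[of _ a])
  qed
  show ?thesis
  proof (rule exI[of _ "2 * A"], intro conjI)
    show "1 \<le> 2 * A" using A by simp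
    show "\<exists>R0>0. \<exists>\<gamma>>0. \<forall>z R T u a. R0 \<le> R \<longrightarrow> R \<le> T \<longrightarrow> u \<in> borel_measurable M \<longrightarrow> (\<forall>x. 0 \<le> u x) \<longrightarrow> 0 < a \<longrightarrow>
     harmonic_on u (cball z (2 * A * T)) \<longrightarrow> (\<forall>y\<in>cball z R. a \<le> u y) \<longrightarrow>
     (\<forall>y\<in>cball z T. a * (R / (2 * T)) powr \<gamma> \<le> u y)"
      using R0 \<gamma> main by blast
  qed
qed

text \<open>If \<open>w\<close> were comparable to \<open>w y\<close> only on a tiny set, then with
  \<open>w \<le> N * w y\<close> elsewhere under control its quadratic mean would be so small that
  the mean value inequality gives \<open>w y \<le> w y / 2\<close>.\<close>

lemma mean_value_fraction:
  "\<exists>R0>0. \<forall>N>0. \<exists>\<epsilon>>0. \<exists>\<sigma>>0. \<forall>R w y. R0 \<le> R \<longrightarrow> w \<in> borel_measurable M \<longrightarrow> (\<forall>x. 0 \<le> w x) \<longrightarrow>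
     (\<exists>B. \<forall>x. w x \<le> B) \<longrightarrow> subharmonic_on w (cball y R) \<longrightarrow> 0 < w y \<longrightarrow> (\<forall>x\<in>cball y R. w x \<le> N * w y) \<longrightarrow>
     \<epsilon> * V y R \<le> measure M {x\<in>cball y R. \<sigma> * w y \<le> w x}"
proof -
  obtain C R0 where C: "0 < C" "0 < R0" and MV: "\<And>R z t w. R0 \<le> R \<Longrightarrow> 0 < t \<Longrightarrow> w \<in> borel_measurable M \<Longrightarrow> (\<forall>x. 0 \<le> w x) \<Longrightarrow>
     (\<exists>B. \<forall>x. w x \<le> B) \<Longrightarrow> subharmonic_on w (cball z R) \<Longrightarrow>
     (\<integral>\<^sup>+x. ennreal ((w x)^2) * indicator (cball z R) x \<partial>M) \<le> ennreal (t^2 * V z R) \<Longrightarrow>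
     (\<forall>y\<in>cball z (R/2). w y \<le> C * t)"
    using mean_value by blast
  have "\<exists>\<epsilon>>0. \<exists>\<sigma>>0. \<forall>R w y. R0 \<le> R \<longrightarrow> w \<in> borel_measurable M \<longrightarrow> (\<forall>x. 0 \<le> w x) \<longrightarrow>
     (\<exists>B. \<forall>x. w x \<le> B) \<longrightarrow> subharmonic_on w (cball y R) \<longrightarrow> 0 < w y \<longrightarrow> (\<forall>x\<in>cball y R. w x \<le> N * w y) \<longrightarrow>
     \<epsilon> * V y R \<le> measure M {x\<in>cball y R. \<sigma> * w y \<le> w x}" if N: "0 < N" for N
  proof -
    \<comment> \<open>Each of the two parts of the integral is then at most
      \<open>(w y)^2 / (9 * C^2)\<close> times the volume, and \<open>2/9 < 1/4\<close> leaves room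
      for \<open>t = w y / (2 * C)\<close>.\<close>
    define \<sigma> where "\<sigma> = 1 / (3 * C)"
    define \<epsilon> where "\<epsilon> = 1 / (9 * C^2 * N^2)"
    have pos: "0 < \<sigma>" "0 < \<epsilon>" using C N by (auto simp: \<sigma>_def \<epsilon>_def)
    have "\<epsilon> * V y R \<le> measure M {x\<in>cball y R. \<sigma> * w y \<le> w x}"
      if R: "R0 \<le> R" and [measurable]: "w \<in> borel_measurable M" and w: "\<forall>x. 0 \<le> w x" and bd: "\<exists>B. \<forall>x. w x \<le> B"
        and sub: "subharmonic_on w (cball y R)" and wy: "0 < w y" and le: "\<forall>x\<in>cball y R. w x \<le> N * w y" for R w y
    proof (rule ccontr)
      assume neg: "\<not> \<epsilon> * V y R \<le> measure M {x\<in>cball y R. \<sigma> * w y \<le> w x}"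
      define S where "S = {x\<in>cball y R. \<sigma> * w y \<le> w x}"
      define t where "t = w y / (2 * C)"
      have t: "0 < t" using wy C by (simp add: t_def)
      have "cball y R \<inter> {x\<in>space M. \<sigma> * w y \<le> w x} \<in> sets M" by measurable
      then have S [measurable]: "S \<in> sets M" by (simp add: S_def Int_def)
      have Sfin: "emeasure M S = ennreal (measure M S)"
        by (rule emeasure_subset_cball[of S y R]) (auto simp: S_def)
      have "(\<integral>\<^sup>+x. ennreal ((w x)^2) * indicator (cball y R) x \<partial>M)
          \<le> (\<integral>\<^sup>+x. ennreal ((N * w y)^2) * indicator S x + ennreal ((\<sigma> * w y)^2) * indicator (cball y R) x \<partial>M)"
      proof (intro nn_integral_mono)
        fix x
        show "ennreal ((w x)^2) * indicator (cball y R) x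
          \<le> ennreal ((N * w y)^2) * indicator S x + ennreal ((\<sigma> * w y)^2) * indicator (cball y R) x"
        proof (cases "x \<in> S")
          case True
          then have x: "x \<in> cball y R" by (simp add: S_def)
          have "ennreal ((w x)^2) \<le> ennreal ((N * w y)^2)"
            using le x w by (intro ennreal_leI power_mono) auto
          then show ?thesis using True x by (simp add: add_increasing2)
        next
          case False
          then have "x \<in> cball y R \<Longrightarrow> w x \<le> \<sigma> * w y" by (auto simp: S_def)
          then show ?thesis using False w by (auto split: split_indicator intro!: ennreal_leI power_mono)
        qed
      qed
      also have "\<dots> = ennreal ((N * w y)^2 * measure M S + (\<sigma> * w y)^2 * V y R)"
        by (simp add: nn_integral_add nn_integral_cmult_indicator[OF S] nn_integral_cmult Sfin emeasure_cball ennreal_mult)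
      also have "\<dots> \<le> ennreal (t^2 * V y R)"
      proof (intro ennreal_leI)
        have "(N * w y)^2 * measure M S \<le> (N * w y)^2 * (\<epsilon> * V y R)"
          using neg by (intro mult_left_mono) (auto simp: S_def)
        also have "\<dots> = (w y)^2 / (9 * C^2) * V y R"
          using N C by (simp add: \<epsilon>_def power_mult_distrib)
        finally have "(N * w y)^2 * measure M S \<le> (w y)^2 / (9 * C^2) * V y R" .
        moreover have "(\<sigma> * w y)^2 = (w y)^2 / (9 * C^2)"
          by (simp add: \<sigma>_def power_mult_distrib power_divide)
        ultimately have "(N * w y)^2 * measure M S + (\<sigma> * w y)^2 * V y R
            \<le> (w y)^2 / (9 * C^2) * V y R + (w y)^2 / (9 * C^2) * V y R"
          by (simp only: add_le_cancel_right)
        also have "\<dots> = 2 * ((w y)^2 / (9 * C^2) * V y R)" by simp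
        also have "\<dots> \<le> (w y)^2 / (4 * C^2) * V y R"
        proof -
          define X where "X = (w y)^2 / C^2 * V y R"
          have "2 * ((w y)^2 / (9 * C^2) * V y R) = 2 / 9 * X" "(w y)^2 / (4 * C^2) * V y R = X / 4"
            by (simp_all add: X_def)
          moreover have "0 \<le> X" by (simp add: X_def)
          ultimately show ?thesis by linarith
        qed
        finally show "(N * w y)^2 * measure M S + (\<sigma> * w y)^2 * V y R \<le> t^2 * V y R"
          by (simp add: t_def power_divide power_mult_distrib)
      qed
      finally have int: "(\<integral>\<^sup>+x. ennreal ((w x)^2) * indicator (cball y R) x \<partial>M) \<le> ennreal (t^2 * V y R)" .
      from MV[OF R t _ w bd sub int] have "\<forall>x\<in>cball y (R/2). w x \<le> C * t" by simp
      then have "w y \<le> C * t" using R C by simp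
      also have "C * t = w y / 2" using C by (simp add: t_def)
      finally show False using wy by simp
    qed
    then show ?thesis using pos by blast
  qed
  then show ?thesis using C by blast
qed

lemma elliptic_harnack:
  assumes geo: "quasi_b_geodesic b TYPE('a)" and b: "0 \<le> b" "b < h"
  shows "\<exists>\<Lambda>\<ge>1. \<exists>R0>0. \<exists>C>0. \<forall>x \<rho> u. R0 \<le> \<rho> \<longrightarrow> u \<in> borel_measurable M \<longrightarrow> (\<forall>x. 0 \<le> u x) \<longrightarrow>
     harmonic_on u (cball x (\<Lambda> * \<rho>)) \<longrightarrow> (\<forall>y\<in>cball x (\<rho>/2). \<forall>z\<in>cball x (\<rho>/2). u y \<le> C * u z)"
proof -
  obtain \<kappa> where \<kappa>: "1 \<le> \<kappa>" and LH: "\<And>\<rho>. 0 \<le> \<rho> \<Longrightarrow> \<exists>C>0. \<forall>u y y'. u \<in> borel_measurable M \<longrightarrow> (\<forall>x. 0 \<le> u x) \<longrightarrow>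
     harmonic_on u (cball y (\<kappa> * (\<rho> + 1))) \<longrightarrow> dist y y' \<le> \<rho> \<longrightarrow> u y \<le> C * u y'"
    using local_harnack[OF geo b] by blast
  obtain A RS \<gamma> where A: "1 \<le> A" "0 < RS" "0 < \<gamma>" and spread: "\<And>z R T u a. RS \<le> R \<Longrightarrow> R \<le> T \<Longrightarrow> u \<in> borel_measurable M \<Longrightarrow> (\<forall>x. 0 \<le> u x) \<Longrightarrow> 0 < a \<Longrightarrow>
     harmonic_on u (cball z (A * T)) \<Longrightarrow> (\<forall>y\<in>cball z R. a \<le> u y) \<Longrightarrow>
     (\<forall>y\<in>cball z T. a * (R / (2 * T)) powr \<gamma> \<le> u y)"
    using spread by blast
  \<comment> \<open>The 2 comes from choosing \<open>y\<close> within half of the supremum, and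
    \<open>2 powr \<gamma>\<close> from the weight, which falls at most to
    \<open>(d y / 2) powr \<gamma>\<close> near \<open>y\<close>.\<close>
  define N where "N = 2 * 2 powr \<gamma>"
  have N: "0 < N" by (simp add: N_def)
  obtain RM where RM0: "0 < RM" and allM: "\<And>N. 0 < N \<Longrightarrow> \<exists>\<epsilon>>0. \<exists>\<sigma>>0. \<forall>R w y. RM \<le> R \<longrightarrow> w \<in> borel_measurable M \<longrightarrow> (\<forall>x. 0 \<le> w x) \<longrightarrow>
     (\<exists>B. \<forall>x. w x \<le> B) \<longrightarrow> subharmonic_on w (cball y R) \<longrightarrow> 0 < w y \<longrightarrow> (\<forall>x\<in>cball y R. w x \<le> N * w y) \<longrightarrow>
     \<epsilon> * V y R \<le> measure M {x\<in>cball y R. \<sigma> * w y \<le> w x}"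
    using mean_value_fraction by blast
  obtain \<epsilon> \<sigma> where RM1: "0 < \<epsilon>" "0 < \<sigma>" and frac: "\<And>R w y. RM \<le> R \<Longrightarrow> w \<in> borel_measurable M \<Longrightarrow> (\<forall>x. 0 \<le> w x) \<Longrightarrow>
     (\<exists>B. \<forall>x. w x \<le> B) \<Longrightarrow> subharmonic_on w (cball y R) \<Longrightarrow> 0 < w y \<Longrightarrow> (\<forall>x\<in>cball y R. w x \<le> N * w y) \<Longrightarrow>
     \<epsilon> * V y R \<le> measure M {x\<in>cball y R. \<sigma> * w y \<le> w x}"
    using allM[OF N] by blast
  note RM = RM0 RM1
  obtain AG RG where AG0: "1 \<le> AG" "0 < RG" and all: "\<And>\<epsilon>. 0 < \<epsilon> \<Longrightarrow> \<exists>\<delta>>0. \<forall>z R u a. RG \<le> R \<longrightarrow> u \<in> borel_measurable M \<longrightarrow> (\<forall>x. 0 \<le> u x) \<longrightarrow> 0 < a \<longrightarrow>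
     harmonic_on u (cball z (AG * R)) \<longrightarrow> \<epsilon> * V z R \<le> measure M {x\<in>cball z R. a \<le> u x} \<longrightarrow>
     (\<forall>y\<in>cball z (2 * R). \<delta> * a \<le> u y)"
    using growth_lemma by blast
  obtain \<delta> where \<delta>: "0 < \<delta>" and GL: "\<And>z R u a. RG \<le> R \<Longrightarrow> u \<in> borel_measurable M \<Longrightarrow> (\<forall>x. 0 \<le> u x) \<Longrightarrow> 0 < a \<Longrightarrow>
     harmonic_on u (cball z (AG * R)) \<Longrightarrow> \<epsilon> * V z R \<le> measure M {x\<in>cball z R. a \<le> u x} \<Longrightarrow>
     (\<forall>y\<in>cball z (2 * R). \<delta> * a \<le> u y)"
    using all[OF RM(2)] by blast
  note AG = AG0 \<delta>
  have h': "0 < h'" using h_pos h_le by simp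
  define R0 where "R0 = RS + RM + RG + h' + 1"
  have R0: "RS \<le> R0" "RM \<le> R0" "RG \<le> R0" "h' \<le> R0" "1 \<le> R0" using A RM AG h' by (auto simp: R0_def)
  obtain CL where CL: "0 < CL" "\<And>u y y'. u \<in> borel_measurable M \<Longrightarrow> (\<forall>x. 0 \<le> u x) \<Longrightarrow>
     harmonic_on u (cball y (\<kappa> * (R0 + 1))) \<Longrightarrow> dist y y' \<le> R0 \<Longrightarrow> u y \<le> CL * u y'"
    using LH[of R0] R0 by auto
  \<comment> \<open>Room around any centre in \<open>cball x \<rho>\<close>: \<open>2 * A\<close>
    for spreading to radius \<open>2 * \<rho>\<close>, \<open>AG\<close> for the growth lemma,
    \<open>2 * \<kappa>\<close> for local comparison, and 1 for the shift of the centre.\<close>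
  define \<Lambda> where "\<Lambda> = 2 * A + AG + 2 * \<kappa> + 1"
  have \<Lambda>1: "1 \<le> \<Lambda>" unfolding \<Lambda>_def using A AG \<kappa> by linarith
  define C where "C = CL + 1 / (\<delta> * \<sigma>)"
  have C: "0 < C" "CL \<le> C" "1 / (\<delta> * \<sigma>) \<le> C" unfolding C_def using CL AG RM by (auto intro: add_pos_pos)
  have bound: "u y \<le> (2 * C * 32 powr \<gamma>) * u z0"
    if \<rho>: "R0 \<le> \<rho>" and [measurable]: "u \<in> borel_measurable M" and u: "\<forall>x. 0 \<le> u x"
      and harm: "harmonic_on u (cball x (\<Lambda> * \<rho>))" and y0: "y \<in> cball x (\<rho>/2)" and z0: "z0 \<in> cball x (\<rho>/2)" for x \<rho> u y z0
  proof -
    have \<rho>0: "0 < \<rho>" "1 \<le> \<rho>" using \<rho> R0 by auto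
    have u0: "0 \<le> u x" for x using u by simp
    have harm_ball: "harmonic_on u (cball y s)" if "dist x y \<le> \<rho>" "s \<le> (2 * A + AG + 2 * \<kappa>) * \<rho>" for y s
    proof (rule harmonic_on_subset[OF harm])
      show "cball y s \<subseteq> cball x (\<Lambda> * \<rho>)"
      proof
        fix t assume "t \<in> cball y s"
        then have "dist x t \<le> \<rho> + (2 * A + AG + 2 * \<kappa>) * \<rho>"
          using that dist_triangle[of x t y] by simp
        then show "t \<in> cball x (\<Lambda> * \<rho>)" by (simp add: \<Lambda>_def algebra_simps)
      qed
    qed
    have parts: "2 * A * \<rho> \<le> (2 * A + AG + 2 * \<kappa>) * \<rho>" "AG * \<rho> \<le> (2 * A + AG + 2 * \<kappa>) * \<rho>"
      "2 * \<kappa> * \<rho> \<le> (2 * A + AG + 2 * \<kappa>) * \<rho>"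
      using A AG \<kappa> \<rho>0 by (auto intro!: mult_right_mono)
    have kr: "\<kappa> * (r + 1) \<le> (2 * A + AG + 2 * \<kappa>) * \<rho>" if "r \<le> \<rho>" for r
    proof -
      have "\<kappa> * (r + 1) \<le> \<kappa> * (2 * \<rho>)" using that \<kappa> \<rho>0 by (intro mult_left_mono) auto
      then show ?thesis using parts(3) by (simp add: ac_simps)
    qed
    define d where "d y = \<rho> - dist x y" for y
    define f where "f y = u y * d y powr \<gamma>" for y
    have f0: "0 \<le> f y" for y using u0 by (simp add: f_def)
    have spreadz0: "a * (R / (4 * \<rho>)) powr \<gamma> \<le> u z0"
      if y: "dist x y \<le> \<rho>" and R: "R0 \<le> R" "R \<le> 2 * \<rho>" and a: "0 < a" and ge: "\<forall>t\<in>cball y R. a \<le> u t" for y R a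
    proof -
      have h2: "harmonic_on u (cball y (A * (2 * \<rho>)))"
        by (rule harm_ball[OF y]) (use parts in \<open>simp add: ac_simps\<close>)
      have "dist y z0 \<le> 2 * \<rho>" using y z0 \<rho>0 dist_triangle[of y z0 x] by (simp add: dist_commute)
      with spread[OF _ R(2) _ u a h2 ge] R R0 show ?thesis by simp
    qed
    \<comment> \<open>\<open>Bx\<close> depends on \<open>\<rho>\<close>; it only shows that the
      weighted supremum is finite and does not enter the final constant.\<close>
    obtain Bx where Bx: "0 < Bx" "\<And>u y y'. u \<in> borel_measurable M \<Longrightarrow> (\<forall>x. 0 \<le> u x) \<Longrightarrow>
      harmonic_on u (cball y (\<kappa> * (\<rho> + 1))) \<Longrightarrow> dist y y' \<le> \<rho> \<Longrightarrow> u y \<le> Bx * u y'"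
      using LH[of \<rho>] \<rho>0 by auto
    have ubd: "u y \<le> Bx * u x" if "dist x y \<le> \<rho>" for y
      by (rule Bx(2)[OF _ u harm_ball[OF that kr]]) (use that in \<open>auto simp: dist_commute\<close>)
    have bdd: "bdd_above (f ` cball x \<rho>)"
    proof (rule bdd_aboveI2)
      fix y assume "y \<in> cball x \<rho>"
      then show "f y \<le> Bx * u x * \<rho> powr \<gamma>"
        unfolding f_def using ubd[of y] A u0 Bx by (intro mult_mono powr_mono2) (auto simp: d_def)
    qed
    define \<Phi> where "\<Phi> = Sup (f ` cball x \<rho>)"
    have f\<Phi>: "f y \<le> \<Phi>" if "dist x y \<le> \<rho>" for y
      unfolding \<Phi>_def by (rule cSup_upper) (use that bdd in auto)
    have main: "\<Phi> \<le> 2 * C * (16 * \<rho>) powr \<gamma> * u z0"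
    proof (cases "0 < \<Phi>")
      case False
      have "0 \<le> 2 * C * (16 * \<rho>) powr \<gamma> * u z0" using C u0 by simp
      then show ?thesis using False by linarith
    next
      case True
      then have "\<Phi> / 2 < Sup (f ` cball x \<rho>)" by (simp add: \<Phi>_def)
      then obtain y where y: "dist x y \<le> \<rho>" "\<Phi> / 2 < f y"
        using less_cSupD[of "f ` cball x \<rho>" "\<Phi>/2"] \<rho>0 by force
      have uy: "0 < u y" using y True u0[of y] by (cases "u y = 0") (auto simp: f_def)
      have dy: "0 < d y" using y True by (cases "d y = 0") (auto simp: f_def d_def)
      have "f y \<le> C * (16 * \<rho>) powr \<gamma> * u z0"
      proof (cases "4 * R0 \<le> d y")
        case False
        \<comment> \<open>Close to the boundary no ball of admissible radius fits inside; local
          comparison on the fixed radius \<open>R0\<close> replaces the mean value argument, and the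
          weight is at most \<open>(4 * R0) powr \<gamma>\<close>.\<close>
        have ge: "\<forall>t\<in>cball y R0. u y / CL \<le> u t"
        proof
          fix t assume "t \<in> cball y R0"
          then have "u y \<le> CL * u t" using CL(2)[OF _ u harm_ball[OF y(1) kr[OF \<rho>]]] by simp
          then show "u y / CL \<le> u t" using CL by (simp add: field_simps)
        qed
        have "u y / CL * (R0 / (4 * \<rho>)) powr \<gamma> \<le> u z0"
          by (rule spreadz0[OF y(1)]) (use ge \<rho> R0 uy CL in auto)
        then have "u y * (R0 / (4 * \<rho>)) powr \<gamma> \<le> CL * u z0" using CL by (simp add: field_simps)
        then have "u y * (R0 / (4 * \<rho>)) powr \<gamma> * (16 * \<rho>) powr \<gamma> \<le> CL * u z0 * (16 * \<rho>) powr \<gamma>"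
          by (intro mult_right_mono) auto
        moreover have "(R0 / (4 * \<rho>)) powr \<gamma> * (16 * \<rho>) powr \<gamma> = (4 * R0) powr \<gamma>"
          using R0 \<rho>0 by (simp add: powr_mult[symmetric])
        moreover have "f y \<le> u y * (4 * R0) powr \<gamma>"
          unfolding f_def using False A u0 dy by (intro mult_left_mono powr_mono2) auto
        moreover have "CL * u z0 * (16 * \<rho>) powr \<gamma> \<le> C * u z0 * (16 * \<rho>) powr \<gamma>"
          using C u0 by (intro mult_right_mono) auto
        ultimately show ?thesis by (simp add: mult.assoc mult.commute[of "u z0"])
      next
        case True
        \<comment> \<open>With a quarter of the distance to the boundary, points within
          \<open>2 * R\<close> of \<open>y\<close> keep at least half of the weight's base
          \<open>d y\<close>.\<close>
        define R where "R = d y / 4"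
        have R: "R0 \<le> R" "R \<le> \<rho>"
          using True \<rho>0 zero_le_dist[of x y] unfolding R_def d_def by argo+
        have Rp: "0 < R" using R R0 by simp
        have in_ball: "dist x t \<le> \<rho> \<and> d y / 2 \<le> d t" if "dist y t \<le> 2 * R" for t
          using that dist_triangle[of x t y] dy by (simp add: R_def d_def)
        have le: "u t \<le> N * u y" if t: "dist y t \<le> 2 * R" for t
        proof -
          have "u t * (d y / 2) powr \<gamma> \<le> f t"
            unfolding f_def using in_ball[OF t] dy A u0 by (intro mult_left_mono powr_mono2) auto
          also have "\<dots> \<le> \<Phi>" using in_ball[OF t] by (intro f\<Phi>) simp
          also have "\<dots> \<le> 2 * f y" using y by simp
          also have "\<dots> = N * u y * (d y / 2) powr \<gamma>"
            using dy by (simp add: f_def N_def powr_divide)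
          finally show ?thesis using dy by simp
        qed
        \<comment> \<open>The mean value inequality asks for a globally bounded function. Cutting
          \<open>u\<close> off outside \<open>cball x \<rho>\<close> provides one, and
          \<open>h' \<le> R\<close> keeps the change invisible to the kernel from
          \<open>cball y R\<close>.\<close>
        define w where "w t = (if dist x t \<le> \<rho> then u t else 0)" for t
        have [measurable]: "w \<in> borel_measurable M" unfolding w_def by measurable
        have w0: "\<forall>t. 0 \<le> w t" using u0 by (simp add: w_def)
        have wbd: "\<exists>B. \<forall>t. w t \<le> B"
          by (rule exI[of _ "Bx * u x"]) (use ubd Bx u0 in \<open>auto simp: w_def\<close>)
        have weq: "w t = u t" if "dist y t \<le> 2 * R" for t using in_ball[OF that] by (simp add: w_def)
        have wy: "w y = u y" using Rp by (intro weq) simp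
        have sub: "subharmonic_on w (cball y R)"
          unfolding subharmonic_on_def
        proof
          fix t assume t: "t \<in> cball y R"
          have "harmonic_on u {t}"
          proof (rule harmonic_on_subset[OF harm_ball[OF y(1) parts(2)]])
            have "1 * R \<le> AG * \<rho>" using AG R Rp by (intro mult_mono) auto
            then show "{t} \<subseteq> cball y (AG * \<rho>)" using t by simp
          qed
          then have "ennreal (u t) = (\<integral>\<^sup>+s. ennreal (p t s) * ennreal (u s) \<partial>M)"
            by (simp add: harmonic_on_def)
          also have "\<dots> = (\<integral>\<^sup>+s. ennreal (p t s) * ennreal (w s) \<partial>M)"
          proof (rule nn_integral_cong_AE)
            show "AE s in M. ennreal (p t s) * ennreal (u s) = ennreal (p t s) * ennreal (w s)"
              using p_support[of t]
            proof eventually_elim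
              fix s assume s: "dist t s \<le> h' \<or> p t s = 0"
              show "ennreal (p t s) * ennreal (u s) = ennreal (p t s) * ennreal (w s)"
              proof (cases "p t s = 0")
                case False
                then have "dist y s \<le> 2 * R" using s t R R0 dist_triangle[of y s t] by simp
                then show ?thesis by (simp add: weq)
              qed simp
            qed
          qed
          finally show "ennreal (w t) \<le> (\<integral>\<^sup>+s. ennreal (p t s) * ennreal (w s) \<partial>M)"
            using t Rp by (simp add: weq)
        qed
        have "\<epsilon> * V y R \<le> measure M {t\<in>cball y R. \<sigma> * w y \<le> w t}"
          by (rule frac[OF _ _ w0 wbd sub]) (use R R0 Rp uy le weq wy in auto)
        also have "{t\<in>cball y R. \<sigma> * w y \<le> w t} = {t\<in>cball y R. \<sigma> * u y \<le> u t}"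
          using weq wy Rp by auto
        finally have fr: "\<epsilon> * V y R \<le> measure M {t\<in>cball y R. \<sigma> * u y \<le> u t}" .
        have hG: "harmonic_on u (cball y (AG * R))"
        proof (rule harm_ball[OF y(1)])
          have "AG * R \<le> AG * \<rho>" using AG R by (intro mult_left_mono) auto
          then show "AG * R \<le> (2 * A + AG + 2 * \<kappa>) * \<rho>" using parts(2) by simp
        qed
        have \<sigma>u: "0 < \<sigma> * u y" using RM uy by simp
        have "\<forall>t\<in>cball y (2 * R). \<delta> * (\<sigma> * u y) \<le> u t"
          by (rule GL[OF _ _ u \<sigma>u hG fr]) (use R R0 in auto)
        then have ge: "\<forall>t\<in>cball y R. \<delta> * (\<sigma> * u y) \<le> u t" using Rp by simp
        have "\<delta> * (\<sigma> * u y) * (R / (4 * \<rho>)) powr \<gamma> \<le> u z0"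
          by (rule spreadz0[OF y(1) R(1)]) (use ge R \<rho>0 \<sigma>u AG in auto)
        then have "\<delta> * (\<sigma> * u y) * (R / (4 * \<rho>)) powr \<gamma> * (16 * \<rho>) powr \<gamma> \<le> u z0 * (16 * \<rho>) powr \<gamma>"
          by (intro mult_right_mono) auto
        \<comment> \<open>The exact cancellation: \<open>4 * \<rho>\<close> is twice the spreading
          radius \<open>2 * \<rho>\<close>, and the further factor 4 in \<open>16 * \<rho>\<close>
          turns \<open>R\<close> back into \<open>d y\<close>.\<close>
        moreover have "(R / (4 * \<rho>)) powr \<gamma> * (16 * \<rho>) powr \<gamma> = d y powr \<gamma>"
          using Rp \<rho>0 dy by (simp add: powr_mult[symmetric] R_def)
        ultimately have "\<delta> * \<sigma> * f y \<le> u z0 * (16 * \<rho>) powr \<gamma>" by (simp add: f_def mult.assoc)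
        then have "f y \<le> 1 / (\<delta> * \<sigma>) * (u z0 * (16 * \<rho>) powr \<gamma>)"
          using AG RM by (simp add: field_simps)
        also have "\<dots> \<le> C * (u z0 * (16 * \<rho>) powr \<gamma>)"
          using C u0 by (intro mult_right_mono) auto
        finally show ?thesis by (simp add: ac_simps)
      qed
      then show ?thesis using y by simp
    qed
    have "u y * (\<rho> / 2) powr \<gamma> \<le> f y"
      unfolding f_def using y0 \<rho>0 A u0 by (intro mult_left_mono powr_mono2) (auto simp: d_def)
    also have "\<dots> \<le> \<Phi>" using y0 \<rho>0 by (intro f\<Phi>) simp
    also have "\<dots> \<le> 2 * C * (16 * \<rho>) powr \<gamma> * u z0" by (rule main)
    also have "(16 * \<rho>) powr \<gamma> = 32 powr \<gamma> * (\<rho> / 2) powr \<gamma>" using \<rho>0 by (simp add: powr_mult[symmetric])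
    finally have "u y * (\<rho> / 2) powr \<gamma> \<le> (2 * C * 32 powr \<gamma> * u z0) * (\<rho> / 2) powr \<gamma>" by (simp add: ac_simps)
    then show ?thesis using \<rho>0 by simp
  qed
  have "0 < 2 * C * 32 powr \<gamma>" using C by simp
  then show ?thesis using \<Lambda>1 bound R0 by (intro exI[of _ \<Lambda>] conjI exI[of _ R0] exI[of _ "2 * C * 32 powr \<gamma>"]) auto
qed

end

subsection \<open>Metric measure spaces with a compatible kernel\<close>

text \<open>Closed balls need not be compact here. Local compactness gives one ball of finite
  measure about \<open>x\<close>, and local doubling propagates finiteness to all radii.\<close>

lemma finite_cball_measure:
  fixes M :: "'a::metric_space measure"
  assumes rad: "radon_mm_space M" and vd: "VD_loc M"
  shows "emeasure M (cball x r) < \<infinity>"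
proof -
  have sets: "sets M = sets borel" and cpt: "\<And>K. compact K \<Longrightarrow> emeasure M K < \<infinity>" and lc: "locally compact (UNIV :: 'a set)"
    using rad by (auto simp: radon_mm_space_def)
  obtain U K where U: "open U" "x \<in> U" "U \<subseteq> K" "compact K"
    by (rule locallyE[OF lc, of UNIV x]) (auto intro: that)
  obtain e where e: "0 < e" "cball x e \<subseteq> U" using U open_contains_cball by metis
  have "emeasure M (cball x e) \<le> emeasure M K"
    using U e compact_imp_closed[OF U(4)] by (intro emeasure_mono) (auto simp: sets)
  then have 0: "emeasure M (cball x e) < \<infinity>" using cpt[OF U(4)] by (rule le_less_trans)
  have dbl: "emeasure M (cball x (2^n * e)) < \<infinity>" for n
  proof (induction n)
    case (Suc n)
    have "0 < 2^n * e" using e by simp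
    then obtain C where "\<forall>x. emeasure M (cball x (2 * (2^n * e))) \<le> ennreal C * emeasure M (cball x (2^n * e))"
      using vd unfolding VD_loc_def by blast
    then have "emeasure M (cball x (2 * (2^n * e))) \<le> ennreal C * emeasure M (cball x (2^n * e))" by blast
    also have "\<dots> < \<infinity>" using Suc by (simp add: ennreal_mult_less_top)
    finally show ?case by (simp add: mult.assoc)
  qed (use 0 in simp)
  obtain n where n: "r / e < 2^n" using real_arch_pow[of 2 "r/e"] by auto
  have "cball x r \<subseteq> cball x (2^n * e)" using n e by (intro subset_cball) (simp add: field_simps)
  then have "emeasure M (cball x r) \<le> emeasure M (cball x (2^n * e))" by (intro emeasure_mono) (auto simp: sets)
  then show ?thesis using dbl by (rule le_less_trans)
qed

text \<open>The constants of \<open>VD_loc\<close> may vary wildly with the radius. For radii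
  between \<open>r1\<close> and \<open>r0\<close> both volumes are therefore compared with the
  single radius \<open>r1\<close>, using \<open>VD_loc\<close> at the finitely many radii
  \<open>2^j * r1\<close>.\<close>

lemma large_scale_doubling:
  fixes M :: "'a::metric_space measure"
  assumes rad: "radon_mm_space M" and vd: "VD_loc M" "VD_infty M" and r1: "0 < r1"
  shows "\<exists>D. \<forall>x. \<forall>r\<ge>r1. measure M (cball x (2*r)) \<le> D * measure M (cball x r)"
proof -
  have sets: "sets M = sets borel" using rad by (simp add: radon_mm_space_def)
  have em: "emeasure M (cball x r) = ennreal (measure M (cball x r))" for x r
    using finite_cball_measure[OF rad vd(1), of x r] by (intro emeasure_eq_ennreal_measure) auto
  have mono: "measure M (cball x r) \<le> measure M (cball x s)" if "r \<le> s" for x r s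
    using subset_cball[OF that] finite_cball_measure[OF rad vd(1), of x s] sets
    by (intro measure_mono_fmeasurable) (auto simp: fmeasurable_def)
  have conv: "measure M (cball x (2*r)) \<le> max 0 C * measure M (cball x r)"
    if "emeasure M (cball x (2*r)) \<le> ennreal C * emeasure M (cball x r)" for C x r
  proof -
    have "ennreal (measure M (cball x (2*r))) \<le> ennreal (max 0 C * measure M (cball x r))"
      using that unfolding em by (simp add: ennreal_mult ennreal_max_0)
    then show ?thesis by simp
  qed
  obtain r0 C where r0: "0 < r0" and C: "\<And>x r. r0 \<le> r \<Longrightarrow> measure M (cball x (2*r)) \<le> max 0 C * measure M (cball x r)"
    using vd(2) conv unfolding VD_infty_def by meson
  have loc: "\<exists>C\<ge>0. \<forall>x. measure M (cball x (2*r)) \<le> C * measure M (cball x r)" if r: "0 < r" for r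
  proof -
    obtain C where "\<forall>x. emeasure M (cball x (2*r)) \<le> ennreal C * emeasure M (cball x r)"
      using vd(1)[unfolded VD_loc_def, rule_format, OF r] ..
    then have "\<forall>x. measure M (cball x (2*r)) \<le> max 0 C * measure M (cball x r)" using conv by blast
    then show ?thesis by (intro exI[of _ "max 0 C"]) auto
  qed
  have "\<exists>E\<ge>0. \<forall>x. measure M (cball x (2^n * r1)) \<le> E * measure M (cball x r1)" for n
  proof (induction n)
    case 0
    show ?case by (rule exI[of _ 1]) simp
  next
    case (Suc n)
    then obtain E where E: "0 \<le> E" "\<And>x. measure M (cball x (2^n * r1)) \<le> E * measure M (cball x r1)" by blast
    have "0 < 2^n * r1" using r1 by simp
    from loc[OF this] obtain F where F: "0 \<le> F"
      "\<And>x. measure M (cball x (2*(2^n * r1))) \<le> F * measure M (cball x (2^n * r1))" by blast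
    have "measure M (cball x (2^Suc n * r1)) \<le> (F * E) * measure M (cball x r1)" for x
      using order_trans[OF F(2)[of x] mult_left_mono[OF E(2) F(1)]] by (simp add: mult.assoc)
    then show ?case using E F by (intro exI[of _ "F * E"]) auto
  qed
  moreover obtain n where n: "2 * r0 / r1 < 2^n" using real_arch_pow[of 2 "2*r0/r1"] by auto
  ultimately obtain E where E: "0 \<le> E" "\<And>x. measure M (cball x (2^n * r1)) \<le> E * measure M (cball x r1)" by blast
  have "measure M (cball x (2*r)) \<le> (max 0 C + E) * measure M (cball x r)" if r: "r1 \<le> r" for x r
  proof (cases "r0 \<le> r")
    case True
    have "measure M (cball x (2*r)) \<le> max 0 C * measure M (cball x r)" by (rule C[OF True])
    also have "\<dots> \<le> (max 0 C + E) * measure M (cball x r)" using E by (intro mult_right_mono) auto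
    finally show ?thesis .
  next
    case False
    have "2 * r0 \<le> 2^n * r1" using n r1 by (simp add: field_simps)
    then have "measure M (cball x (2*r)) \<le> measure M (cball x (2^n * r1))" using False by (intro mono) simp
    also have "\<dots> \<le> E * measure M (cball x r1)" by (rule E)
    also have "\<dots> \<le> E * measure M (cball x r)" using E r by (intro mult_left_mono mono) auto
    also have "\<dots> \<le> (max 0 C + E) * measure M (cball x r)" by (intro mult_right_mono) auto
    finally show ?thesis .
  qed
  then show ?thesis by blast
qed

text \<open>The lower kernel bound on \<open>cball y h\<close> dominates the normalised indicator
  there, so \<open>grad_sq\<close> is at most \<open>1 / c1\<close> times the energy; hence the
  Poincare constant \<open>CP / c1\<close>.\<close>

lemma random_walk_space_intro:
  fixes M :: "'a::metric_space measure"
  assumes rad: "radon_mm_space M" and vd: "VD_loc M" "VD_infty M" and P: "poincare_h M h"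
    and mk: "markov_kernel M p" and comp: "compatible M p h h'" and h: "0 < h"
  shows "\<exists>c1 C1 CP C2 r0. random_walk_space M p h h' c1 C1 CP C2 r0"
proof -
  have spM: "space M = UNIV" and sets: "sets M = sets borel"
    using rad by (auto simp: radon_mm_space_def)
  have pos: "0 < emeasure M (cball x r)" if "0 < r" for x r
  proof -
    have "0 < emeasure M (ball x r)" using rad that unfolding radon_mm_space_def by blast
    also have "\<dots> \<le> emeasure M (cball x r)" using sets by (intro emeasure_mono) auto
    finally show ?thesis .
  qed
  note fin = finite_cball_measure[OF rad vd(1)]
  have em: "emeasure M (cball x r) = ennreal (measure M (cball x r))" for x r
    using fin[of x r] by (intro emeasure_eq_ennreal_measure) auto
  have Vp: "0 < measure M (cball x r)" if "0 < r" for x r using pos[OF that, of x] unfolding em by simp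
  have h': "h \<le> h'" using comp by (simp add: compatible_def)
  have p_meas [measurable]: "(\<lambda>z. p (fst z) (snd z)) \<in> borel_measurable (M \<Otimes>\<^sub>M M)"
    and p0: "\<And>x y. 0 \<le> p x y" and pint: "\<And>x. integrable M (p x)" "\<And>x. (\<integral>y. p x y \<partial>M) = 1"
    using mk by (auto simp: markov_kernel_def)
  have mass: "(\<integral>\<^sup>+y. ennreal (p x y) \<partial>M) = 1" for x
    using nn_integral_eq_integral[OF pint(1), of x] pint(2) p0 by simp
  obtain c1 C1 where c1: "0 < c1" "0 < C1" and bds: "\<And>x. AE y in M.
        ennreal c1 / emeasure M (cball x h) * indicator (cball x h) y \<le> ennreal (p x y) \<and>
        ennreal (p x y) \<le> ennreal C1 / emeasure M (cball x h') * indicator (cball x h') y"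
    using comp unfolding compatible_def by blast
  have lower: "AE y in M. y \<in> cball x h \<longrightarrow> c1 / measure M (cball x h) \<le> p x y" for x
    using bds[of x]
  proof eventually_elim
    fix y assume a: "ennreal c1 / emeasure M (cball x h) * indicator (cball x h) y \<le> ennreal (p x y) \<and>
        ennreal (p x y) \<le> ennreal C1 / emeasure M (cball x h') * indicator (cball x h') y"
    show "y \<in> cball x h \<longrightarrow> c1 / measure M (cball x h) \<le> p x y"
    proof
      assume "y \<in> cball x h"
      then have "ennreal (c1 / measure M (cball x h)) \<le> ennreal (p x y)"
        using a c1 Vp[OF h, of x] by (simp add: em divide_ennreal)
      then show "c1 / measure M (cball x h) \<le> p x y" using p0 by simp
    qed
  qed
  have upper: "AE y in M. p x y \<le> C1 / measure M (cball x h') * indicator (cball x h') y" for x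
    using bds[of x]
  proof eventually_elim
    fix y assume a: "ennreal c1 / emeasure M (cball x h) * indicator (cball x h) y \<le> ennreal (p x y) \<and>
        ennreal (p x y) \<le> ennreal C1 / emeasure M (cball x h') * indicator (cball x h') y"
    have V': "0 < measure M (cball x h')" using h h' by (intro Vp) simp
    show "p x y \<le> C1 / measure M (cball x h') * indicator (cball x h') y"
    proof (cases "y \<in> cball x h'")
      case True
      then have "ennreal (p x y) \<le> ennreal (C1 / measure M (cball x h'))"
        using a c1 V' by (simp add: em divide_ennreal)
      then show ?thesis using True c1 V' by simp
    next
      case False
      then have "ennreal (p x y) \<le> 0" using a by simp
      then show ?thesis using False p0[of x y] by simp
    qed
  qed
  obtain CP C2 r0 where CP: "0 < CP" "1 \<le> C2" "0 < r0" and PI: "\<And>f x r. Linf_loc M f \<Longrightarrow> r0 \<le> r \<Longrightarrow>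
     (\<integral>\<^sup>+ y. ennreal ((f y - ball_avg M f (cball x r))^2) * indicator (cball x r) y \<partial>M)
       \<le> ennreal (CP * r^2) * (\<integral>\<^sup>+ y. grad_sq M h f y * indicator (cball x (C2*r)) y \<partial>M)"
    using P unfolding poincare_h_def by blast
  have poincare: "\<exists>m. (\<integral>\<^sup>+y. ennreal ((f y - m)^2) * indicator (cball x r) y \<partial>M)
        \<le> ennreal (CP / c1 * r^2) *
          (\<integral>\<^sup>+y. (\<integral>\<^sup>+z. ennreal (p y z) * ennreal ((f y - f z)^2) \<partial>M) * indicator (cball x (C2*r)) y \<partial>M)"
    if f [measurable]: "f \<in> borel_measurable M" and bd: "\<And>y. \<bar>f y\<bar> \<le> B" and r: "r0 \<le> r" for f B x r
  proof -
    have p_meas1 [measurable]: "p y \<in> borel_measurable M" for y using pint(1) by (rule borel_measurable_integrable)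
    have grad: "grad_sq M h f y \<le> ennreal (1 / c1) * (\<integral>\<^sup>+z. ennreal (p y z) * ennreal ((f y - f z)^2) \<partial>M)" for y
    proof -
      have V: "0 < measure M (cball y h)" by (rule Vp[OF h])
      have "(\<integral>\<^sup>+ z. ennreal ((f z - f y)^2) * indicator (cball y h) z \<partial>M)
         \<le> (\<integral>\<^sup>+ z. ennreal (measure M (cball y h) / c1) * (ennreal (p y z) * ennreal ((f y - f z)^2)) \<partial>M)"
      proof (rule nn_integral_mono_AE)
        show "AE z in M. ennreal ((f z - f y)^2) * indicator (cball y h) z
           \<le> ennreal (measure M (cball y h) / c1) * (ennreal (p y z) * ennreal ((f y - f z)^2))"
          using lower[of y]
        proof eventually_elim
          fix z assume a: "z \<in> cball y h \<longrightarrow> c1 / measure M (cball y h) \<le> p y z"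
          show "ennreal ((f z - f y)^2) * indicator (cball y h) z
           \<le> ennreal (measure M (cball y h) / c1) * (ennreal (p y z) * ennreal ((f y - f z)^2))"
          proof (cases "z \<in> cball y h")
            case True
            then have "1 \<le> measure M (cball y h) / c1 * p y z" using a V c1 by (simp add: field_simps)
            then have "1 * (f z - f y)^2 \<le> measure M (cball y h) / c1 * p y z * (f y - f z)^2"
              unfolding power2_commute[of "f z"] by (rule mult_right_mono) simp
            then have "ennreal ((f z - f y)^2) \<le> ennreal (measure M (cball y h) / c1 * (p y z * (f y - f z)^2))"
              by (intro ennreal_leI) (simp add: mult.assoc)
            also have "\<dots> = ennreal (measure M (cball y h) / c1) * (ennreal (p y z) * ennreal ((f y - f z)^2))"
              using c1 p0 by (simp add: ennreal_mult[symmetric])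
            finally show ?thesis using True by simp
          qed simp
        qed
      qed
      also have "\<dots> = ennreal (measure M (cball y h) / c1) * (\<integral>\<^sup>+z. ennreal (p y z) * ennreal ((f y - f z)^2) \<partial>M)"
        by (rule nn_integral_cmult) measurable
      finally have "grad_sq M h f y \<le> ennreal (measure M (cball y h) / c1) *
          (\<integral>\<^sup>+z. ennreal (p y z) * ennreal ((f y - f z)^2) \<partial>M) / ennreal (measure M (cball y h))"
        unfolding grad_sq_def em by (rule divide_right_mono_ennreal)
      also have "\<dots> = ennreal (measure M (cball y h) / c1) * inverse (ennreal (measure M (cball y h))) *
          (\<integral>\<^sup>+z. ennreal (p y z) * ennreal ((f y - f z)^2) \<partial>M)"
        by (simp add: divide_ennreal_def ac_simps)
      also have "ennreal (measure M (cball y h) / c1) * inverse (ennreal (measure M (cball y h))) = ennreal (1 / c1)"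
        using V c1 by (simp add: inverse_ennreal ennreal_mult[symmetric] field_simps)
      finally show ?thesis .
    qed
    have "Linf_loc M f" unfolding Linf_loc_def using f bd by blast
    from PI[OF this r, of x]
    have "(\<integral>\<^sup>+ y. ennreal ((f y - ball_avg M f (cball x r))^2) * indicator (cball x r) y \<partial>M)
       \<le> ennreal (CP * r^2) * (\<integral>\<^sup>+ y. grad_sq M h f y * indicator (cball x (C2*r)) y \<partial>M)" .
    also have "\<dots> \<le> ennreal (CP * r^2) * (\<integral>\<^sup>+ y. ennreal (1 / c1) *
       ((\<integral>\<^sup>+z. ennreal (p y z) * ennreal ((f y - f z)^2) \<partial>M) * indicator (cball x (C2*r)) y) \<partial>M)"
      unfolding mult.assoc[symmetric] by (intro mult_left_mono nn_integral_mono mult_right_mono grad) simp_all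
    also have "(\<integral>\<^sup>+ y. ennreal (1 / c1) *
       ((\<integral>\<^sup>+z. ennreal (p y z) * ennreal ((f y - f z)^2) \<partial>M) * indicator (cball x (C2*r)) y) \<partial>M)
      = ennreal (1 / c1) * (\<integral>\<^sup>+ y. (\<integral>\<^sup>+z. ennreal (p y z) * ennreal ((f y - f z)^2) \<partial>M) * indicator (cball x (C2*r)) y \<partial>M)"
    proof (rule nn_integral_cmult)
      interpret sigma_finite_measure M
        by (rule sigma_finite_of_finite_cballs[OF spM sets]) (simp add: em)
      have "(\<lambda>y. \<integral>\<^sup>+z. ennreal (p y z) * ennreal ((f y - f z)^2) \<partial>M) \<in> borel_measurable M"
      proof (rule borel_measurable_nn_integral)
        have "(\<lambda>z. ennreal (p (fst z) (snd z)) * ennreal ((f (fst z) - f (snd z))^2)) \<in> borel_measurable (M \<Otimes>\<^sub>M M)"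
          by measurable
        then show "(\<lambda>(y, z). ennreal (p y z) * ennreal ((f y - f z)^2)) \<in> borel_measurable (M \<Otimes>\<^sub>M M)"
          by (simp add: case_prod_beta')
      qed
      then show "(\<lambda>y. (\<integral>\<^sup>+z. ennreal (p y z) * ennreal ((f y - f z)^2) \<partial>M) * indicator (cball x (C2*r)) y) \<in> borel_measurable M"
        by (intro borel_measurable_times_ennreal borel_measurable_indicator) (auto simp: sets)
    qed
    also have "ennreal (CP * r^2) * (ennreal (1 / c1) * (\<integral>\<^sup>+ y. (\<integral>\<^sup>+z. ennreal (p y z) * ennreal ((f y - f z)^2) \<partial>M) * indicator (cball x (C2*r)) y \<partial>M))
      = ennreal (CP / c1 * r^2) * (\<integral>\<^sup>+ y. (\<integral>\<^sup>+z. ennreal (p y z) * ennreal ((f y - f z)^2) \<partial>M) * indicator (cball x (C2*r)) y \<partial>M)"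
      using CP c1 by (simp add: mult.assoc[symmetric] ennreal_mult[symmetric])
    finally show ?thesis by blast
  qed
  have sym: "AE z in M \<Otimes>\<^sub>M M. p (fst z) (snd z) = p (snd z) (fst z)" using comp by (simp add: compatible_def)
  have CP1: "0 < CP / c1" using CP c1 by simp
  have "random_walk_space M p h h' c1 C1 (CP / c1) C2 r0"
    by (rule random_walk_space.intro)
      (fact spM sets fin pos large_scale_doubling[OF rad vd] h h' p_meas p0 mass sym c1 lower upper CP CP1 poincare)+
  then show ?thesis by blast
qed

section \<open>Essential bounds and the elliptic Harnack inequality for Markov operators\<close>

lemma esssup_le_essinf:
  assumes sp: "space M = UNIV" and A: "A \<in> sets M" and u: "u \<in> borel_measurable M" and C: "0 < C"
    and le: "\<And>y z. y \<in> A \<Longrightarrow> z \<in> A \<Longrightarrow> u y \<le> C * u z"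
  shows "esssup_on M A u \<le> ereal C * essinf_on M A u"
proof -
  have [measurable]: "u \<in> borel_measurable (restrict_space M A)" using u by (rule measurable_restrict_space1)
  have spA: "space (restrict_space M A) = A" using sp by (simp add: space_restrict_space)
  have "ereal (u y) \<le> ereal C * essinf_on M A u" if y: "y \<in> A" for y
  proof -
    have "esssup (restrict_space M A) (\<lambda>z. - ereal (u z)) \<le> - ereal (u y / C)"
    proof (rule esssup_I)
      show "(\<lambda>z. - ereal (u z)) \<in> borel_measurable (restrict_space M A)" by measurable
      show "AE z in restrict_space M A. - ereal (u z) \<le> - ereal (u y / C)"
      proof (rule AE_I2)
        fix z assume "z \<in> space (restrict_space M A)"
        then show "- ereal (u z) \<le> - ereal (u y / C)" using le[OF y, of z] C by (simp add: spA field_simps)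
      qed
    qed
    then have "ereal (u y / C) \<le> essinf_on M A u" unfolding essinf_on_def
      using ereal_minus_le_minus[of "- ereal (u y / C)"] by (metis ereal_uminus_uminus)
    then have "ereal C * ereal (u y / C) \<le> ereal C * essinf_on M A u" using C by (intro ereal_mult_left_mono) auto
    then show ?thesis using C by simp
  qed
  then show ?thesis unfolding esssup_on_def
    by (intro esssup_I AE_I2) (auto simp: spA)
qed

theorem theorem6p3:
  fixes M :: "'a::metric_space measure" and p :: "'a \<Rightarrow> 'a \<Rightarrow> real"
    and b h h' :: real
  assumes "radon_mm_space M"
    and "quasi_b_geodesic b TYPE('a)"
    and "VD_loc M" and "VD_infty M"
    and "poincare_h M h"
    and "markov_kernel M p"
    and "compatible M p h h'"
    and "h > b"
  shows "\<exists>c. 0 < c \<and> c < 1 \<and> (\<exists>r0>0. \<exists>C_E>0. \<forall>x r u.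
           r \<ge> r0 \<longrightarrow> u \<in> borel_measurable M \<longrightarrow>
           (\<forall>y\<in>cball x (r + h'). u y \<ge> 0) \<longrightarrow>
           P_harmonic_in M p u (cball x r) \<longrightarrow>
           esssup_on M (cball x (c*r)) u \<le> ereal C_E * essinf_on M (cball x (c*r)) u)"
proof -
  have sp: "space M = UNIV" and sets: "sets M = sets borel"
    using assms(1) by (auto simp: radon_mm_space_def)
  show ?thesis
  proof (cases "0 \<le> b")
    case False
    \<comment> \<open>For negative \<open>b\<close> no step is admissible, so only chains without
      steps exist and any two points coincide.\<close>
    have single: "x = y" for x y :: 'a
    proof -
      have "0 \<le> b" if "x \<noteq> y"
      proof -
        obtain z m where zm: "z 0 = x" "z m = y" "\<forall>i<m. dist (z i) (z (Suc i)) \<le> b"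
          using quasi_geodesic_chain[OF assms(2)] by metis
        have "0 < m" using zm that by (cases m) auto
        then have "dist (z 0) (z (Suc 0)) \<le> b" using zm(3) by blast
        then show ?thesis using zero_le_dist order_trans by blast
      qed
      then show ?thesis using False by blast
    qed
    have "esssup_on M (cball x (1/2*r)) u \<le> ereal 1 * essinf_on M (cball x (1/2*r)) u"
      if "u \<in> borel_measurable M" for x r and u :: "'a \<Rightarrow> real"
    proof (rule esssup_le_essinf[OF sp _ that])
      fix y z :: 'a
      show "u y \<le> 1 * u z" using single[of y z] by simp
    qed (simp_all add: sets)
    then show ?thesis by (intro exI[of _ "1/2"] conjI exI[of _ 1]) auto
  next
    case True
    then have h: "0 < h" using assms(8) by simp
    obtain c1 C1 CP C2 r0 where "random_walk_space M p h h' c1 C1 CP C2 r0"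
      using random_walk_space_intro[OF assms(1,3-7) h] by blast
    then interpret random_walk_space M p h h' c1 C1 CP C2 r0 .
    obtain \<Lambda> R0 C where \<Lambda>: "1 \<le> \<Lambda>" "0 < R0" "0 < C" and EH: "\<And>x \<rho> u. R0 \<le> \<rho> \<Longrightarrow> u \<in> borel_measurable M \<Longrightarrow> (\<forall>x. 0 \<le> u x) \<Longrightarrow>
     harmonic_on u (cball x (\<Lambda> * \<rho>)) \<Longrightarrow> (\<forall>y\<in>cball x (\<rho>/2). \<forall>z\<in>cball x (\<rho>/2). u y \<le> C * u z)"
      using elliptic_harnack[OF assms(2) True assms(8)] by blast
    \<comment> \<open>\<open>1 / \<Lambda>\<close> shrinks the ball of harmonicity to the radius of
      \<open>elliptic_harnack\<close>, and its conclusion concerns half of that radius.\<close>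
    define c where "c = 1 / (2 * \<Lambda>)"
    have c: "0 < c" "c < 1" "c \<le> 1 / 2" using \<Lambda> by (auto simp: c_def field_simps)
    have h'0: "0 < h'" using h_pos h_le by simp
    have main: "esssup_on M (cball x (c*r)) u \<le> ereal C * essinf_on M (cball x (c*r)) u"
      if r: "\<Lambda> * R0 \<le> r" and u [measurable]: "u \<in> borel_measurable M" and nonneg: "\<forall>y\<in>cball x (r + h'). u y \<ge> 0"
        and harm: "P_harmonic_in M p u (cball x r)" for x r u
    proof -
      have r0: "0 < r" using r \<Lambda> by (meson less_le_trans mult_pos_pos zero_less_one)
      \<comment> \<open>\<open>u\<close> is nonnegative only on \<open>cball x (r + h')\<close>.
        Setting it to 0 outside makes it so everywhere, and the kernel from \<open>cball x r\<close>
        does not see the difference.\<close>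
      define v where "v y = (if dist x y \<le> r + h' then u y else 0)" for y
      have [measurable]: "v \<in> borel_measurable M" unfolding v_def by measurable
      have v0: "0 \<le> v y" for y using nonneg by (simp add: v_def)
      have hv: "harmonic_on v (cball x r)"
        unfolding harmonic_on_def
      proof
        fix y assume y: "y \<in> cball x r"
        have int: "integrable M (\<lambda>z. p y z * u z)" and eq: "u y = (\<integral>z. p y z * u z \<partial>M)"
          using harm y by (auto simp: P_harmonic_in_def markov_op_def)
        have ae: "AE z in M. p y z * u z = p y z * v z"
          using p_support[of y]
        proof eventually_elim
          fix z assume z: "dist y z \<le> h' \<or> p y z = 0"
          show "p y z * u z = p y z * v z"
          proof (cases "p y z = 0")
            case False
            then have "dist x z \<le> r + h'" using z y dist_triangle[of x z y] by simp
            then show ?thesis by (simp add: v_def)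
          qed simp
        qed
        have int': "integrable M (\<lambda>z. p y z * v z)"
          by (rule integrable_cong_AE_imp[OF int]) (use ae in \<open>auto elim!: eventually_mono\<close>)
        have "(\<integral>\<^sup>+z. ennreal (p y z) * ennreal (v z) \<partial>M) = (\<integral>\<^sup>+z. ennreal (p y z * v z) \<partial>M)"
          using v0 p_nonneg by (simp add: ennreal_mult)
        also have "\<dots> = ennreal (\<integral>z. p y z * v z \<partial>M)"
          using v0 p_nonneg by (intro nn_integral_eq_integral int') simp
        also have "(\<integral>z. p y z * v z \<partial>M) = (\<integral>z. p y z * u z \<partial>M)"
          by (rule integral_cong_AE) (use ae in \<open>auto elim!: eventually_mono\<close>)
        also have "\<dots> = v y" using eq y h'0 by (simp add: v_def)
        finally show "ennreal (v y) = (\<integral>\<^sup>+z. ennreal (p y z) * ennreal (v z) \<partial>M)" by simp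
      qed
      have "\<forall>y\<in>cball x (r / \<Lambda> / 2). \<forall>z\<in>cball x (r / \<Lambda> / 2). v y \<le> C * v z"
      proof (rule EH)
        show "R0 \<le> r / \<Lambda>" using r \<Lambda> by (simp add: field_simps)
        show "harmonic_on v (cball x (\<Lambda> * (r / \<Lambda>)))" using hv \<Lambda> by simp
      qed (use v0 in simp_all)
      moreover have "r / \<Lambda> / 2 = c * r" by (simp add: c_def)
      ultimately have vv: "v y \<le> C * v z" if "y \<in> cball x (c * r)" "z \<in> cball x (c * r)" for y z
        using that by simp
      have "c * r \<le> 1 * r" using c r0 by (intro mult_right_mono) auto
      then have "c * r \<le> r + h'" using h'0 by simp
      then have uv: "u y = v y" if "y \<in> cball x (c * r)" for y using that by (simp add: v_def)
      show ?thesis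
      proof (rule esssup_le_essinf[OF sp _ u \<Lambda>(3)])
        show "u y \<le> C * u z" if "y \<in> cball x (c * r)" "z \<in> cball x (c * r)" for y z
          using vv[OF that] that by (simp add: uv)
      qed (simp add: sets)
    qed
    have "0 < \<Lambda> * R0" using \<Lambda> by (intro mult_pos_pos) auto
    then show ?thesis using c(1,2) \<Lambda>(3) main
      by (intro exI[of _ c] conjI exI[of _ "\<Lambda> * R0"] exI[of _ C] allI impI)
  qed
qed

end
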